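(* Let $\mathbf z_1,\dots,\mathbf z_n$ be a random sample from the distribution of a random vector $\mathbf z\in\mathbb R^p$ with mutually independent components having mean $0$ and variance $1$. Notation is as in the context. (i) Suppose $\mathbf z$ has finite sixth moments and at most one of $\gamma_1,\dots,\gamma_p$ is zero. Then for $\alpha=1$ there is a sequence of deflation-based solutions $\hat{\mathbf W}\to_P\mathbf I_p$ such that the limiting distribution of $\sqrt n\,\mathrm{vec}(\hat{\mathbf W}-\mathbf I_p)$ is multivariate normal with mean vector $\mathbf 0$ and elementwise variances $$ASV(\hat w_{kl})=\frac{\zeta_{11l}}{\gamma_l^4}+1\ (l<k),\qquad ASV(\hat w_{kk})=\frac{\kappa_k+2}{4},\qquad ASV(\hat w_{kl})=\frac{\zeta_{11k}}{\gamma_k^4}\ (l>k),$$ where $\zeta_{11k}=\gamma_k^2(\nu_k-\gamma_k^2)$. (ii) Suppose $\mathbf z$ has finite eighth moments and at most one of $\kappa_1,\dots,\kappa_p$ is zero. Then for $\alpha=0$ there is a sequence of deflation-based solutions $\hat{\mathbf W}\to_P\mathbf I_p$ such that the limiting distribution of $\sqrt n\,\mathrm{vec}(\hat{\mathbf W}-\mathbf I_p)$ is multivariate normal with mean vector $\mathbf 0$ and elementwise variances $$ASV(\hat w_{kl})=\frac{\zeta_{22l}}{\kappa_l^4}+1\ (l<k),\qquad ASV(\hat w_{kk})=\frac{\kappa_k+2}{4},\qquad ASV(\hat w_{kl})=\frac{\zeta_{22k}}{\kappa_k^4}\ (l>k),$$ where $\zeta_{22k}=\kappa_k^2(\omega_k-\beta_k^2)$.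 (iii) Suppose $\mathbf z$ has finite eighth moments and $\gamma_k=\kappa_k=0$ for at most one $k$. Then there is a sequence of deflation-based solutions $\hat{\mathbf W}\to_P\mathbf I_p$ based on both skewness and kurtosis such that the limiting distribution of $\sqrt n\,\mathrm{vec}(\hat{\mathbf W}-\mathbf I_p)$ is multivariate normal with mean vector $\mathbf 0$ and elementwise variances $$ASV(\hat w_{kl})=\frac{9\alpha^2\zeta_{11l}+16(1-\alpha)^2\zeta_{22l}+24\alpha(1-\alpha)\zeta_{12l}}{(3\alpha\gamma_l^2+4(1-\alpha)\kappa_l^2)^2}+1,\quad l<k,$$ $$ASV(\hat w_{kk})=\frac{\kappa_k+2}{4},$$ $$ASV(\hat w_{kl})=\frac{9\alpha^2\zeta_{11k}+16(1-\alpha)^2\zeta_{22k}+24\alpha(1-\alpha)\zeta_{12k}}{(3\alpha\gamma_k^2+4(1-\alpha)\kappa_k^2)^2},\quad l>k,$$ where $\alpha\in[0,1]$ is the proportion of weight given to skewness, $\zeta_{11k},\zeta_{22k}$ are as in (i), (ii), and $\zeta_{12k}=\gamma_k\kappa_k(\eta_k-\gamma_k\beta_k)$.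
   Context: Moments, with $z_k$ the $k$th component of $\mathbf z$: $\gamma_k=E(z_k^3)$, $\beta_k=E(z_k^4)$, $\kappa_k=\beta_k-3$, $\omega_k=E(z_k^6)-E(z_k^3)^2$, $\nu_k=E(z_k^4)-1$, $\eta_k=E(z_k^5)-E(z_k^3)$. $ASV(\hat w_{kl})$ denotes the variance of the $(k,l)$ coordinate of the limiting distribution of $\sqrt n(\hat{\mathbf W}-\mathbf I_p)$ as $n\to\infty$. Deflation-based projection pursuit functional with weight $\alpha\in[0,1]$ (the proportion of weight given to third cumulants, i.e. skewness): for a random vector $\mathbf x$ with covariance matrix $\boldsymbol\Sigma$ and standardized version $\mathbf x_{st}=\boldsymbol\Sigma^{-1/2}(\mathbf x-E\mathbf x)$ (symmetric positive definite root), the functional is $\mathbf W=\mathbf U\boldsymbol\Sigma^{-1/2}$, where the rows of the orthogonal matrix $\mathbf U=(\mathbf u_1,\dots,\mathbf u_p)^T$ are found one by one, $\mathbf u_k$ maximizing $\alpha\gamma^2(\mathbf u^T\mathbf x_{st})+(1-\alpha)\kappa^2(\mathbf u^T\mathbf x_{st})$ over unit vectors $\mathbf u$ orthogonal to $\mathbf u_1,\dots,\mathbf u_{k-1}$, with $\gamma(y)$ and $\kappa(y)$ the third moment and the fourth moment minus $3$ of the standardized version of $y$. The estimating equations obtained from this maximization problem are $(\mathbf I_p-\sum_{j=1}^k\mathbf u_j\mathbf u_j^T)\mathbf T_k=\mathbf 0$, $k=1,\dots,p$, with $$\mathbf T_k=3\alpha E[(\mathbf u_k^T\mathbf x_{st})^3]E[(\mathbf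 u_k^T\mathbf x_{st})^2\mathbf x_{st}]+4(1-\alpha)\left(E[(\mathbf u_k^T\mathbf x_{st})^4]-3\right)E[(\mathbf u_k^T\mathbf x_{st})^3\mathbf x_{st}].$$ A deflation-based solution $\hat{\mathbf W}=(\hat w_{kl})$ is the sample version of this functional, i.e. the functional applied to the empirical distribution of $\mathbf z_1,\dots,\mathbf z_n$: $\hat{\mathbf W}=\hat{\mathbf U}\hat{\boldsymbol\Sigma}^{-1/2}$ with $\bar{\mathbf z}=\frac1n\sum_i\mathbf z_i$, $\hat{\boldsymbol\Sigma}=\frac1n\sum_i(\mathbf z_i-\bar{\mathbf z})(\mathbf z_i-\bar{\mathbf z})^T$, and $\hat{\mathbf U}$ obtained with expectations over $\mathbf x_{st}$ replaced by averages over $\hat{\boldsymbol\Sigma}^{-1/2}(\mathbf z_i-\bar{\mathbf z})$, $i=1,\dots,n$.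
   Formalization: Rows of U are local maximizers (global too if the components' index values strictly decrease), as global ones need not converge to I_p; a component of index zero must come last, and (iii) at α=1 or 0 also assumes the condition of (i) or (ii), since otherwise the variances are 0/0. *)

theory Defs
  imports "HOL-Probability.Probability"
begin

definition gam :: "(real^'p) measure \<Rightarrow> 'p \<Rightarrow> real" where
  "gam D k = (\<integral>v. (v $ k) ^ 3 \<partial>D)"

definition bet :: "(real^'p) measure \<Rightarrow> 'p \<Rightarrow> real" where
  "bet D k = (\<integral>v. (v $ k) ^ 4 \<partial>D)"

definition kap :: "(real^'p) measure \<Rightarrow> 'p \<Rightarrow> real" where
  "kap D k = bet D k - 3"

definition omg :: "(real^'p) measure \<Rightarrow> 'p \<Rightarrow> real" where
  "omg D k = (\<integral>v. (v $ k) ^ 6 \<partial>D) - (\<integral>v. (v $ k) ^ 3 \<partial>D)\<^sup>2"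

definition nu :: "(real^'p) measure \<Rightarrow> 'p \<Rightarrow> real" where
  "nu D k = (\<integral>v. (v $ k) ^ 4 \<partial>D) - 1"

definition eta :: "(real^'p) measure \<Rightarrow> 'p \<Rightarrow> real" where
  "eta D k = (\<integral>v. (v $ k) ^ 5 \<partial>D) - (\<integral>v. (v $ k) ^ 3 \<partial>D)"

definition zeta11 :: "(real^'p) measure \<Rightarrow> 'p \<Rightarrow> real" where
  "zeta11 D k = (gam D k)\<^sup>2 * (nu D k - (gam D k)\<^sup>2)"

definition zeta22 :: "(real^'p) measure \<Rightarrow> 'p \<Rightarrow> real" where
  "zeta22 D k = (kap D k)\<^sup>2 * (omg D k - (bet D k)\<^sup>2)"

definition zeta12 :: "(real^'p) measure \<Rightarrow> 'p \<Rightarrow> real" where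
  "zeta12 D k = gam D k * kap D k * (eta D k - gam D k * bet D k)"

definition mean_vector :: "(real^'p) measure \<Rightarrow> real^'p" where
  "mean_vector D = (\<chi> k. \<integral>v. v $ k \<partial>D)"

definition covariance_matrix :: "(real^'p) measure \<Rightarrow> real^'p^'p" where
  "covariance_matrix D =
    (\<chi> k l. \<integral>v. (v $ k - mean_vector D $ k) * (v $ l - mean_vector D $ l) \<partial>D)"

definition positive_definite :: "real^'p^'p \<Rightarrow> bool" where
  "positive_definite S \<longleftrightarrow> transpose S = S \<and> (\<forall>v. v \<noteq> 0 \<longrightarrow> v \<bullet> (S *v v) > 0)"

definition inv_sqrt :: "real^'p^'p \<Rightarrow> real^'p^'p" where
  "inv_sqrt S = (THE R. positive_definite R \<and> R ** R = matrix_inv S)"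

definition standardize :: "(real^'p) measure \<Rightarrow> real^'p \<Rightarrow> real^'p" where
  "standardize D v = inv_sqrt (covariance_matrix D) *v (v - mean_vector D)"

definition std_moment :: "nat \<Rightarrow> 'a measure \<Rightarrow> ('a \<Rightarrow> real) \<Rightarrow> real" where
  "std_moment r M y =
    (\<integral>\<omega>. ((y \<omega> - prob_space.expectation M y) / sqrt (prob_space.variance M y)) ^ r \<partial>M)"

definition projection_index :: "real \<Rightarrow> (real^'p) measure \<Rightarrow> real^'p \<Rightarrow> real" where
  "projection_index \<alpha> D u =
     \<alpha> * (std_moment 3 D (\<lambda>v. u \<bullet> standardize D v))\<^sup>2
     + (1 - \<alpha>) * (std_moment 4 D (\<lambda>v. u \<bullet> standardize D v) - 3)\<^sup>2"

text \<open>
  The coordinates are indexed by a finite linearly ordered type, which stands for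
  1, ..., p; its order is the order in which the rows are extracted.
\<close>

definition deflation_sphere ::
  "real^'p::{finite,linorder}^'p::{finite,linorder} \<Rightarrow> 'p::{finite,linorder}
    \<Rightarrow> (real^'p::{finite,linorder}) set" where
  "deflation_sphere U k = {u. norm u = 1 \<and> (\<forall>j<k. u \<bullet> row j U = 0)}"

definition deflation_maximizer ::
  "real \<Rightarrow> (real^'p::{finite,linorder}) measure
    \<Rightarrow> real^'p::{finite,linorder}^'p::{finite,linorder} \<Rightarrow> bool" where
  "deflation_maximizer \<alpha> D W \<longleftrightarrow>
    (\<exists>U. orthogonal_matrix U \<and> W = U ** inv_sqrt (covariance_matrix D) \<and>
      (\<forall>k. \<forall>u \<in> deflation_sphere U k.
        projection_index \<alpha> D u \<le> projection_index \<alpha> D (row k U)))"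

text \<open>
  Global maximization extracts the components in decreasing order of their index, so a
  solution that estimates the components in the given order is in general only a local
  maximizer in each row.  Local maximizers still satisfy the estimating equations.
\<close>

definition deflation_solution ::
  "real \<Rightarrow> (real^'p::{finite,linorder}) measure
    \<Rightarrow> real^'p::{finite,linorder}^'p::{finite,linorder} \<Rightarrow> bool" where
  "deflation_solution \<alpha> D W \<longleftrightarrow>
    (\<exists>U. orthogonal_matrix U \<and> W = U ** inv_sqrt (covariance_matrix D) \<and>
      (\<forall>k. \<exists>\<epsilon>>0. \<forall>u \<in> deflation_sphere U k. dist u (row k U) < \<epsilon> \<longrightarrow>
        projection_index \<alpha> D u \<le> projection_index \<alpha> D (row k U)))"

text \<open>
  The index of the k-th coordinate direction under the distribution of a vector with
  independent standardized components.
\<close>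

definition component_index :: "real \<Rightarrow> (real^'p) measure \<Rightarrow> 'p \<Rightarrow> real" where
  "component_index \<alpha> D k = \<alpha> * (gam D k)\<^sup>2 + (1 - \<alpha>) * (kap D k)\<^sup>2"

text \<open>
  A labelling convention: at a coordinate direction of index 0 the index has a minimum, so
  such a direction can only be estimated once no direction of positive index is left.
\<close>

definition zero_index_last :: "real \<Rightarrow> (real^'p::{finite,linorder}) measure \<Rightarrow> bool" where
  "zero_index_last \<alpha> D \<longleftrightarrow>
    (\<forall>k l. k < l \<longrightarrow> component_index \<alpha> D k = 0 \<longrightarrow> component_index \<alpha> D l = 0)"

definition index_decreasing :: "real \<Rightarrow> (real^'p::{finite,linorder}) measure \<Rightarrow> bool" where
  "index_decreasing \<alpha> D \<longleftrightarrow> (\<forall>k l. k < l \<longrightarrow> component_index \<alpha> D l < component_index \<alpha> D k)"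

definition empirical :: "nat \<Rightarrow> (nat \<Rightarrow> real^'p) \<Rightarrow> (real^'p) measure" where
  "empirical n x = distr (uniform_count_measure {..<n}) borel x"

text \<open>
  \<open>W n\<close> is a random matrix obtained from the first \<open>n\<close> observations.  Nothing is required
  at sample points where the sample covariance matrix has no inverse square root.
\<close>

definition sample_version ::
  "((real^'p) measure \<Rightarrow> real^'p^'p \<Rightarrow> bool) \<Rightarrow> 'a measure \<Rightarrow> (nat \<Rightarrow> 'a \<Rightarrow> real^'p)
    \<Rightarrow> (nat \<Rightarrow> 'a \<Rightarrow> real^'p^'p) \<Rightarrow> bool" where
  "sample_version F M z W \<longleftrightarrow>
    (\<forall>n. W n \<in> borel_measurable M) \<and>
    (\<forall>n. \<forall>\<omega>\<in>space M. invertible (covariance_matrix (empirical n (\<lambda>i. z i \<omega>))) \<longrightarrow>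
      F (empirical n (\<lambda>i. z i \<omega>)) (W n \<omega>))"

definition random_sample ::
  "'a measure \<Rightarrow> (real^'p) measure \<Rightarrow> (nat \<Rightarrow> 'a \<Rightarrow> real^'p) \<Rightarrow> bool" where
  "random_sample M D z \<longleftrightarrow>
    prob_space.indep_vars M (\<lambda>_. borel) z UNIV \<and> (\<forall>i. distr M borel (z i) = D)"

definition conv_in_probability ::
  "'a measure \<Rightarrow> (nat \<Rightarrow> 'a \<Rightarrow> 'b::metric_space) \<Rightarrow> 'b \<Rightarrow> bool" where
  "conv_in_probability M X c \<longleftrightarrow>
    (\<forall>\<epsilon>>0. (\<lambda>n. measure M {\<omega> \<in> space M. dist (X n \<omega>) c > \<epsilon>}) \<longlonglongrightarrow> 0)"

definition conv_in_distribution ::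
  "'a measure \<Rightarrow> (nat \<Rightarrow> 'a \<Rightarrow> 'b::euclidean_space) \<Rightarrow> 'b measure \<Rightarrow> bool" where
  "conv_in_distribution M X N \<longleftrightarrow>
    (\<forall>f :: 'b \<Rightarrow> real. continuous_on UNIV f \<longrightarrow> bounded (range f) \<longrightarrow>
      (\<lambda>n. \<integral>\<omega>. f (X n \<omega>) \<partial>M) \<longlonglongrightarrow> (\<integral>x. f x \<partial>N))"

text \<open>Degenerate normal laws are included, since the asymptotic covariance can be singular.\<close>

definition normal_law :: "real \<Rightarrow> real \<Rightarrow> real measure" where
  "normal_law m s =
    (if s = 0 then return borel m else density lborel (\<lambda>x. ennreal (normal_density m s x)))"

definition multivariate_normal :: "'b::euclidean_space measure \<Rightarrow> bool" where
  "multivariate_normal N \<longleftrightarrow> prob_space N \<and> sets N = sets borel \<and>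
    (\<forall>t. \<exists>m s. s \<ge> 0 \<and> distr N borel (\<lambda>x. x \<bullet> t) = normal_law m s)"

definition vectorize :: "real^'p^'p \<Rightarrow> real^('p \<times> 'p)" where
  "vectorize A = (\<chi> q. A $ fst q $ snd q)"

definition asymptotically_normal ::
  "'a measure \<Rightarrow> (nat \<Rightarrow> 'a \<Rightarrow> real^'p^'p) \<Rightarrow> ('p \<Rightarrow> 'p \<Rightarrow> real) \<Rightarrow> bool" where
  "asymptotically_normal M W asv \<longleftrightarrow>
    (\<exists>N. multivariate_normal N
      \<and> conv_in_distribution M (\<lambda>n \<omega>. sqrt (real n) *\<^sub>R vectorize (W n \<omega> - mat 1)) N
      \<and> (\<forall>k l. prob_space.expectation N (\<lambda>x. x $ (k, l)) = 0)
      \<and> (\<forall>k l. prob_space.variance N (\<lambda>x. x $ (k, l)) = asv k l))"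

end

(*
  A deflation-based estimate is W = U R, where R is the inverse square root of the sample covariance
  matrix and the rows of U maximize, one after the other, the empirical index over a compact set of
  orthogonal matrices.  The empirical index converges uniformly on the sphere to the population index,
  which at a unit vector u is at most the sum of u_j^4 times the j-th component index; this identifies
  the identity matrix as the limit.  Maximality in the plane of two rows gives the estimating equations.
  Together with the centring and whitening equations they are multilinear in the rows of W, so that
  they can be solved for sqrt n (W - I) up to an error of smaller order than sqrt n (W - I) plus
  quantities bounded in mean.  The solution is a normalized sum of i.i.d. vectors, to which the
  one-dimensional central limit theorem applies for every linear form.
*)

theory Submission
  imports Defs "HOL-Library.Landau_Symbols"
begin

section \<open>Convergence in probability and laws of large numbers\<close>

text \<open>At the outset the estimate is only known to be consistent, so no rate is available to
  control the remainder of a Taylor expansion. The moment equations are therefore treated as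
  multilinear: rows are replaced by their limits one at a time, the coefficients converge by the law
  of large numbers, and the remainder is o(1) times the unknown error, which can be absorbed.

  The variances reflect a two by two system. For k < l the estimating equation relates the entries
  (k,l) and (l,k), and whitening gives their sum. Elimination leaves the entry (k,l) with the factor
  3 \<alpha> \<gamma>_k^2 + 4 (1 - \<alpha>) \<kappa>_k^2, in which \<kappa>_k = \<beta>_k - 3 is a
  difference of two coefficients. The entry (l,k) then follows from whitening, which adds the extra
  1. A component of index zero makes the factor vanish; it has to come last, where orthogonality
  alone determines the row.

  The integrals that define convergence in distribution are informative only for measurable
  estimates, so the successive maximizers have to be selected measurably.\<close>

text \<open>Convergence along this filter is convergence in probability; measurability of the sequence
  is not needed.\<close>

definition prob_filter :: "'a measure \<Rightarrow> (nat \<times> 'a) filter" where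
  "prob_filter M = Abs_filter (\<lambda>P. \<exists>A. (\<forall>n. A n \<in> sets M) \<and> (\<lambda>n. measure M (A n)) \<longlonglongrightarrow> 1 \<and>
     (\<forall>n. \<forall>\<omega>\<in>A n. P (n, \<omega>)))"

context prob_space
begin

text \<open>Closure under conjunction is the only filter axiom with content: P(A) + P(B) - 1 \<le>
  P(A \<inter> B), so two sequences of events with probability tending to one intersect in
  another.\<close>

lemma eventually_prob_filter:
  "eventually P (prob_filter M) \<longleftrightarrow>
    (\<exists>A. (\<forall>n. A n \<in> events) \<and> (\<lambda>n. prob (A n)) \<longlonglongrightarrow> 1 \<and> (\<forall>n. \<forall>\<omega>\<in>A n. P (n, \<omega>)))"
  unfolding prob_filter_def
proof (rule eventually_Abs_filter, rule is_filter.intro)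
  show "\<exists>A. (\<forall>n. A n \<in> events) \<and> (\<lambda>n. prob (A n)) \<longlonglongrightarrow> 1 \<and> (\<forall>n. \<forall>\<omega>\<in>A n. True)"
    by (intro exI[of _ "\<lambda>n. space M"]) (simp add: prob_space)
next
  fix P Q :: "nat \<times> 'a \<Rightarrow> bool"
  assume "\<exists>A. (\<forall>n. A n \<in> events) \<and> (\<lambda>n. prob (A n)) \<longlonglongrightarrow> 1 \<and> (\<forall>n. \<forall>\<omega>\<in>A n. P (n, \<omega>))"
    and "\<exists>A. (\<forall>n. A n \<in> events) \<and> (\<lambda>n. prob (A n)) \<longlonglongrightarrow> 1 \<and> (\<forall>n. \<forall>\<omega>\<in>A n. Q (n, \<omega>))"
  then obtain A B where AB: "\<And>n. A n \<in> events" "(\<lambda>n. prob (A n)) \<longlonglongrightarrow> 1" "\<And>n \<omega>. \<omega> \<in> A n \<Longrightarrow> P (n, \<omega>)"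
    "\<And>n. B n \<in> events" "(\<lambda>n. prob (B n)) \<longlonglongrightarrow> 1" "\<And>n \<omega>. \<omega> \<in> B n \<Longrightarrow> Q (n, \<omega>)" by blast
  have "(\<lambda>n. prob (A n \<inter> B n)) \<longlonglongrightarrow> 1"
  proof (rule tendsto_sandwich)
    show "(\<lambda>n. prob (A n) + prob (B n) - 1) \<longlonglongrightarrow> 1"
      using tendsto_diff[OF tendsto_add[OF AB(2,5)] tendsto_const[of 1]] by simp
    have "prob (A n) + prob (B n) - 1 \<le> prob (A n \<inter> B n)" for n
    proof -
      have "prob (A n) + prob (B n) = prob (A n \<union> B n) + prob (A n \<inter> B n)"
        using AB finite_measure_Union'[of "A n" "B n"] finite_measure_Diff'[of "B n" "A n"]
        by (simp add: Int_commute)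
      also have "\<dots> \<le> 1 + prob (A n \<inter> B n)" by simp
      finally show ?thesis by simp
    qed
    then show "\<forall>\<^sub>F n in sequentially. prob (A n) + prob (B n) - 1 \<le> prob (A n \<inter> B n)" by simp
  qed auto
  then show "\<exists>A. (\<forall>n. A n \<in> events) \<and> (\<lambda>n. prob (A n)) \<longlonglongrightarrow> 1 \<and> (\<forall>n. \<forall>\<omega>\<in>A n. P (n, \<omega>) \<and> Q (n, \<omega>))"
    using AB by (intro exI[of _ "\<lambda>n. A n \<inter> B n"]) auto
qed blast

lemma eventually_prob_filter_space: "\<forall>\<^sub>F T in prob_filter M. snd T \<in> space M"
  unfolding eventually_prob_filter by (intro exI[of _ "\<lambda>n. space M"]) (simp add: prob_space)

lemma eventually_prob_filter_sequentially:
  assumes "eventually P sequentially"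
  shows "\<forall>\<^sub>F T in prob_filter M. P (fst T)"
  unfolding eventually_prob_filter
proof (intro exI[of _ "\<lambda>n. if P n then space M else {}"] conjI)
  show "(\<lambda>n. prob (if P n then space M else {})) \<longlonglongrightarrow> 1"
    by (rule tendsto_eventually) (use assms in eventually_elim, simp add: prob_space)
qed auto

lemma eventually_prob_filter_measurableI:
  assumes "\<And>n. {\<omega> \<in> space M. \<not> P (n, \<omega>)} \<in> events"
    and "(\<lambda>n. prob {\<omega> \<in> space M. \<not> P (n, \<omega>)}) \<longlonglongrightarrow> 0"
  shows "eventually P (prob_filter M)"
  unfolding eventually_prob_filter
proof (intro exI[of _ "\<lambda>n. space M - {\<omega> \<in> space M. \<not> P (n, \<omega>)}"] conjI)
  show "(\<lambda>n. prob (space M - {\<omega> \<in> space M. \<not> P (n, \<omega>)})) \<longlonglongrightarrow> 1"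
    using tendsto_diff[OF tendsto_const[of 1] assms(2)] by (simp add: prob_compl assms(1))
qed (use assms(1) in auto)

text \<open>The exceptional set lies in the complement of the event A n. If it is not measurable,
  its \<open>prob\<close> is 0, so the bound covers this case as well.\<close>

lemma prob_not_eventually:
  assumes "eventually P (prob_filter M)"
  shows "(\<lambda>n. prob {\<omega> \<in> space M. \<not> P (n, \<omega>)}) \<longlonglongrightarrow> 0"
proof -
  from assms obtain A where A: "\<And>n. A n \<in> events" "(\<lambda>n. prob (A n)) \<longlonglongrightarrow> 1" "\<And>n \<omega>. \<omega> \<in> A n \<Longrightarrow> P (n, \<omega>)"
    unfolding eventually_prob_filter by blast
  show ?thesis
  proof (rule tendsto_sandwich[of "\<lambda>_. 0" _ _ "\<lambda>n. 1 - prob (A n)"])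
    have "prob {\<omega> \<in> space M. \<not> P (n, \<omega>)} \<le> 1 - prob (A n)" for n
    proof -
      have "prob {\<omega> \<in> space M. \<not> P (n, \<omega>)} \<le> prob (space M - A n)"
        using A by (intro finite_measure_mono) auto
      then show ?thesis using A by (simp add: prob_compl)
    qed
    then show "\<forall>\<^sub>F n in sequentially. prob {\<omega> \<in> space M. \<not> P (n, \<omega>)} \<le> 1 - prob (A n)" by simp
    show "(\<lambda>n. 1 - prob (A n)) \<longlonglongrightarrow> 0" using tendsto_diff[OF tendsto_const[of 1] A(2)] by simp
  qed auto
qed

lemma conv_in_probabilityI:
  assumes "((\<lambda>T. X (fst T) (snd T)) \<longlongrightarrow> c) (prob_filter M)"
  shows "conv_in_probability M X c"
  unfolding conv_in_probability_def
proof safe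
  fix e :: real assume "e > 0"
  have "\<forall>\<^sub>F T in prob_filter M. dist (X (fst T) (snd T)) c \<le> e"
    using tendstoD[OF assms \<open>e > 0\<close>] by (rule eventually_mono) simp
  from prob_not_eventually[OF this]
  show "(\<lambda>n. prob {\<omega> \<in> space M. e < dist (X n \<omega>) c}) \<longlonglongrightarrow> 0" by (simp add: not_le)
qed

lemma Markov_inequality_ge:
  assumes "integrable M u" "\<And>x. 0 \<le> u x" "0 < c"
  shows "prob {x \<in> space M. c \<le> u x} \<le> (\<integral>x. u x \<partial>M) / c"
  using integral_Markov_inequality_measure[of M u "space M" c] assms by auto

text \<open>A sequence that is bounded in mean is bounded in probability.\<close>

lemma smallo_bounded_mean_tendsto:
  fixes X Z :: "nat \<times> 'a \<Rightarrow> real"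
  assumes X: "X \<in> o[prob_filter M](Z)"
    and meas: "\<And>n. (\<lambda>\<omega>. X (n, \<omega>)) \<in> borel_measurable M"
    and Z: "\<And>n. integrable M (\<lambda>\<omega>. \<bar>Z (n, \<omega>)\<bar>)" "\<And>n. expectation (\<lambda>\<omega>. \<bar>Z (n, \<omega>)\<bar>) \<le> B"
  shows "(X \<longlongrightarrow> 0) (prob_filter M)"
proof (rule tendstoI)
  fix d :: real assume d: "d > 0"
  show "\<forall>\<^sub>F T in prob_filter M. dist (X T) 0 < d"
  proof (rule eventually_prob_filter_measurableI)
    note [measurable] = meas
    show "{\<omega> \<in> space M. \<not> dist (X (n, \<omega>)) 0 < d} \<in> events" for n by measurable
    show "(\<lambda>n. prob {\<omega> \<in> space M. \<not> dist (X (n, \<omega>)) 0 < d}) \<longlonglongrightarrow> 0"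
    proof (rule LIMSEQ_I)
      fix e :: real assume e: "e > 0"
      define b where "b = max B 1"
      have b: "b > 0" "B \<le> b" by (auto simp: b_def)
      \<comment> \<open>Where |X| \<le> c |Z|, the bound |X| \<ge> d forces |Z| \<ge> d / c, which
        by Markov has probability at most c b / d = e / 4. The other e / 2 pays for the event where
        |X| \<le> c |Z| fails.\<close>
      define c where "c = d * e / (4 * b)"
      have c: "c > 0" using d e b by (simp add: c_def)
      have ev: "\<forall>\<^sub>F T in prob_filter M. norm (X T) \<le> c * norm (Z T)" using X c by (rule landau_o.smallD)
      from LIMSEQ_D[OF prob_not_eventually[OF ev], of "e / 2"] e
      obtain N where N: "\<And>n. n \<ge> N \<Longrightarrow> prob {\<omega> \<in> space M. \<not> norm (X (n, \<omega>)) \<le> c * norm (Z (n, \<omega>))} < e / 2"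
        by auto
      have "prob {\<omega> \<in> space M. \<not> dist (X (n, \<omega>)) 0 < d} < e" if "n \<ge> N" for n
      proof -
        have [measurable]: "(\<lambda>\<omega>. \<bar>Z (n, \<omega>)\<bar>) \<in> borel_measurable M" using Z(1)[of n] by simp
        have "{\<omega> \<in> space M. \<not> dist (X (n, \<omega>)) 0 < d} \<subseteq>
          {\<omega> \<in> space M. \<not> norm (X (n, \<omega>)) \<le> c * norm (Z (n, \<omega>))} \<union> {\<omega> \<in> space M. d / c \<le> \<bar>Z (n, \<omega>)\<bar>}"
          using c by (auto simp: divide_le_eq mult.commute)
        then have "prob {\<omega> \<in> space M. \<not> dist (X (n, \<omega>)) 0 < d} \<le>
          prob ({\<omega> \<in> space M. \<not> norm (X (n, \<omega>)) \<le> c * norm (Z (n, \<omega>))} \<union> {\<omega> \<in> space M. d / c \<le> \<bar>Z (n, \<omega>)\<bar>})"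
          by (intro finite_measure_mono) (auto simp: real_norm_def)
        also have "\<dots> \<le> prob {\<omega> \<in> space M. \<not> norm (X (n, \<omega>)) \<le> c * norm (Z (n, \<omega>))}
          + prob {\<omega> \<in> space M. d / c \<le> \<bar>Z (n, \<omega>)\<bar>}"
          by (intro measure_Un_le) (auto simp: real_norm_def)
        also have "prob {\<omega> \<in> space M. d / c \<le> \<bar>Z (n, \<omega>)\<bar>} \<le> expectation (\<lambda>\<omega>. \<bar>Z (n, \<omega>)\<bar>) / (d / c)"
          using Z d c by (intro Markov_inequality_ge) auto
        also have "\<dots> \<le> b / (d / c)" using Z(2)[of n] b d c by (intro divide_right_mono) auto
        also have "\<dots> = e / 4" using b d by (simp add: c_def)
        finally show ?thesis using N[OF that] e by simp
      qed
      then show "\<exists>no. \<forall>n\<ge>no. norm (prob {\<omega> \<in> space M. \<not> dist (X (n, \<omega>)) 0 < d} - 0) < e"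
        by (intro exI[of _ N]) auto
    qed
  qed
qed

end

section \<open>Averages over an i.i.d. sample and the weak law of large numbers\<close>

locale iid_sample = prob_space M for M :: "'a measure" +
  fixes D :: "(real^'p) measure" and z :: "nat \<Rightarrow> 'a \<Rightarrow> real^'p"
  assumes random_sample: "random_sample M D z"
begin

text \<open>Sample size and sample point form one argument, so that limits along
  \<open>prob_filter M\<close> apply directly. For sample size 0 the value is 0.\<close>

definition avg :: "(real^'p \<Rightarrow> real) \<Rightarrow> nat \<times> 'a \<Rightarrow> real" where
  "avg h T = (\<Sum>i<fst T. h (z i (snd T))) / real (fst T)"

lemma measurable_z [measurable]: "z i \<in> borel_measurable M"
  using random_sample unfolding random_sample_def indep_vars_def by auto

lemma distr_z: "distr M borel (z i) = D"
  using random_sample by (simp add: random_sample_def)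

lemma sets_D [simp, measurable_cong]: "sets D = sets borel"
  by (simp flip: distr_z[of 0])

lemma space_D [simp]: "space D = UNIV"
  by (simp flip: distr_z[of 0])

lemma prob_space_D: "prob_space D"
  by (metis distr_z measurable_z prob_space_distr)

lemma integrable_z: "h \<in> borel_measurable borel \<Longrightarrow> integrable M (\<lambda>\<omega>. h (z i \<omega>)) \<longleftrightarrow> integrable D (h :: real^'p \<Rightarrow> real)"
  unfolding distr_z[of i, symmetric] by (simp add: integrable_distr_eq)

lemma expectation_z: "h \<in> borel_measurable borel \<Longrightarrow> expectation (\<lambda>\<omega>. h (z i \<omega>)) = (\<integral>v. (h v :: real) \<partial>D)"
  unfolding distr_z[of i, symmetric] by (simp add: integral_distr)

lemma indep_vars_z: "h \<in> borel_measurable borel \<Longrightarrow> indep_vars (\<lambda>_. borel) (\<lambda>i \<omega>. h (z i \<omega>) :: real) UNIV"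
  using random_sample unfolding random_sample_def
  by (intro indep_vars_compose2[of "\<lambda>_. borel" z UNIV "\<lambda>_. h"]) auto

lemma measurable_avg [measurable]:
  assumes [measurable]: "h \<in> borel_measurable borel"
  shows "(\<lambda>\<omega>. avg h (n, \<omega>)) \<in> borel_measurable M"
  unfolding avg_def by simp

text \<open>Induction on n: the new summand is independent of the partial sum and centred, so the
  cross term integrates to zero.\<close>

lemma second_moment_sum:
  assumes h [measurable]: "h \<in> borel_measurable borel" and h2: "integrable D (\<lambda>v. (h v)\<^sup>2)" and h0: "(\<integral>v. h v \<partial>D) = 0"
  shows "integrable M (\<lambda>\<omega>. (\<Sum>i<n. h (z i \<omega>))\<^sup>2) \<and>
    expectation (\<lambda>\<omega>. (\<Sum>i<n. h (z i \<omega>))\<^sup>2) = real n * (\<integral>v. (h v)\<^sup>2 \<partial>D)"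
proof (induction n)
  case (Suc n)
  interpret D: prob_space D by (rule prob_space_D)
  have h1: "integrable D h" by (rule D.square_integrable_imp_integrable[OF _ h2]) simp
  have ind: "indep_var borel (\<lambda>\<omega>. h (z n \<omega>)) borel (\<lambda>\<omega>. \<Sum>i<n. h (z i \<omega>))"
    using indep_vars_sum[of "{..<n}" n "\<lambda>i \<omega>. h (z i \<omega>)"] indep_vars_subset[OF indep_vars_z[OF h]]
    by (simp add: lessThan_Suc)
  have i1: "integrable M (\<lambda>\<omega>. h (z i \<omega>))" for i using h1 by (simp add: integrable_z)
  have i2: "integrable M (\<lambda>\<omega>. (h (z i \<omega>))\<^sup>2)" for i
    using h2 integrable_z[of "\<lambda>v. (h v)\<^sup>2"] by simp
  have E2: "expectation (\<lambda>\<omega>. (h (z n \<omega>))\<^sup>2) = (\<integral>v. (h v)\<^sup>2 \<partial>D)"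
    using expectation_z[of "\<lambda>v. (h v)\<^sup>2"] by simp
  have c: "integrable M (\<lambda>\<omega>. h (z n \<omega>) * (\<Sum>i<n. h (z i \<omega>)))"
    "expectation (\<lambda>\<omega>. h (z n \<omega>) * (\<Sum>i<n. h (z i \<omega>))) = 0"
    using indep_var_integrable[OF ind] indep_var_lebesgue_integral[OF ind] i1
    by (simp_all add: expectation_z h0)
  have eq: "(\<Sum>i<Suc n. h (z i \<omega>))\<^sup>2 = (h (z n \<omega>))\<^sup>2 + 2 * (h (z n \<omega>) * (\<Sum>i<n. h (z i \<omega>))) + (\<Sum>i<n. h (z i \<omega>))\<^sup>2" for \<omega>
    by (simp add: power2_eq_square algebra_simps)
  show ?case unfolding eq using Suc.IH c i2 by (simp add: E2 algebra_simps)
qed simp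

text \<open>The second moment of the scaled average is at most that of h for every n, and |x| \<le>
  1 + x^2 turns this into a bound on the mean that is uniform in n. It is the source of all
  boundedness in probability below.\<close>

lemma mean_scaled_avg_bound:
  assumes h [measurable]: "h \<in> borel_measurable borel" and h2: "integrable D (\<lambda>v. (h v)\<^sup>2)" and h0: "(\<integral>v. h v \<partial>D) = 0"
  shows "integrable M (\<lambda>\<omega>. \<bar>sqrt (real n) * avg h (n, \<omega>)\<bar>)"
    "expectation (\<lambda>\<omega>. \<bar>sqrt (real n) * avg h (n, \<omega>)\<bar>) \<le> 1 + (\<integral>v. (h v)\<^sup>2 \<partial>D)"
proof -
  have sq: "(sqrt (real n) * avg h (n, \<omega>))\<^sup>2 = (\<Sum>i<n. h (z i \<omega>))\<^sup>2 / real n" for \<omega>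
    by (simp add: avg_def power_mult_distrib power_divide) (simp add: power2_eq_square)
  have i: "integrable M (\<lambda>\<omega>. (sqrt (real n) * avg h (n, \<omega>))\<^sup>2)"
    unfolding sq using second_moment_sum[OF assms] by simp
  have E: "expectation (\<lambda>\<omega>. (sqrt (real n) * avg h (n, \<omega>))\<^sup>2) \<le> (\<integral>v. (h v)\<^sup>2 \<partial>D)"
    unfolding sq using second_moment_sum[OF assms] by (cases "n = 0") auto
  have "integrable M (\<lambda>\<omega>. sqrt (real n) * avg h (n, \<omega>))"
    by (rule square_integrable_imp_integrable[OF _ i]) simp
  then show i1: "integrable M (\<lambda>\<omega>. \<bar>sqrt (real n) * avg h (n, \<omega>)\<bar>)" by simp
  have "\<bar>x\<bar> \<le> 1 + x\<^sup>2" for x :: real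
  proof -
    have "0 \<le> (\<bar>x\<bar> - 1)\<^sup>2" by simp
    then show ?thesis using abs_ge_zero[of x] unfolding power2_diff by simp
  qed
  then have "expectation (\<lambda>\<omega>. \<bar>sqrt (real n) * avg h (n, \<omega>)\<bar>) \<le> expectation (\<lambda>\<omega>. 1 + (sqrt (real n) * avg h (n, \<omega>))\<^sup>2)"
    by (intro integral_mono i1 Bochner_Integration.integrable_add i) auto
  also have "\<dots> \<le> 1 + (\<integral>v. (h v)\<^sup>2 \<partial>D)"
    using E i by (simp add: prob_space)
  finally show "expectation (\<lambda>\<omega>. \<bar>sqrt (real n) * avg h (n, \<omega>)\<bar>) \<le> 1 + (\<integral>v. (h v)\<^sup>2 \<partial>D)" .
qed

lemma truncation_tendsto:
  fixes h :: "real^'p \<Rightarrow> real"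
  assumes [measurable]: "h \<in> borel_measurable borel" and h: "integrable D h"
  shows "(\<lambda>c::nat. \<integral>v. (if \<bar>h v\<bar> \<le> real c then 0 else \<bar>h v\<bar>) \<partial>D) \<longlonglongrightarrow> 0"
proof -
  have "(\<lambda>c::nat. \<integral>v. (if \<bar>h v\<bar> \<le> real c then 0 else \<bar>h v\<bar>) \<partial>D) \<longlonglongrightarrow> (\<integral>v. 0 \<partial>D)"
  proof (rule integral_dominated_convergence[where w = "\<lambda>v. \<bar>h v\<bar>"])
    show "AE v in D. (\<lambda>c. if \<bar>h v\<bar> \<le> real c then 0 else \<bar>h v\<bar>) \<longlonglongrightarrow> 0"
    proof (rule AE_I2, rule tendsto_eventually)
      fix v
      show "\<forall>\<^sub>F c in sequentially. (if \<bar>h v\<bar> \<le> real c then 0 else \<bar>h v\<bar>) = 0"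
        using eventually_ge_at_top[of "nat \<lceil>\<bar>h v\<bar>\<rceil>"] by eventually_elim (auto simp: nat_ceiling_le_eq)
    qed
  qed (use h in auto)
  then show ?thesis by simp
qed

text \<open>Only a first moment is assumed, because with sixth moments a product of four coordinates
  may have infinite variance. Hence the truncation: Chebyshev handles the bounded part, Markov the
  small remainder.\<close>

theorem weak_law_of_large_numbers:
  assumes h [measurable]: "h \<in> borel_measurable borel" and int: "integrable D h"
  shows "(avg h \<longlongrightarrow> (\<integral>v. h v \<partial>D)) (prob_filter M)"
proof (rule tendstoI)
  interpret D: prob_space D by (rule prob_space_D)
  fix d :: real assume d: "d > 0"
  define \<mu> where "\<mu> = (\<integral>v. h v \<partial>D)"
  have "(\<lambda>n. prob {\<omega> \<in> space M. \<not> dist (avg h (n, \<omega>)) \<mu> < d}) \<longlonglongrightarrow> 0"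
  proof (rule LIMSEQ_I)
    fix e :: real assume e: "e > 0"
    \<comment> \<open>A tail below d / 3 keeps the shift of the mean harmless; a tail below d e / 6
      makes the Markov bound at level d / 3 at most e / 2.\<close>
    obtain c :: nat where c: "\<bar>\<integral>v. (if \<bar>h v\<bar> \<le> real c then 0 else \<bar>h v\<bar>) \<partial>D\<bar> < min (d / 3) (d * e / 6)"
      using LIMSEQ_D[OF truncation_tendsto[OF h int], of "min (d / 3) (d * e / 6)"] d e by auto
    define r where "r v = (if \<bar>h v\<bar> \<le> real c then 0 else h v)" for v
    define k where "k v = (if \<bar>h v\<bar> \<le> real c then h v else 0)" for v
    define m where "m = (\<integral>v. k v \<partial>D)"
    define g where "g v = k v - m" for v
    have [measurable]: "r \<in> borel_measurable borel" "k \<in> borel_measurable borel" "g \<in> borel_measurable borel"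
      unfolding r_def k_def g_def by measurable
    have ri: "integrable D r" and ki: "integrable D k"
      by (rule Bochner_Integration.integrable_bound[OF int]; simp add: r_def k_def)+
    have r_abs: "(\<integral>v. \<bar>r v\<bar> \<partial>D) < min (d / 3) (d * e / 6)"
      using c unfolding r_def by (simp add: if_distrib[of abs] cong: if_cong)
    have hrk: "h v = g v + m + r v" for v by (simp add: g_def r_def k_def)
    have \<mu>: "\<mu> = m + (\<integral>v. r v \<partial>D)"
    proof -
      have "\<mu> = (\<integral>v. k v + r v \<partial>D)" unfolding \<mu>_def by (rule Bochner_Integration.integral_cong) (auto simp: k_def r_def)
      then show ?thesis using ri ki by (simp add: m_def)
    qed
    have g0: "(\<integral>v. g v \<partial>D) = 0" using ki D.prob_space by (simp add: g_def m_def)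
    have g2: "integrable D (\<lambda>v. (g v)\<^sup>2)"
      by (rule D.integrable_const_bound[where B = "(real c + \<bar>m\<bar>)\<^sup>2"])
         (auto simp: g_def k_def intro!: power_mono simp flip: abs_le_square_iff)
    define G where "G = (\<integral>v. (g v)\<^sup>2 \<partial>D)"
    have G: "G \<ge> 0" by (simp add: G_def)
    \<comment> \<open>The Chebyshev bound 9 G / (N d^2) has to fall below e / 2.\<close>
    obtain N :: nat where N: "N > 0" "real N > 18 * G / (d\<^sup>2 * e)"
      by (metis add.commute gt_ex less_imp_of_nat_less of_nat_0_less_iff reals_Archimedean2 dual_order.strict_trans not_gr_zero of_nat_0)
    have "prob {\<omega> \<in> space M. \<not> dist (avg h (n, \<omega>)) \<mu> < d} < e" if n: "n \<ge> N" for n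
    proof -
      have n0: "n > 0" using n N by simp
      have split: "avg h (n, \<omega>) - \<mu> = avg g (n, \<omega>) + avg r (n, \<omega>) - (\<integral>v. r v \<partial>D)" for \<omega>
        using n0 by (simp add: avg_def hrk sum.distrib add_divide_distrib \<mu>)
      have int_r: "\<bar>\<integral>v. r v \<partial>D\<bar> < d / 3"
        using integral_abs_bound[of D r] r_abs by linarith
      have "{\<omega> \<in> space M. \<not> dist (avg h (n, \<omega>)) \<mu> < d} \<subseteq>
        {\<omega> \<in> space M. d\<^sup>2 / 9 \<le> (avg g (n, \<omega>))\<^sup>2} \<union> {\<omega> \<in> space M. d / 3 \<le> avg (\<lambda>v. \<bar>r v\<bar>) (n, \<omega>)}"
      proof safe
        fix \<omega> assume a: "\<omega> \<in> space M" "\<not> dist (avg h (n, \<omega>)) \<mu> < d" "\<not> d / 3 \<le> avg (\<lambda>v. \<bar>r v\<bar>) (n, \<omega>)"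
        have "\<bar>avg r (n, \<omega>)\<bar> \<le> avg (\<lambda>v. \<bar>r v\<bar>) (n, \<omega>)"
          using n0 by (simp add: avg_def divide_right_mono)
        then have "d / 3 \<le> \<bar>avg g (n, \<omega>)\<bar>" using a split[of \<omega>] int_r by (simp add: dist_real_def)
        then have "(d / 3)\<^sup>2 \<le> (avg g (n, \<omega>))\<^sup>2" using d by (simp flip: abs_le_square_iff)
        then show "d\<^sup>2 / 9 \<le> (avg g (n, \<omega>))\<^sup>2" by (simp add: power_divide)
      qed
      then have "prob {\<omega> \<in> space M. \<not> dist (avg h (n, \<omega>)) \<mu> < d} \<le>
        prob ({\<omega> \<in> space M. d\<^sup>2 / 9 \<le> (avg g (n, \<omega>))\<^sup>2} \<union> {\<omega> \<in> space M. d / 3 \<le> avg (\<lambda>v. \<bar>r v\<bar>) (n, \<omega>)})"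
        by (intro finite_measure_mono) auto
      also have "\<dots> \<le> prob {\<omega> \<in> space M. d\<^sup>2 / 9 \<le> (avg g (n, \<omega>))\<^sup>2} + prob {\<omega> \<in> space M. d / 3 \<le> avg (\<lambda>v. \<bar>r v\<bar>) (n, \<omega>)}"
        by (intro measure_Un_le) auto
      also have "prob {\<omega> \<in> space M. d\<^sup>2 / 9 \<le> (avg g (n, \<omega>))\<^sup>2} \<le> (G / real n) / (d\<^sup>2 / 9)"
      proof -
        have sq: "(avg g (n, \<omega>))\<^sup>2 = (\<Sum>i<n. g (z i \<omega>))\<^sup>2 / (real n)\<^sup>2" for \<omega>
          by (simp add: avg_def power_divide)
        have "integrable M (\<lambda>\<omega>. (avg g (n, \<omega>))\<^sup>2)" "expectation (\<lambda>\<omega>. (avg g (n, \<omega>))\<^sup>2) = G / real n"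
          unfolding sq using second_moment_sum[OF _ g2 g0, of n] n0 by (auto simp: G_def power2_eq_square)
        then show ?thesis
          using Markov_inequality_ge[of "\<lambda>\<omega>. (avg g (n, \<omega>))\<^sup>2" "d\<^sup>2 / 9"] d by simp
      qed
      also have "\<dots> \<le> (G / real N) / (d\<^sup>2 / 9)"
        using n N G by (intro divide_right_mono divide_left_mono) auto
      also have "\<dots> < e / 2"
        using N d e by (simp add: field_simps)
      also have "prob {\<omega> \<in> space M. d / 3 \<le> avg (\<lambda>v. \<bar>r v\<bar>) (n, \<omega>)} \<le> (\<integral>v. \<bar>r v\<bar> \<partial>D) / (d / 3)"
      proof -
        have "integrable M (\<lambda>\<omega>. \<bar>r (z i \<omega>)\<bar>)" "expectation (\<lambda>\<omega>. \<bar>r (z i \<omega>)\<bar>) = (\<integral>v. \<bar>r v\<bar> \<partial>D)" for i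
          using integrable_z[of "\<lambda>v. \<bar>r v\<bar>" i] expectation_z[of "\<lambda>v. \<bar>r v\<bar>" i] ri by auto
        then have "integrable M (\<lambda>\<omega>. avg (\<lambda>v. \<bar>r v\<bar>) (n, \<omega>))" "expectation (\<lambda>\<omega>. avg (\<lambda>v. \<bar>r v\<bar>) (n, \<omega>)) = (\<integral>v. \<bar>r v\<bar> \<partial>D)"
          using n0 by (auto simp: avg_def)
        then show ?thesis
          using Markov_inequality_ge[of "\<lambda>\<omega>. avg (\<lambda>v. \<bar>r v\<bar>) (n, \<omega>)" "d / 3"] d
          by (auto simp: avg_def sum_nonneg)
      qed
      also have "\<dots> \<le> e / 2"
      proof -
        have "(\<integral>v. \<bar>r v\<bar> \<partial>D) \<le> d * e / 6" using r_abs by simp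
        then show ?thesis using d by (simp add: field_simps)
      qed
      finally show ?thesis by simp
    qed
    then show "\<exists>no. \<forall>n\<ge>no. norm (prob {\<omega> \<in> space M. \<not> dist (avg h (n, \<omega>)) \<mu> < d} - 0) < e"
      by (intro exI[of _ N]) auto
  qed
  then show "\<forall>\<^sub>F T in prob_filter M. dist (avg h T) (\<integral>v. h v \<partial>D) < d"
    unfolding \<mu>_def[symmetric] by (intro eventually_prob_filter_measurableI) auto
qed

end

section \<open>Square roots of matrices and orthogonal matrices\<close>

text \<open>The vanishing of a first variation at an extremum. The test point is t = - B / (Q + 1);
  adding 1 keeps the denominator positive when Q = 0.\<close>

lemma quadratic_nonneg_imp_linear_zero:
  fixes B Q :: real
  assumes "\<And>t. 0 \<le> 2 * t * B + t\<^sup>2 * Q"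
  shows "B = 0"
proof (rule ccontr)
  assume "B \<noteq> 0"
  then have B2: "0 < B\<^sup>2" by simp
  have "Q \<ge> 0" using assms[of 1] assms[of "-1"] by simp
  have "0 \<le> 2 * (- B / (Q + 1)) * B + (- B / (Q + 1))\<^sup>2 * Q" by (rule assms)
  also have "\<dots> = B\<^sup>2 * (- 2 * (Q + 1) + Q) / (Q + 1)\<^sup>2"
    using \<open>Q \<ge> 0\<close> by (simp add: divide_simps power2_eq_square) (simp add: algebra_simps)
  also have "\<dots> < 0" using B2 \<open>Q \<ge> 0\<close>
    by (intro divide_neg_pos mult_pos_neg) auto
  finally show False by simp
qed

text \<open>The orthogonal complement of a set of eigenvectors is invariant under f, and a maximizer
  of x \<bullet> f x on its unit sphere is an eigenvector.\<close>

lemma selfadjoint_eigenvector_orthogonal: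
  fixes f :: "'a::euclidean_space \<Rightarrow> 'a"
  assumes lin: "linear f" and sa: "\<And>x y. f x \<bullet> y = x \<bullet> f y"
    and eig: "\<And>b. b \<in> B \<Longrightarrow> \<exists>c. f b = c *\<^sub>R b"
    and dim: "dim (span B) < DIM('a)"
  shows "\<exists>v c. norm v = 1 \<and> (\<forall>b\<in>B. b \<bullet> v = 0) \<and> f v = c *\<^sub>R v"
proof -
  define V where "V = {x. \<forall>b\<in>B. b \<bullet> x = 0}"
  have subV: "subspace V"
    unfolding V_def subspace_def by (auto simp: inner_right_distrib)
  have invV: "f x \<in> V" if "x \<in> V" for x
    unfolding V_def
  proof safe
    fix b assume b: "b \<in> B"
    then obtain c where "f b = c *\<^sub>R b" using eig by blast
    then show "b \<bullet> f x = 0" using sa[of b x] that b by (simp add: V_def)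
  qed
  obtain x where x: "x \<noteq> 0" "\<And>y. y \<in> span B \<Longrightarrow> orthogonal x y"
    using orthogonal_to_subspace_exists[of B] dim by (auto simp: dim_span)
  have "x \<in> V" using x(2) by (auto simp: V_def orthogonal_def span_base inner_commute)
  have closedV: "closed V" using subV by (rule closed_subspace)
  have "compact (V \<inter> sphere 0 1)" using closedV by (simp add: closed_Int_compact)
  moreover have "x /\<^sub>R norm x \<in> V \<inter> sphere 0 1"
    using x(1) \<open>x \<in> V\<close> subV by (auto intro: subspace_scale)
  moreover have contf: "continuous_on UNIV f" using lin by (simp add: linear_continuous_on linear_conv_bounded_linear)
  then have "continuous_on (V \<inter> sphere 0 1) (\<lambda>x. x \<bullet> f x)"
    by (intro continuous_intros) (auto intro: continuous_on_subset)
  ultimately obtain v where v: "v \<in> V" "norm v = 1"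
    and mx: "\<And>w. w \<in> V \<Longrightarrow> norm w = 1 \<Longrightarrow> w \<bullet> f w \<le> v \<bullet> f v"
    using continuous_attains_sup[of "V \<inter> sphere 0 1" "\<lambda>x. x \<bullet> f x"]
    by (metis IntD1 IntD2 IntI empty_iff mem_sphere_0)
  define c where "c = v \<bullet> f v"
  have q: "w \<bullet> f w \<le> c * (w \<bullet> w)" if "w \<in> V" for w
  proof (cases "w = 0")
    case True then show ?thesis using lin by (simp add: linear_0)
  next
    case False
    have "(w /\<^sub>R norm w) \<bullet> f (w /\<^sub>R norm w) \<le> c"
      unfolding c_def using mx[of "w /\<^sub>R norm w"] that False subV by (auto intro: subspace_scale)
    then have "(w \<bullet> f w) / (norm w * norm w) \<le> c"
      using lin by (simp add: linear_cmul divide_inverse mult_ac)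
    then show ?thesis using False by (simp add: divide_le_eq dot_square_norm power2_eq_square)
  qed
  \<comment> \<open>The map t \<mapsto> c |v + t w|^2 - (v + t w) \<bullet> f (v + t w) is
    nonnegative and vanishes at t = 0, so its linear coefficient is zero.\<close>
  have z: "(c *\<^sub>R v - f v) \<bullet> w = 0" if w: "w \<in> V" for w
  proof -
    define B where "B = (c *\<^sub>R v - f v) \<bullet> w"
    define Q where "Q = c * (w \<bullet> w) - w \<bullet> f w"
    have "0 \<le> 2 * t * B + t\<^sup>2 * Q" for t
    proof -
      have "v + t *\<^sub>R w \<in> V" using w v subV by (auto intro: subspace_add subspace_scale)
      from q[OF this] have "0 \<le> c * ((v + t *\<^sub>R w) \<bullet> (v + t *\<^sub>R w)) - (v + t *\<^sub>R w) \<bullet> f (v + t *\<^sub>R w)" by simp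
      also have "f (v + t *\<^sub>R w) = f v + t *\<^sub>R f w" using lin by (simp add: linear_add linear_cmul)
      finally show ?thesis
        using v(2) sa[of v w]
        unfolding B_def Q_def c_def norm_eq_1
        by (simp add: algebra_simps inner_commute power2_eq_square)
    qed note p = this
    have "B = 0" using p by (rule quadratic_nonneg_imp_linear_zero)
    then show ?thesis by (simp add: B_def)
  qed
  have "c *\<^sub>R v - f v \<in> V" using v invV subV by (auto intro: subspace_diff subspace_scale)
  from z[OF this] have "f v = c *\<^sub>R v" by simp
  then show ?thesis using v by (auto simp: V_def)
qed

text \<open>The spectral theorem: an orthonormal set of eigenvectors is enlarged until its size
  equals the dimension.\<close>

lemma selfadjoint_eigenbasis:
  fixes f :: "'a::euclidean_space \<Rightarrow> 'a"
  assumes lin: "linear f" and sa: "\<And>x y. f x \<bullet> y = x \<bullet> f y"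
  obtains B d where "finite B" "pairwise orthogonal B" "\<And>b. b \<in> B \<Longrightarrow> norm b = 1"
    "\<And>b. b \<in> B \<Longrightarrow> f b = d b *\<^sub>R b" "span B = UNIV"
proof -
  have "\<exists>B. finite B \<and> card B = n \<and> pairwise orthogonal B \<and> (\<forall>b\<in>B. norm b = 1 \<and> (\<exists>c. f b = c *\<^sub>R b))"
    if "n \<le> DIM('a)" for n
    using that
  proof (induction n)
    case 0 then show ?case by (intro exI[of _ "{}"]) auto
  next
    case (Suc n)
    then obtain B where B: "finite B" "card B = n" "pairwise orthogonal B"
      "\<And>b. b \<in> B \<Longrightarrow> norm b = 1" "\<And>b. b \<in> B \<Longrightarrow> \<exists>c. f b = c *\<^sub>R b" by auto
    have "dim (span B) < DIM('a)" using B Suc.prems dim_le_card'[of B] by (simp add: dim_span)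
    from selfadjoint_eigenvector_orthogonal[OF lin sa B(5) this]
    obtain v c where v: "norm v = 1" "\<forall>b\<in>B. b \<bullet> v = 0" "f v = c *\<^sub>R v" by blast
    have "v \<notin> B" using v by force
    have "pairwise orthogonal (insert v B)"
      using B(3) v(2) by (auto simp: pairwise_insert orthogonal_def inner_commute)
    then show ?case using B v \<open>v \<notin> B\<close> by (intro exI[of _ "insert v B"]) auto
  qed
  from this[OF order_refl] obtain B where B: "finite B" "card B = DIM('a)" "pairwise orthogonal B"
      "\<And>b. b \<in> B \<Longrightarrow> norm b = 1" "\<And>b. b \<in> B \<Longrightarrow> \<exists>c. f b = c *\<^sub>R b" by auto
  have "0 \<notin> B" using B(4) by force
  then have "independent B" using B(3) by (intro pairwise_orthogonal_independent)
  then have "UNIV \<subseteq> span B" using B by (intro card_ge_dim_independent) (auto simp: dim_UNIV)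
  moreover obtain d where "\<And>b. b \<in> B \<Longrightarrow> f b = d b *\<^sub>R b" using B(5) by metis
  ultimately show ?thesis using B by (intro that[of B d]) auto
qed

lemma symmetric_matrix_inner: "transpose S = S \<Longrightarrow> (S *v x) \<bullet> y = x \<bullet> (S *v (y::real^'n))"
  by (metis dot_lmul_matrix inner_commute transpose_matrix_vector)

lemma symmetric_matrix_iff_inner:
  fixes S :: "real^'n^'n"
  assumes "\<And>x y. (S *v x) \<bullet> y = x \<bullet> (S *v y)"
  shows "transpose S = S"
proof -
  have "S $ i $ j = S $ j $ i" for i j
    using assms[of "axis i 1" "axis j 1"]
    by (simp add: matrix_vector_mult_basis inner_axis inner_axis' column_def)
  then show ?thesis by (simp add: transpose_def vec_eq_iff)
qed

text \<open>Along v + t S v the quadratic form is nonnegative with linear term 2 t |S v|^2.\<close>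

lemma positive_semidefinite_kernel:
  fixes S :: "real^'n^'n"
  assumes S: "transpose S = S" and psd: "\<And>v. v \<bullet> (S *v v) \<ge> 0" and 0: "v \<bullet> (S *v v) = 0"
  shows "S *v v = 0"
proof -
  define w where "w = S *v v"
  define Q where "Q = w \<bullet> (S *v w)"
  have "w \<bullet> w = 0"
  proof (rule quadratic_nonneg_imp_linear_zero)
    fix t
    have "0 \<le> (v + t *\<^sub>R w) \<bullet> (S *v (v + t *\<^sub>R w))" by (rule psd)
    also have "\<dots> = 2 * t * (w \<bullet> w) + t\<^sup>2 * Q"
      using 0 symmetric_matrix_inner[OF S, of v w]
      by (simp add: w_def Q_def matrix_vector_right_distrib matrix_vector_mult_scaleR algebra_simps inner_commute power2_eq_square)
    finally show "0 \<le> 2 * t * (w \<bullet> w) + t\<^sup>2 * Q" .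
  qed
  then show ?thesis by (simp add: w_def)
qed

text \<open>An empirical covariance matrix is always positive semidefinite, so by this equivalence
  the condition in \<open>sample_version\<close> that it be invertible provides a positive definite
  matrix.\<close>

lemma positive_definite_iff:
  fixes S :: "real^'n^'n"
  shows "positive_definite S \<longleftrightarrow> transpose S = S \<and> (\<forall>v. v \<bullet> (S *v v) \<ge> 0) \<and> invertible S"
proof safe
  assume p: "positive_definite S"
  then show "transpose S = S" by (simp add: positive_definite_def)
  show "v \<bullet> (S *v v) \<ge> 0" for v
    using p by (cases "v = 0") (auto simp: positive_definite_def less_imp_le)
  have "inj ((*v) S)"
    unfolding linear_injective_0[OF matrix_vector_mul_linear]
    using p unfolding positive_definite_def by (metis inner_zero_right less_irrefl)
  then show "invertible S"
    using invertible_left_inverse matrix_left_invertible_injective by blast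
next
  assume S: "transpose S = S" "\<forall>v. v \<bullet> (S *v v) \<ge> 0" "invertible S"
  have "v = 0" if "v \<bullet> (S *v v) = 0" for v
  proof -
    have "S *v v = 0" using positive_semidefinite_kernel S that by blast
    then show ?thesis using S(3) by (metis invertible_def matrix_left_invertible_ker)
  qed
  then show "positive_definite S" using S unfolding positive_definite_def
    by (metis order_le_less)
qed

text \<open>\<open>\<Phi> r\<close> multiplies the eigenvector b by r b. Products act pointwise on
  the eigenvalues, so square roots and inverse square roots are both obtained by choosing r.\<close>

lemma symmetric_functional_calculus:
  fixes S :: "real^'n^'n"
  assumes S: "transpose S = S"
  obtains B d \<Phi> where "finite B" "\<And>b. b \<in> B \<Longrightarrow> S *v b = d b *\<^sub>R b" "\<And>b. b \<in> B \<Longrightarrow> norm b = 1"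
    "\<And>r. transpose (\<Phi> r) = (\<Phi> r :: real^'n^'n)" "\<And>r s. \<Phi> r ** \<Phi> s = \<Phi> (\<lambda>b. r b * s b)"
    "\<Phi> d = S" "\<Phi> (\<lambda>_. 1) = mat 1"
    "\<And>r v. v \<bullet> (\<Phi> r *v v) = (\<Sum>b\<in>B. r b * (b \<bullet> v)\<^sup>2)"
    "\<And>r s. (\<And>b. b \<in> B \<Longrightarrow> r b = s b) \<Longrightarrow> \<Phi> r = \<Phi> s"
proof -
  obtain B d where B: "finite B" "pairwise orthogonal B" "\<And>b. b \<in> B \<Longrightarrow> norm b = 1"
    "\<And>b. b \<in> B \<Longrightarrow> S *v b = d b *\<^sub>R b" "span B = UNIV"
    using selfadjoint_eigenbasis[of "(*v) S"] symmetric_matrix_inner[OF S] by blast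
  define f where "f r x = (\<Sum>b\<in>B. (r b * (b \<bullet> x)) *\<^sub>R b)" for r and x :: "real^'n"
  define \<Phi> where "\<Phi> r = matrix (f r)" for r
  have "linear (f r)" for r
    unfolding f_def by (rule linearI) (simp_all add: inner_right_distrib algebra_simps sum.distrib scaleR_sum_right)
  then have \<Phi>: "\<Phi> r *v x = f r x" for r x unfolding \<Phi>_def by (simp add: matrix_works)
  have bb: "b \<bullet> c = (if b = c then 1 else 0)" if "b \<in> B" "c \<in> B" for b c
    using B(2,3) that by (auto simp: pairwise_def orthogonal_def dot_square_norm)
  have bf: "b \<bullet> f r x = r b * (b \<bullet> x)" if "b \<in> B" for b r x
    using that B(1) by (simp add: f_def inner_sum_right bb if_distrib[of "\<lambda>x. _ * x"] cong: if_cong)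
  have id: "f (\<lambda>_. 1) x = x" for x
    using orthonormal_basis_expand[of B x] B by (simp add: f_def inner_commute)
  have eqI: "A = C" if "\<And>x. A *v x = C *v x" for A C :: "real^'n^'n"
    using that by (simp add: matrix_eq)
  show ?thesis
  proof (rule that[of B d \<Phi>])
    show "transpose (\<Phi> r) = \<Phi> r" for r
      by (rule symmetric_matrix_iff_inner)
        (auto simp: \<Phi> f_def inner_sum_left inner_sum_right intro!: sum.cong, simp add: inner_commute)
    show "\<Phi> r ** \<Phi> s = \<Phi> (\<lambda>b. r b * s b)" for r s
    proof (rule eqI)
      fix x
      show "(\<Phi> r ** \<Phi> s) *v x = \<Phi> (\<lambda>b. r b * s b) *v x"
        unfolding matrix_vector_mul_assoc[symmetric] \<Phi>
        by (simp add: f_def[of r] f_def[of "\<lambda>b. r b * s b"] bf mult.assoc)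
    qed
    show "\<Phi> d = S"
    proof (rule eqI)
      fix x
      have "S *v x = S *v f (\<lambda>_. 1) x" by (simp add: id)
      also have "\<dots> = f d x"
        unfolding f_def by (simp add: linear_sum[OF matrix_vector_mul_linear] matrix_vector_mult_scaleR B mult.commute)
      finally show "\<Phi> d *v x = S *v x" by (simp add: \<Phi>)
    qed
    show "\<Phi> (\<lambda>_. 1) = mat 1" by (rule eqI) (simp add: \<Phi> id)
    show "v \<bullet> (\<Phi> r *v v) = (\<Sum>b\<in>B. r b * (b \<bullet> v)\<^sup>2)" for r v
      by (simp add: \<Phi> f_def inner_sum_right power2_eq_square inner_commute mult.assoc)
    show "\<Phi> r = \<Phi> s" if "\<And>b. b \<in> B \<Longrightarrow> r b = s b" for r s
      by (rule eqI) (simp add: \<Phi> f_def that)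
  qed (use B in auto)
qed

lemma matrix_inv_mult:
  fixes A :: "'a::semiring_1^'n^'m"
  assumes "invertible A"
  shows "A ** matrix_inv A = mat 1" "matrix_inv A ** A = mat 1"
  using someI_ex[OF assms[unfolded invertible_def]] by (auto simp: matrix_inv_def)

lemma matrix_inv_eqI:
  fixes A :: "real^'n^'n"
  assumes "A ** B = mat 1"
  shows "matrix_inv A = B"
proof -
  have "invertible A" using assms by (auto simp: invertible_right_inverse)
  then have "matrix_inv A ** (A ** B) = B"
    by (simp add: matrix_mul_assoc matrix_inv_mult)
  then show ?thesis by (simp add: assms)
qed

lemma positive_semidefinite_sqrt:
  fixes S :: "real^'n^'n"
  assumes S: "transpose S = S" and psd: "\<And>v. v \<bullet> (S *v v) \<ge> 0"
  obtains R where "transpose R = R" "R ** R = S"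
proof -
  show thesis
  proof (rule symmetric_functional_calculus[OF S], goal_cases)
    case (1 B d \<Phi>)
    note P = 1
  have "d b \<ge> 0" if "b \<in> B" for b
    using psd[of b] P(2,3)[OF that] by (simp add: dot_square_norm)
  then have "\<Phi> (\<lambda>b. sqrt (d b) * sqrt (d b)) = \<Phi> d" by (intro P(9)) auto
  then have "\<Phi> (\<lambda>b. sqrt (d b)) ** \<Phi> (\<lambda>b. sqrt (d b)) = S" by (simp only: P(5,6))
  then show ?thesis using P(4) that by blast
qed
qed

lemma inverse_sqrt_exists:
  fixes S :: "real^'n^'n"
  assumes pd: "positive_definite S"
  obtains R where "positive_definite R" "R ** R = matrix_inv S"
proof -
  have S: "transpose S = S" using pd by (simp add: positive_definite_def)
  show thesis
  proof (rule symmetric_functional_calculus[OF S], goal_cases)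
    case (1 B d \<Phi>)
    note P = 1
  have d: "d b > 0" if "b \<in> B" for b
  proof -
    have "b \<noteq> 0" using P(3)[OF that] by auto
    then have "b \<bullet> (S *v b) > 0" using pd by (simp add: positive_definite_def)
    then show ?thesis using P(2,3)[OF that] by (simp add: dot_square_norm)
  qed
  define R where "R = \<Phi> (\<lambda>b. 1 / sqrt (d b))"
  define T where "T = \<Phi> (\<lambda>b. 1 / d b)"
  have RR: "R ** R = T"
    unfolding R_def T_def P(5) by (rule P(9)) (use d in \<open>auto simp: field_simps less_imp_le\<close>)
  have TS: "T ** S = mat 1"
  proof -
    have "T ** S = \<Phi> (\<lambda>b. 1 / d b) ** \<Phi> d" by (simp only: T_def P(6))
    also have "\<dots> = \<Phi> (\<lambda>_. 1)" unfolding P(5) by (rule P(9)) (use d in force)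
    finally show ?thesis by (simp only: P(7))
  qed
  then have ST: "S ** T = mat 1" by (simp add: matrix_left_right_inverse)
  have inv: "matrix_inv S = T" using ST by (rule matrix_inv_eqI)
  have "invertible R"
    using RR ST by (metis invertible_left_inverse matrix_mul_assoc matrix_left_right_inverse)
  moreover have "v \<bullet> (R *v v) \<ge> 0" for v
    unfolding R_def P(8) by (intro sum_nonneg mult_nonneg_nonneg) (use d in \<open>auto simp: less_imp_le\<close>)
  ultimately have "positive_definite R" using P(4) by (simp add: positive_definite_iff R_def)
  then show ?thesis using that RR inv by simp
qed
qed


text \<open>The constant is the minimum of the quadratic form on the unit sphere, attained by
  compactness and hence positive.\<close>

lemma positive_definite_lower_bound:
  fixes R :: "real^'n^'n"
  assumes "positive_definite R"
  obtains m where "m > 0" "\<And>v. m * (norm v)\<^sup>2 \<le> v \<bullet> (R *v v)"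
proof -
  have "axis undefined 1 \<in> sphere (0::real^'n) 1" by simp
  moreover have "continuous_on (sphere 0 1) (\<lambda>v. v \<bullet> (R *v v))"
    by (intro continuous_intros)
  ultimately obtain w where w: "norm w = 1" and mn: "\<And>v. norm v = 1 \<Longrightarrow> w \<bullet> (R *v w) \<le> v \<bullet> (R *v v)"
    using continuous_attains_inf[of "sphere 0 1" "\<lambda>v. v \<bullet> (R *v v)"]
    by (metis compact_sphere empty_iff mem_sphere_0)
  show ?thesis
  proof
    show "w \<bullet> (R *v w) > 0" using assms w unfolding positive_definite_def by (metis norm_zero zero_neq_one)
    fix v :: "real^'n"
    show "w \<bullet> (R *v w) * (norm v)\<^sup>2 \<le> v \<bullet> (R *v v)"
    proof (cases "v = 0")
      case False
      then have "w \<bullet> (R *v w) \<le> (v /\<^sub>R norm v) \<bullet> (R *v (v /\<^sub>R norm v))" by (intro mn) simp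
      also have "\<dots> = v \<bullet> (R *v v) / (norm v)\<^sup>2"
        by (simp add: matrix_vector_mult_scaleR power2_eq_square divide_inverse)
      finally show ?thesis using False by (simp add: le_divide_eq)
    qed simp
  qed
qed

lemma inner_matrix_mult_symmetric:
  fixes X R :: "real^'n^'n"
  assumes "transpose R = R"
  shows "X \<bullet> (X ** R) = (\<Sum>i\<in>UNIV. (X $ i) \<bullet> (R *v (X $ i)))"
proof -
  have "(X ** R) $ i = R *v (X $ i)" for i
  proof -
    have "(X ** R) $ i = (X $ i) v* R"
      by (simp add: vec_eq_iff matrix_matrix_mult_def vector_matrix_mult_def mult.commute)
    also have "\<dots> = R *v (X $ i)" using assms by (metis transpose_matrix_vector)
    finally show ?thesis .
  qed
  then show ?thesis by (simp add: inner_vec_def[of X])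
qed

lemma matrix_diff_ldistrib: "A ** (B - C) = A ** B - A ** (C :: real^'n^'m)"
  by (simp add: matrix_matrix_mult_def vec_eq_iff right_diff_distrib sum_subtractf)

lemma matrix_diff_rdistrib: "(A - B) ** C = A ** C - B ** (C :: real^'n^'m)"
  by (simp add: matrix_matrix_mult_def vec_eq_iff left_diff_distrib sum_subtractf)

lemma inner_transpose: "transpose X \<bullet> transpose Y = X \<bullet> (Y :: real^'n^'m)"
  by (simp add: inner_vec_def transpose_def) (rule sum.swap)

text \<open>Pair \<open>R ** R - R' ** R' = X ** R + R' ** X\<close>, where \<open>X = R - R'\<close>, with \<open>X\<close>.\<close>

lemma positive_definite_sqrt_lipschitz:
  fixes R R' :: "real^'n^'n"
  assumes R: "positive_definite R" and R': "positive_definite R'"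
    and m: "\<And>v. m * (norm v)\<^sup>2 \<le> v \<bullet> (R *v v)"
  shows "m * norm (R - R') \<le> norm (R ** R - R' ** R')"
proof -
  define X where "X = R - R'"
  have tX: "transpose X = X" and tR: "transpose R = R" and tR': "transpose R' = R'"
    using R R' by (auto simp: X_def positive_definite_def transpose_def vec_eq_iff)
  have "m * (norm X)\<^sup>2 = (\<Sum>i\<in>UNIV. m * (norm (X $ i))\<^sup>2)"
    by (simp add: power2_norm_eq_inner inner_vec_def[of X] sum_distrib_left)
  also have "\<dots> \<le> X \<bullet> (X ** R)"
    unfolding inner_matrix_mult_symmetric[OF tR] by (intro sum_mono m)
  also have "\<dots> \<le> X \<bullet> (X ** R) + X \<bullet> (R' ** X)"
  proof -
    have "X \<bullet> (R' ** X) = X \<bullet> (X ** R')"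
      using inner_transpose[of X "R' ** X"] by (simp add: matrix_transpose_mul tX tR')
    also have "\<dots> \<ge> 0" unfolding inner_matrix_mult_symmetric[OF tR']
      using R' by (intro sum_nonneg) (simp add: positive_definite_iff)
    finally show ?thesis by simp
  qed
  also have "\<dots> = X \<bullet> (R ** R - R' ** R')"
    by (simp add: X_def inner_add_right[symmetric] matrix_diff_ldistrib matrix_diff_rdistrib)
  also have "\<dots> \<le> norm X * norm (R ** R - R' ** R')" by (rule norm_cauchy_schwarz)
  finally have "m * norm X * norm X \<le> norm (R ** R - R' ** R') * norm X"
    by (simp add: power2_eq_square mult.commute mult.left_commute)
  then show ?thesis
    by (cases "norm X = 0") (auto simp: X_def)
qed

text \<open>The definite description in \<open>inv_sqrt\<close> requires uniqueness. Two positive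
  definite roots of the same matrix coincide by the Lipschitz estimate, whose right-hand side is
  then zero.\<close>

lemma inv_sqrt_works:
  fixes S :: "real^'n^'n"
  assumes "positive_definite S"
  shows "positive_definite (inv_sqrt S)" "inv_sqrt S ** inv_sqrt S = matrix_inv S"
proof -
  have "\<exists>!R. positive_definite R \<and> R ** R = matrix_inv S"
  proof (rule ex_ex1I)
    show "\<exists>R. positive_definite R \<and> R ** R = matrix_inv S"
      using inverse_sqrt_exists[OF assms] by blast
    fix R R' :: "real^'n^'n"
    assume R: "positive_definite R \<and> R ** R = matrix_inv S" and R': "positive_definite R' \<and> R' ** R' = matrix_inv S"
    obtain m where m: "m > 0" "\<And>v. m * (norm v)\<^sup>2 \<le> v \<bullet> (R *v v)"
      using positive_definite_lower_bound R by blast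
    show "R = R'" using positive_definite_sqrt_lipschitz[of R R' m] R R' m
      by (simp add: mult_le_0_iff)
  qed
  from theI'[OF this] show "positive_definite (inv_sqrt S)" "inv_sqrt S ** inv_sqrt S = matrix_inv S"
    by (auto simp: inv_sqrt_def)
qed

lemma inv_sqrt_conjugate:
  fixes S :: "real^'n^'n"
  assumes "positive_definite S"
  shows "inv_sqrt S ** S ** inv_sqrt S = mat 1"
proof -
  let ?R = "inv_sqrt S"
  have S: "invertible S" using assms by (simp add: positive_definite_iff)
  have "?R ** (?R ** S) = mat 1"
    using inv_sqrt_works[OF assms] S by (simp add: matrix_mul_assoc matrix_inv_mult)
  then have "(?R ** S) ** ?R = mat 1" using matrix_left_right_inverse by blast
  then show ?thesis .
qed

text \<open>The norm of a matrix as a vector of vectors is the Frobenius norm; each entry of the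
  product is bounded by Cauchy-Schwarz.\<close>

lemma norm_matrix_mult_le: "norm (A ** B) \<le> norm A * norm (B :: real^'n^'m)" for A :: "real^'m^'k"
proof -
  have n2: "(norm (C :: real^'a::finite^'b::finite))\<^sup>2 = (\<Sum>i\<in>UNIV. (norm (C $ i))\<^sup>2)" for C
    by (simp add: power2_norm_eq_inner inner_vec_def[of C])
  have v2: "(norm (x :: real^'n))\<^sup>2 = (\<Sum>j\<in>UNIV. (x $ j)\<^sup>2)" for x
    unfolding power2_norm_eq_inner by (simp add: inner_vec_def power2_eq_square)
  have c2: "(norm B)\<^sup>2 = (\<Sum>j\<in>UNIV. (norm (column j B))\<^sup>2)"
    unfolding power2_norm_eq_inner inner_transpose[of B B, symmetric]
    by (simp add: inner_vec_def[of "transpose B"]) (simp add: transpose_def column_def)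
  have "(norm (A ** B))\<^sup>2 = (\<Sum>i\<in>UNIV. \<Sum>j\<in>UNIV. ((A $ i) \<bullet> column j B)\<^sup>2)"
    unfolding n2 v2 by (simp add: inner_vec_def matrix_matrix_mult_def column_def)
  also have "\<dots> \<le> (\<Sum>i\<in>UNIV. \<Sum>j\<in>UNIV. (norm (A $ i))\<^sup>2 * (norm (column j B))\<^sup>2)"
    by (intro sum_mono) (metis Cauchy_Schwarz_ineq2 abs_ge_zero power2_abs power_mono power_mult_distrib)
  also have "\<dots> = (norm A * norm B)\<^sup>2"
    unfolding power_mult_distrib n2[of A] c2 by (simp add: sum_product)
  finally show ?thesis by (rule power2_le_imp_le) simp
qed

text \<open>With X and Y the inverses of B and A, the resolvent identity X - Y = X (A - B) Y first
  bounds X by 2 c and then gives the estimate.\<close>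

lemma continuous_on_matrix_inv: "continuous_on {A :: real^'n^'n. invertible A} matrix_inv"
  unfolding continuous_on_iff
proof safe
  fix A :: "real^'n^'n" and e :: real
  assume A: "invertible A" and "e > 0"
  define c where "c = norm (matrix_inv A) + 1"
  have c: "c > 0" by (simp add: c_def add_nonneg_pos)
  \<comment> \<open>The first term gives |A - B| |Y| \<le> 1 / 2, hence |X| \<le> 2 c; the second
    turns the bound 2 c^2 |A - B| into 2 e / 3.\<close>
  define d where "d = min (1 / (2 * c)) (e / (3 * c * c))"
  have "d > 0" using c \<open>e > 0\<close> by (simp add: d_def)
  moreover have "dist (matrix_inv B) (matrix_inv A) < e" if B: "invertible B" and BA: "dist B A < d" for B
  proof -
    define X where "X = matrix_inv B"
    define Y where "Y = matrix_inv A"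
    define E where "E = norm (A - B)"
    have E: "0 \<le> E" "E < 1 / (2 * c)" "E < e / (3 * c * c)"
      using BA by (auto simp: E_def d_def dist_norm norm_minus_commute)
    have "X - Y = X ** (A - B) ** Y"
      unfolding X_def Y_def matrix_diff_ldistrib matrix_diff_rdistrib
      by (simp add: matrix_inv_mult A B flip: matrix_mul_assoc)
    then have "norm (X - Y) \<le> norm (X ** (A - B)) * norm Y"
      using norm_matrix_mult_le[of "X ** (A - B)" Y] by simp
    also have "\<dots> \<le> norm X * E * norm Y"
      unfolding E_def by (intro mult_right_mono norm_matrix_mult_le norm_ge_zero)
    finally have 1: "norm (X - Y) \<le> norm X * E * norm Y" .
    have Yc: "norm Y \<le> c" by (simp add: Y_def c_def)
    have EY: "E * norm Y \<le> 1 / 2"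
    proof -
      have "E * norm Y \<le> 1 / (2 * c) * c" using E Yc c by (intro mult_mono) auto
      then show ?thesis using c by simp
    qed
    have "norm X \<le> norm Y + norm (X - Y)" using norm_triangle_sub[of X Y] by (simp add: add.commute)
    also have "\<dots> \<le> norm Y + norm X * (1 / 2)"
      using 1 mult_left_mono[OF EY, of "norm X"] by (simp add: mult.assoc)
    finally have "norm X \<le> 2 * c" using Yc by simp
    then have "norm (X - Y) \<le> 2 * c * E * c"
      using 1 Yc E c mult_mono[of "norm X * E" "2 * c * E" "norm Y" c] mult_right_mono[of "norm X" "2 * c" E]
      by simp
    also have "\<dots> < 2 * c * (e / (3 * c * c)) * c"
      using E c by (intro mult_strict_right_mono mult_strict_left_mono) auto
    also have "\<dots> \<le> e" using c \<open>e > 0\<close> by simp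
    finally show ?thesis by (simp add: X_def Y_def dist_norm)
  qed
  ultimately show "\<exists>d>0. \<forall>x'\<in>Collect invertible. dist x' A < d \<longrightarrow> dist (matrix_inv x') (matrix_inv A) < e"
    by auto
qed

text \<open>The Lipschitz estimate carries continuity over from the inverse to its root. Its
  constant m belongs to the fixed point S, so it does not degenerate as B varies.\<close>

lemma continuous_on_inv_sqrt: "continuous_on {S :: real^'n^'n. positive_definite S} inv_sqrt"
  unfolding continuous_on_iff
proof safe
  fix S :: "real^'n^'n" and e :: real
  assume S: "positive_definite S" and "e > 0"
  obtain m where m: "m > 0" "\<And>v. m * (norm v)\<^sup>2 \<le> v \<bullet> (inv_sqrt S *v v)"
    using positive_definite_lower_bound[OF inv_sqrt_works(1)[OF S]] by blast
  have "\<exists>d>0. \<forall>B\<in>Collect invertible. dist B S < d \<longrightarrow> dist (matrix_inv B) (matrix_inv S) < m * e"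
    using continuous_on_matrix_inv[unfolded continuous_on_iff, rule_format, of S "m * e"] S m(1) \<open>e > 0\<close>
    by (simp add: positive_definite_iff)
  then obtain d where d: "d > 0"
    "\<And>B. invertible B \<Longrightarrow> dist B S < d \<Longrightarrow> dist (matrix_inv B) (matrix_inv S) < m * e" by blast
  have "dist (inv_sqrt B) (inv_sqrt S) < e" if B: "positive_definite B" and BS: "dist B S < d" for B
  proof -
    have "m * norm (inv_sqrt S - inv_sqrt B) \<le> norm (matrix_inv S - matrix_inv B)"
      using positive_definite_sqrt_lipschitz[OF inv_sqrt_works(1)[OF S] inv_sqrt_works(1)[OF B] m(2)]
      by (simp add: inv_sqrt_works S B)
    also have "\<dots> < m * e" using d(2)[OF _ BS] B by (simp add: positive_definite_iff dist_norm norm_minus_commute)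
    finally show ?thesis using m(1) by (simp add: dist_norm norm_minus_commute)
  qed
  then show "\<exists>d>0. \<forall>x'\<in>Collect positive_definite. dist x' S < d \<longrightarrow> dist (inv_sqrt x') (inv_sqrt S) < e"
    using d(1) by auto
qed

lemma positive_definite_mat_1: "positive_definite (mat 1 :: real^'n^'n)"
  by (simp add: positive_definite_def)

lemma inv_sqrt_mat_1: "inv_sqrt (mat 1 :: real^'n^'n) = mat 1"
proof -
  let ?I = "mat 1 :: real^'n^'n"
  have "1 * norm (?I - inv_sqrt ?I) \<le> norm (?I ** ?I - inv_sqrt ?I ** inv_sqrt ?I)"
    by (rule positive_definite_sqrt_lipschitz)
      (auto simp: positive_definite_mat_1 inv_sqrt_works power2_norm_eq_inner)
  also have "inv_sqrt ?I ** inv_sqrt ?I = ?I"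
    by (simp add: inv_sqrt_works positive_definite_mat_1 matrix_inv_eqI)
  finally show ?thesis by simp
qed

section \<open>Orthogonal matrices and the adjustment of single rows\<close>

lemma orthogonal_matrix_iff_rows:
  "orthogonal_matrix (U :: real^'n^'n) \<longleftrightarrow> (\<forall>i j. (U $ i) \<bullet> (U $ j) = (if i = j then 1 else 0))"
proof -
  have "orthogonal_matrix U \<longleftrightarrow> U ** transpose U = mat 1"
    by (metis orthogonal_matrix_def orthogonal_matrix matrix_left_right_inverse)
  also have "\<dots> \<longleftrightarrow> (\<forall>i j. (U $ i) \<bullet> (U $ j) = (if i = j then 1 else 0))"
    by (simp add: vec_eq_iff matrix_matrix_mult_def transpose_def mat_def inner_vec_def)
  finally show ?thesis .
qed

lemma compact_orthogonal_matrices: "compact {U :: real^'n^'n. orthogonal_matrix U}"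
proof -
  have "closed {U :: real^'n^'n. \<forall>i j. (U $ i) \<bullet> (U $ j) = (if i = j then 1 else 0)}"
    by (intro closed_Collect_all closed_Collect_eq continuous_intros)
  moreover have "bounded {U :: real^'n^'n. orthogonal_matrix U}"
  proof (rule boundedI)
    fix U :: "real^'n^'n" assume "U \<in> {U. orthogonal_matrix U}"
    then have "(norm U)\<^sup>2 = real CARD('n)"
      by (simp add: orthogonal_matrix_iff_rows power2_norm_eq_inner inner_vec_def[of U])
    then show "norm U \<le> sqrt (real CARD('n))" by (metis norm_ge_zero order_refl real_sqrt_unique)
  qed
  ultimately show ?thesis by (simp add: compact_eq_bounded_closed orthogonal_matrix_iff_rows)
qed

lemma norm_matrix_le_sum_rows: "norm (A :: real^'n^'m) \<le> (\<Sum>i\<in>UNIV. norm (A $ i))"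
  unfolding norm_vec_def[of A] by (rule L2_set_le_sum) simp

text \<open>The rotation in the plane of \<open>U $ k\<close> and \<open>u\<close> that takes the first to the second fixes the
  rows orthogonal to both.\<close>

lemma orthogonal_matrix_replace_row:
  fixes U :: "real^'n^'n"
  assumes U: "orthogonal_matrix U" and u: "norm u = 1" and near: "norm (u - U $ k) \<le> 1"
  obtains V where "orthogonal_matrix V" "V $ k = u"
    "\<And>j. j \<noteq> k \<Longrightarrow> (U $ j) \<bullet> u = 0 \<Longrightarrow> V $ j = U $ j"
    "norm (V - U) \<le> 2 * real CARD('n) * norm (u - U $ k)"
proof -
  define r where "r = U $ k"
  define t where "t = 1 + u \<bullet> r"
  have rr: "r \<bullet> r = 1" and uu: "u \<bullet> u = 1" using U u by (auto simp: r_def orthogonal_matrix_iff_rows norm_eq_1)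
  have Ur: "(U $ j) \<bullet> r = (if j = k then 1 else 0)" for j using U by (auto simp: r_def orthogonal_matrix_iff_rows)
  have n1: "(norm (u - r))\<^sup>2 = 2 - 2 * (u \<bullet> r)"
    unfolding power2_norm_eq_inner using rr uu by (auto simp: algebra_simps inner_commute)
  have "(norm (u - r))\<^sup>2 \<le> 1" using near by (simp add: r_def power_le_one)
  then have t: "t \<ge> 3 / 2" using n1 by (simp add: t_def)
  \<comment> \<open>The rotation sends x to x - (((u + r) \<bullet> x) / t) (u + r) + 2 (r \<bullet>
    x) u. Rows other than k are orthogonal to r, so their last term drops out and (u + r) \<bullet>
    x reduces to u \<bullet> x.\<close>
  define V where "V = (\<chi> j. if j = k then u else U $ j - (((U $ j) \<bullet> u) / t) *\<^sub>R (u + r))"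
  have Vk: "V $ k = u" and Vj: "j \<noteq> k \<Longrightarrow> V $ j = U $ j - (((U $ j) \<bullet> u) / t) *\<^sub>R (u + r)" for j
    by (auto simp: V_def)
  show ?thesis
  proof (rule that[of V])
    have urt: "(u + r) \<bullet> u = t" "(u + r) \<bullet> (u + r) = 2 * t"
      using rr uu by (auto simp: t_def algebra_simps inner_commute)
    have x1: "(V $ j) \<bullet> u = 0" if "j \<noteq> k" for j
      using that t urt by (simp add: Vj inner_diff_left)
    have x2: "(V $ i) \<bullet> (V $ j) = (if i = j then 1 else 0)" if "i \<noteq> k" "j \<noteq> k" for i j
    proof -
      define a where "a = (U $ i) \<bullet> u / t"
      define b where "b = (U $ j) \<bullet> u / t"
      have ab: "(U $ i) \<bullet> (u + r) = a * t" "(u + r) \<bullet> (U $ j) = b * t"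
        using t that Ur[of i] Ur[of j] by (auto simp: a_def b_def inner_add_right inner_add_left inner_commute)
      have "(V $ i) \<bullet> (V $ j) = (U $ i - a *\<^sub>R (u + r)) \<bullet> (U $ j - b *\<^sub>R (u + r))"
        using that by (simp add: Vj a_def b_def)
      also have "\<dots> = (U $ i) \<bullet> (U $ j) - b * ((U $ i) \<bullet> (u + r)) - a * ((u + r) \<bullet> (U $ j)) + a * b * ((u + r) \<bullet> (u + r))"
        by (simp add: inner_diff_left inner_diff_right algebra_simps)
      also have "\<dots> = (U $ i) \<bullet> (U $ j)" by (simp only: ab urt) simp
      finally show ?thesis using U by (simp add: orthogonal_matrix_iff_rows)
    qed
    have "(V $ i) \<bullet> (V $ j) = (if i = j then 1 else 0)" for i j
      using x1[of i] x1[of j] x2[of i j] uu Vk by (cases "i = k"; cases "j = k") (auto simp: inner_commute)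
    then show "orthogonal_matrix V" by (simp add: orthogonal_matrix_iff_rows)
    show "V $ k = u" by fact
    show "V $ j = U $ j" if "j \<noteq> k" "(U $ j) \<bullet> u = 0" for j using that by (simp add: Vj)
    have "norm ((V - U) $ j) \<le> 2 * norm (u - U $ k)" for j
    proof (cases "j = k")
      case True then show ?thesis by (simp add: Vk)
    next
      case False
      have "\<bar>(U $ j) \<bullet> u\<bar> = \<bar>(U $ j) \<bullet> (u - r)\<bar>" using Ur[of j] False by (simp add: inner_diff_right)
      also have "\<dots> \<le> norm (U $ j) * norm (u - r)" by (rule Cauchy_Schwarz_ineq2)
      also have "norm (U $ j) = 1" using U by (simp add: orthogonal_matrix_iff_rows norm_eq_1)
      finally have c: "\<bar>(U $ j) \<bullet> u\<bar> \<le> norm (u - r)" by simp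
      have "norm (u + r) \<le> 2" using norm_triangle_ineq[of u r] u rr by (simp add: norm_eq_1[symmetric])
      then have "\<bar>(U $ j) \<bullet> u\<bar> / t * norm (u + r) \<le> norm (u - r) / 1 * 2"
        using c t by (intro mult_mono frac_le) auto
      then show ?thesis using False t by (simp add: Vj r_def)
    qed
    then have "(\<Sum>j\<in>UNIV. norm ((V - U) $ j)) \<le> (\<Sum>j\<in>(UNIV::'n set). 2 * norm (u - U $ k))"
      by (intro sum_mono)
    then show "norm (V - U) \<le> 2 * real CARD('n) * norm (u - U $ k)"
      using norm_matrix_le_sum_rows[of "V - U"] by simp
  qed
qed

text \<open>The Householder reflection along u - U_k exchanges the two vectors and fixes what is
  orthogonal to both. It allows u to be far from U_k, but V stays at a fixed distance from U even
  for close u, so it serves global comparisons only.\<close>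

lemma orthogonal_matrix_reflect_row:
  fixes U :: "real^'n^'n"
  assumes U: "orthogonal_matrix U" and u: "norm u = 1"
  obtains V where "orthogonal_matrix V" "V $ k = u"
    "\<And>j. j \<noteq> k \<Longrightarrow> (U $ j) \<bullet> u = 0 \<Longrightarrow> V $ j = U $ j"
proof (cases "u = U $ k")
  case True then show ?thesis using that U by blast
next
  case False
  define w where "w = u - U $ k"
  have ww: "w \<bullet> w \<noteq> 0" using False by (simp add: w_def)
  define V where "V = (\<chi> j. U $ j - (2 * ((U $ j) \<bullet> w) / (w \<bullet> w)) *\<^sub>R w)"
  have VV: "(V $ i) \<bullet> (V $ j) = (U $ i) \<bullet> (U $ j)" for i j
  proof -
    define a where "a = 2 * ((U $ i) \<bullet> w) / (w \<bullet> w)"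
    define b where "b = 2 * ((U $ j) \<bullet> w) / (w \<bullet> w)"
    have ab: "(U $ i) \<bullet> w = a * (w \<bullet> w) / 2" "w \<bullet> (U $ j) = b * (w \<bullet> w) / 2"
      using ww by (auto simp: a_def b_def inner_commute)
    have "(V $ i) \<bullet> (V $ j) = (U $ i - a *\<^sub>R w) \<bullet> (U $ j - b *\<^sub>R w)"
      by (simp add: V_def a_def b_def)
    also have "\<dots> = (U $ i) \<bullet> (U $ j) - b * ((U $ i) \<bullet> w) - a * (w \<bullet> (U $ j)) + a * b * (w \<bullet> w)"
      by (simp add: inner_diff_left inner_diff_right algebra_simps)
    also have "\<dots> = (U $ i) \<bullet> (U $ j)" by (simp only: ab) simp
    finally show ?thesis .
  qed
  have rr: "(U $ k) \<bullet> (U $ k) = 1" "u \<bullet> u = 1" using U u by (auto simp: orthogonal_matrix_iff_rows norm_eq_1)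
  have "2 * ((U $ k) \<bullet> w) = - (w \<bullet> w)"
    using rr by (simp add: w_def inner_diff_left inner_diff_right inner_commute)
  then have Vk: "V $ k = u" using ww by (simp add: V_def w_def)
  have Vj: "V $ j = U $ j" if "j \<noteq> k" "(U $ j) \<bullet> u = 0" for j
  proof -
    have "(U $ j) \<bullet> w = 0" using that U by (simp add: w_def inner_diff_right orthogonal_matrix_iff_rows)
    then show ?thesis by (simp add: V_def)
  qed
  have "orthogonal_matrix V" using U by (simp add: orthogonal_matrix_iff_rows VV)
  then show ?thesis using Vk Vj by (rule that)
qed

text \<open>Supplies competitors that share the rows already known to converge and nevertheless tend
  to the identity. The rows in A are rotated into place one by one; a later rotation does not
  disturb an earlier row, because the rows of U m are orthogonal to each other.\<close>

lemma orthogonal_matrix_adjust_rows: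
  fixes U :: "nat \<Rightarrow> real^'n^'n"
  assumes U: "\<And>m. orthogonal_matrix (U m)"
    and lim: "\<And>j. j \<in> A \<Longrightarrow> (\<lambda>m. U m $ j) \<longlonglongrightarrow> axis j 1"
  shows "\<exists>V. (\<forall>m. orthogonal_matrix (V m)) \<and> V \<longlonglongrightarrow> mat 1 \<and> (\<forall>j\<in>A. \<forall>\<^sub>F m in sequentially. V m $ j = U m $ j)"
  using finite[of A] lim
proof (induction A rule: finite_induct)
  case empty
  show ?case by (intro exI[of _ "\<lambda>_. mat 1"]) (auto simp: orthogonal_matrix_id)
next
  case (insert k A)
  then obtain V where V: "\<And>m. orthogonal_matrix (V m)" "V \<longlonglongrightarrow> mat 1"
    "\<And>j. j \<in> A \<Longrightarrow> \<forall>\<^sub>F m in sequentially. V m $ j = U m $ j" by auto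
  define e where "e m = norm (U m $ k - V m $ k)" for m
  have "(\<lambda>m. V m $ k) \<longlonglongrightarrow> mat 1 $ k" using V(2) by (rule tendsto_vec_nth)
  moreover have "mat 1 $ k = (axis k 1 :: real^'n)" by (auto simp: mat_def axis_def vec_eq_iff)
  ultimately have "(\<lambda>m. U m $ k - V m $ k) \<longlonglongrightarrow> axis k 1 - axis k 1"
    using insert.prems by (intro tendsto_diff) auto
  then have e0: "e \<longlonglongrightarrow> 0" unfolding e_def by (simp add: tendsto_norm_zero)
  have "\<exists>V'. orthogonal_matrix V' \<and> (e m \<le> 1 \<longrightarrow> V' $ k = U m $ k \<and>
      (\<forall>j. j \<noteq> k \<longrightarrow> (V m $ j) \<bullet> (U m $ k) = 0 \<longrightarrow> V' $ j = V m $ j) \<and>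
      norm (V' - V m) \<le> 2 * real CARD('n) * e m)" for m
  proof (cases "e m \<le> 1")
    case True
    have "norm (U m $ k) = 1" using U by (simp add: orthogonal_matrix_iff_rows norm_eq_1)
    from orthogonal_matrix_replace_row[OF V(1)[of m] this, of k] True show ?thesis
      unfolding e_def by metis
  qed (use V in auto)
  then obtain V' where V': "\<And>m. orthogonal_matrix (V' m)"
    "\<And>m. e m \<le> 1 \<Longrightarrow> V' m $ k = U m $ k"
    "\<And>m j. e m \<le> 1 \<Longrightarrow> j \<noteq> k \<Longrightarrow> (V m $ j) \<bullet> (U m $ k) = 0 \<Longrightarrow> V' m $ j = V m $ j"
    "\<And>m. e m \<le> 1 \<Longrightarrow> norm (V' m - V m) \<le> 2 * real CARD('n) * e m"
    by metis
  have ev: "\<forall>\<^sub>F m in sequentially. e m \<le> 1"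
    using order_tendstoD(2)[OF e0, of 1] by (auto elim: eventually_mono)
  have "(\<lambda>m. V' m - V m) \<longlonglongrightarrow> 0"
    by (rule Lim_null_comparison[OF eventually_mono[OF ev V'(4)]])
       (use tendsto_mult_right_zero[OF e0] in auto)
  from tendsto_add[OF this V(2)] have "V' \<longlonglongrightarrow> mat 1" by simp
  moreover have "\<forall>\<^sub>F m in sequentially. V' m $ j = U m $ j" if "j \<in> insert k A" for j
  proof (cases "j = k")
    case True then show ?thesis using ev V'(2) by (auto elim: eventually_mono)
  next
    case False
    then have "j \<in> A" using that by simp
    from V(3)[OF this] ev show ?thesis
    proof eventually_elim
      case (elim m)
      then show ?case using V'(3)[of m j] U[of m] False by (simp add: orthogonal_matrix_iff_rows)
    qed
  qed
  ultimately show ?case using V'(1) by blast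
qed

section \<open>Measurable selection of successive maximizers\<close>

definition caratheodory :: "'a measure \<Rightarrow> ('a \<Rightarrow> 'b::euclidean_space \<Rightarrow> real) \<Rightarrow> bool" where
  "caratheodory M h \<longleftrightarrow> (\<forall>\<omega>\<in>space M. continuous_on UNIV (h \<omega>)) \<and> (\<forall>u. (\<lambda>\<omega>. h \<omega> u) \<in> borel_measurable M)"

text \<open>Measurability is expressed through suprema of Caratheodory functions instead of hitting
  sets, since this is the form that is inherited by the set of maximizers.\<close>

definition measurable_correspondence :: "'a measure \<Rightarrow> ('a \<Rightarrow> 'b::euclidean_space set) \<Rightarrow> bool" where
  "measurable_correspondence M \<Phi> \<longleftrightarrow> (\<forall>\<omega>\<in>space M. compact (\<Phi> \<omega>) \<and> \<Phi> \<omega> \<noteq> {}) \<and>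
     (\<forall>h. caratheodory M h \<longrightarrow> (\<lambda>\<omega>. SUP u\<in>\<Phi> \<omega>. h \<omega> u) \<in> borel_measurable M)"

lemma continuous_attains_SUP:
  fixes h :: "'b::euclidean_space \<Rightarrow> real"
  assumes "compact C" "C \<noteq> {}" "continuous_on UNIV h"
  shows "\<exists>u\<in>C. h u = (SUP v\<in>C. h v)" "u \<in> C \<Longrightarrow> h u \<le> (SUP v\<in>C. h v)" "bdd_above (h ` C)"
proof -
  have c: "continuous_on C h" using assms by (auto intro: continuous_on_subset)
  then show b: "bdd_above (h ` C)"
    using assms(1) by (intro bounded_imp_bdd_above compact_imp_bounded compact_continuous_image)
  then show "u \<in> C \<Longrightarrow> h u \<le> (SUP v\<in>C. h v)" by (rule cSUP_upper2) auto
  obtain u where u: "u \<in> C" "\<And>v. v \<in> C \<Longrightarrow> h v \<le> h u"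
    using continuous_attains_sup[OF assms(1,2) c] by auto
  then have "h u = (SUP v\<in>C. h v)"
    using b assms by (intro antisym cSUP_upper2 cSUP_least) auto
  then show "\<exists>u\<in>C. h u = (SUP v\<in>C. h v)" using u by blast
qed

text \<open>By continuity the supremum over K equals the one over a countable dense subset.\<close>

lemma measurable_correspondence_const:
  fixes M :: "'a measure" and K :: "'b::euclidean_space set"
  assumes K: "compact K" "K \<noteq> {}"
  shows "measurable_correspondence M (\<lambda>_. K)"
  unfolding measurable_correspondence_def
proof (intro conjI allI impI ballI)
  fix h :: "'a \<Rightarrow> 'b \<Rightarrow> real" assume h: "caratheodory M h"
  obtain T where T: "countable T" "T \<subseteq> K" "K \<subseteq> closure T" using separable by blast
  have "T \<noteq> {}" using T K by auto
  have eq: "(SUP u\<in>T. h \<omega> u) = (SUP u\<in>K. h \<omega> u)" and bdd: "bdd_above (h \<omega> ` T)" if \<omega>: "\<omega> \<in> space M" for \<omega>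
  proof -
    have c: "continuous_on UNIV (h \<omega>)" using h \<omega> by (simp add: caratheodory_def)
    have bK: "bdd_above (h \<omega> ` K)" using continuous_attains_SUP(3)[OF K c] .
    then show bT: "bdd_above (h \<omega> ` T)" using T by (meson bdd_above_mono image_mono)
    have "h \<omega> u \<le> (SUP u\<in>T. h \<omega> u)" if "u \<in> K" for u
    proof -
      have "closed {u. h \<omega> u \<le> (SUP u\<in>T. h \<omega> u)}"
        using c by (intro closed_Collect_le continuous_intros)
      moreover have "T \<subseteq> {u. h \<omega> u \<le> (SUP u\<in>T. h \<omega> u)}" using bT by (auto intro: cSUP_upper)
      ultimately have "closure T \<subseteq> {u. h \<omega> u \<le> (SUP u\<in>T. h \<omega> u)}" by (rule closure_minimal[rotated])
      then show ?thesis using T that by auto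
    qed
    then show "(SUP u\<in>T. h \<omega> u) = (SUP u\<in>K. h \<omega> u)"
      using K T \<open>T \<noteq> {}\<close> bK by (intro antisym cSUP_subset_mono cSUP_least) auto
  qed
  have "(\<lambda>\<omega>. SUP u\<in>T. h \<omega> u) \<in> borel_measurable M"
    using h bdd T by (intro borel_measurable_cSUP) (auto simp: caratheodory_def)
  then show "(\<lambda>\<omega>. SUP u\<in>K. h \<omega> u) \<in> borel_measurable M"
    using eq by (simp cong: measurable_cong)
qed (use K in auto)

text \<open>Penalizing the distance of \<open>g\<close> to its maximum writes the supremum over the set of maximizers as
  a limit of suprema over the whole set, and hence shows that it is measurable.\<close>

lemma penalized_SUP_tendsto:
  fixes g h :: "'b::euclidean_space \<Rightarrow> real"
  assumes C: "compact C" "C \<noteq> {}" and g: "continuous_on UNIV g" and h: "continuous_on UNIV h"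
  defines "G \<equiv> SUP u\<in>C. g u"
  shows "compact {u \<in> C. g u = G}" "{u \<in> C. g u = G} \<noteq> {}"
    "(\<lambda>m. SUP u\<in>C. h u + real m * (g u - G)) \<longlonglongrightarrow> (SUP u\<in>{u \<in> C. g u = G}. h u)"
proof -
  let ?S = "{u \<in> C. g u = G}"
  have gG: "u \<in> C \<Longrightarrow> g u \<le> G" for u unfolding G_def by (rule continuous_attains_SUP(2)[OF C g])
  have "closed {u. g u = G}" using g by (intro closed_Collect_eq continuous_intros)
  then have "compact (C \<inter> {u. g u = G})" using C by (intro compact_Int_closed)
  then show S: "compact ?S" by (simp add: Int_def)
  show Sne: "?S \<noteq> {}" using continuous_attains_SUP(1)[OF C g] by (auto simp: G_def)
  obtain u where u: "u \<in> ?S" "h u = (SUP u\<in>?S. h u)" using continuous_attains_SUP(1)[OF S Sne h] by auto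
  define L where "L = (SUP u\<in>?S. h u)"
  define F where "F m = (SUP u\<in>C. h u + real m * (g u - G))" for m
  have cF: "continuous_on UNIV (\<lambda>u. h u + real m * (g u - G))" for m
    using g h by (intro continuous_intros)
  have lower: "L \<le> F m" for m
    using continuous_attains_SUP(2)[OF C cF[of m], of u] u by (simp add: F_def L_def)
  obtain H where H: "\<And>u. u \<in> C \<Longrightarrow> h u \<le> H" using continuous_attains_SUP(2)[OF C h] by blast
  have "F \<longlonglongrightarrow> L"
  proof (rule LIMSEQ_I)
    fix e :: real assume e: "e > 0"
    \<comment> \<open>On the compact set where h exceeds its constrained supremum by e / 2, g stays
      below its maximum by some d > 0. Once m d exceeds H - L, the penalty outweighs any gain in
      h.\<close>
    define C' where "C' = {u \<in> C. L + e / 2 \<le> h u}"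
    have "closed {u. L + e / 2 \<le> h u}" using h by (intro closed_Collect_le continuous_intros)
    then have "compact (C \<inter> {u. L + e / 2 \<le> h u})" using C by (intro compact_Int_closed)
    then have C': "compact C'" by (simp add: C'_def Int_def)
    have "\<exists>d>0. \<forall>u\<in>C'. g u \<le> G - d"
    proof (cases "C' = {}")
      case True then show ?thesis by (intro exI[of _ 1]) auto
    next
      case False
      then obtain w where w: "w \<in> C'" "\<And>v. v \<in> C' \<Longrightarrow> g v \<le> g w"
        using continuous_attains_sup[OF C' False, of g] continuous_on_subset[OF g] by auto
      have "g w \<noteq> G"
      proof
        assume "g w = G"
        then have "h w \<le> L" unfolding L_def using w by (intro continuous_attains_SUP(2)[OF S Sne h]) (auto simp: C'_def)
        then show False using w e by (auto simp: C'_def)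
      qed
      then have "g w < G" using gG[of w] w by (auto simp: C'_def)
      then show ?thesis using w by (intro exI[of _ "G - g w"]) auto
    qed
    then obtain d where d: "d > 0" "\<And>u. u \<in> C' \<Longrightarrow> g u \<le> G - d" by blast
    obtain N :: nat where N: "H - L \<le> real N * d" using d(1) by (metis ex_less_of_nat_mult less_imp_le)
    have "F m \<le> L + e / 2" if m: "m \<ge> N" for m
      unfolding F_def
    proof (rule cSUP_least)
      fix u assume u: "u \<in> C"
      show "h u + real m * (g u - G) \<le> L + e / 2"
      proof (cases "u \<in> C'")
        case True
        have "real m * (g u - G) \<le> real m * (- d)" using d(2)[OF True] by (intro mult_left_mono) auto
        also have "\<dots> \<le> - (real N * d)" using m d by (simp add: mult_right_mono)
        finally show ?thesis using H[OF u] N e by simp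
      next
        case False
        have "real m * (g u - G) \<le> 0" using gG[OF u] by (simp add: mult_nonneg_nonpos)
        then show ?thesis using False u by (simp add: C'_def)
      qed
    qed (use C in auto)
    then show "\<exists>no. \<forall>n\<ge>no. norm (F n - L) < e"
      using lower e by (intro exI[of _ N]) (smt (verit) field_sum_of_halves real_norm_def)
  qed
  then show "(\<lambda>m. SUP u\<in>C. h u + real m * (g u - G)) \<longlonglongrightarrow> (SUP u\<in>?S. h u)"
    by (simp add: F_def[abs_def] L_def)
qed

text \<open>The penalized function is again Caratheodory because the random maximum G is measurable;
  its suprema are therefore measurable, and so is their pointwise limit.\<close>

lemma measurable_correspondence_argmax:
  assumes \<Phi>: "measurable_correspondence M \<Phi>" and g: "caratheodory M g"
  shows "measurable_correspondence M (\<lambda>\<omega>. {u \<in> \<Phi> \<omega>. g \<omega> u = (SUP v\<in>\<Phi> \<omega>. g \<omega> v)})"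
proof -
  define G where "G \<omega> = (SUP v\<in>\<Phi> \<omega>. g \<omega> v)" for \<omega>
  have [measurable]: "G \<in> borel_measurable M"
    using \<Phi> g by (auto simp: measurable_correspondence_def G_def[abs_def])
  have \<Phi>': "compact (\<Phi> \<omega>)" "\<Phi> \<omega> \<noteq> {}" "continuous_on UNIV (g \<omega>)" if "\<omega> \<in> space M" for \<omega>
    using \<Phi> g that by (auto simp: measurable_correspondence_def caratheodory_def)
  have "(\<lambda>\<omega>. SUP u\<in>{u \<in> \<Phi> \<omega>. g \<omega> u = G \<omega>}. h \<omega> u) \<in> borel_measurable M" if h: "caratheodory M h" for h
  proof (rule borel_measurable_LIMSEQ_real)
    fix m :: nat
    have [measurable]: "(\<lambda>\<omega>. h \<omega> u) \<in> borel_measurable M" "(\<lambda>\<omega>. g \<omega> u) \<in> borel_measurable M" for u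
      using g h by (auto simp: caratheodory_def)
    have "caratheodory M (\<lambda>\<omega> u. h \<omega> u + real m * (g \<omega> u - G \<omega>))"
      using g h unfolding caratheodory_def by (auto intro!: continuous_intros)
    then show "(\<lambda>\<omega>. SUP u\<in>\<Phi> \<omega>. h \<omega> u + real m * (g \<omega> u - G \<omega>)) \<in> borel_measurable M"
      using \<Phi> by (simp add: measurable_correspondence_def)
  next
    fix \<omega> assume "\<omega> \<in> space M"
    then show "(\<lambda>m. SUP u\<in>\<Phi> \<omega>. h \<omega> u + real m * (g \<omega> u - G \<omega>)) \<longlonglongrightarrow> (SUP u\<in>{u \<in> \<Phi> \<omega>. g \<omega> u = G \<omega>}. h \<omega> u)"
      using h unfolding G_def caratheodory_def by (intro penalized_SUP_tendsto(3) \<Phi>') auto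
  qed
  moreover have "compact {u \<in> \<Phi> \<omega>. g \<omega> u = G \<omega>} \<and> {u \<in> \<Phi> \<omega>. g \<omega> u = G \<omega>} \<noteq> {}" if "\<omega> \<in> space M" for \<omega>
    unfolding G_def using penalized_SUP_tendsto(1,2)[OF \<Phi>'[OF that] \<Phi>'(3)[OF that]] by blast
  ultimately show ?thesis unfolding measurable_correspondence_def G_def by blast
qed

text \<open>Maximizing the coordinates in turn shrinks each set to a single point. The coordinates
  of this point are suprema of linear functions and hence measurable.\<close>

lemma measurable_correspondence_selection:
  fixes \<Phi> :: "'a \<Rightarrow> 'b::euclidean_space set"
  assumes \<Phi>: "measurable_correspondence M \<Phi>"
  shows "\<exists>s. s \<in> borel_measurable M \<and> (\<forall>\<omega>\<in>space M. s \<omega> \<in> \<Phi> \<omega>)"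
proof -
  have c: "caratheodory M (\<lambda>\<omega> u. u \<bullet> b)" for b :: 'b
    by (auto simp: caratheodory_def intro!: continuous_intros)
  have "\<exists>\<Psi>. measurable_correspondence M \<Psi> \<and> (\<forall>\<omega>\<in>space M. \<Psi> \<omega> \<subseteq> \<Phi> \<omega> \<and>
      (\<forall>u\<in>\<Psi> \<omega>. \<forall>v\<in>\<Psi> \<omega>. \<forall>b\<in>B. u \<bullet> b = v \<bullet> b))" if "finite B" for B :: "'b set"
    using that
  proof (induction B rule: finite_induct)
    case empty then show ?case using \<Phi> by auto
  next
    case (insert b B)
    then obtain \<Psi> where \<Psi>: "measurable_correspondence M \<Psi>"
      "\<And>\<omega>. \<omega> \<in> space M \<Longrightarrow> \<Psi> \<omega> \<subseteq> \<Phi> \<omega>"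
      "\<And>\<omega> u v b. \<omega> \<in> space M \<Longrightarrow> u \<in> \<Psi> \<omega> \<Longrightarrow> v \<in> \<Psi> \<omega> \<Longrightarrow> b \<in> B \<Longrightarrow> u \<bullet> b = v \<bullet> b" by metis
    show ?case
    proof (intro exI conjI ballI)
      show "measurable_correspondence M (\<lambda>\<omega>. {u \<in> \<Psi> \<omega>. u \<bullet> b = (SUP v\<in>\<Psi> \<omega>. v \<bullet> b)})"
        using measurable_correspondence_argmax[OF \<Psi>(1) c] .
      fix \<omega> assume \<omega>: "\<omega> \<in> space M"
      show "{u \<in> \<Psi> \<omega>. u \<bullet> b = (SUP v\<in>\<Psi> \<omega>. v \<bullet> b)} \<subseteq> \<Phi> \<omega>" using \<Psi>(2)[OF \<omega>] by blast
      fix u v c assume "u \<in> {u \<in> \<Psi> \<omega>. u \<bullet> b = (SUP v\<in>\<Psi> \<omega>. v \<bullet> b)}" "v \<in> {u \<in> \<Psi> \<omega>. u \<bullet> b = (SUP v\<in>\<Psi> \<omega>. v \<bullet> b)}" "c \<in> insert b B"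
      then show "u \<bullet> c = v \<bullet> c" using \<Psi>(3)[OF \<omega>, of u v c] by (cases "c = b") simp_all
    qed
  qed
  from this[OF finite_Basis] obtain \<Psi> where \<Psi>: "measurable_correspondence M \<Psi>"
      "\<And>\<omega>. \<omega> \<in> space M \<Longrightarrow> \<Psi> \<omega> \<subseteq> \<Phi> \<omega>"
      "\<And>\<omega> u v b. \<omega> \<in> space M \<Longrightarrow> u \<in> \<Psi> \<omega> \<Longrightarrow> v \<in> \<Psi> \<omega> \<Longrightarrow> b \<in> Basis \<Longrightarrow> u \<bullet> b = v \<bullet> b" by metis
  define s where "s \<omega> = (\<Sum>b\<in>Basis. (SUP v\<in>\<Psi> \<omega>. v \<bullet> b) *\<^sub>R b)" for \<omega>
  have [measurable]: "(\<lambda>\<omega>. SUP v\<in>\<Psi> \<omega>. v \<bullet> b) \<in> borel_measurable M" for b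
    using \<Psi>(1) c[of b] by (simp add: measurable_correspondence_def)
  have "s \<in> borel_measurable M" unfolding s_def by measurable
  moreover have "s \<omega> \<in> \<Phi> \<omega>" if \<omega>: "\<omega> \<in> space M" for \<omega>
  proof -
    obtain u where u: "u \<in> \<Psi> \<omega>" using \<Psi>(1) \<omega> by (auto simp: measurable_correspondence_def)
    have "(SUP v\<in>\<Psi> \<omega>. v \<bullet> b) = u \<bullet> b" if "b \<in> Basis" for b
    proof -
      have "(SUP v\<in>\<Psi> \<omega>. v \<bullet> b) = (SUP v\<in>\<Psi> \<omega>. u \<bullet> b)"
        using \<Psi>(3)[OF \<omega> _ u that] by (intro SUP_cong) auto
      then show ?thesis using u by (metis cSUP_const empty_iff)
    qed
    then have "s \<omega> = u" by (simp add: s_def euclidean_representation)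
    then show ?thesis using u \<Psi>(2)[OF \<omega>] by auto
  qed
  ultimately show ?thesis by blast
qed

text \<open>Competitors are whole matrices in K that agree in the earlier rows, not unit vectors. In
  this way K can impose a choice of signs or a neighbourhood of the identity on all rows at
  once.\<close>

definition greedy :: "(real^'p::{finite,linorder}^'p::{finite,linorder}) set \<Rightarrow>
    (real^'p::{finite,linorder} \<Rightarrow> real) \<Rightarrow> real^'p::{finite,linorder}^'p::{finite,linorder} \<Rightarrow> bool" where
  "greedy K f U \<longleftrightarrow> U \<in> K \<and> (\<forall>k. \<forall>V\<in>K. (\<forall>j<k. V $ j = U $ j) \<longrightarrow> f (V $ k) \<le> f (U $ k))"

text \<open>Rows are maximized in increasing order. The invariant that membership in \<Psi> depends
  only on the rows in A, among matrices of K, turns the maximum over \<Psi> into a maximum over all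
  competitors with the same earlier rows.\<close>

lemma measurable_greedy:
  fixes K :: "(real^'p::{finite,linorder}^'p::{finite,linorder}) set"
  assumes K: "compact K" "K \<noteq> {}" and f: "caratheodory M f"
  shows "\<exists>U. U \<in> borel_measurable M \<and> (\<forall>\<omega>\<in>space M. greedy K (f \<omega>) (U \<omega>))"
proof -
  have "\<exists>\<Psi>. measurable_correspondence M \<Psi> \<and> (\<forall>\<omega>\<in>space M. \<Psi> \<omega> \<subseteq> K \<and>
      (\<forall>U\<in>\<Psi> \<omega>. \<forall>V\<in>K. (\<forall>j\<in>A. V $ j = U $ j) \<longrightarrow> V \<in> \<Psi> \<omega>) \<and>
      (\<forall>k\<in>A. \<forall>U\<in>\<Psi> \<omega>. \<forall>V\<in>K. (\<forall>j\<in>A. j < k \<longrightarrow> V $ j = U $ j) \<longrightarrow> f \<omega> (V $ k) \<le> f \<omega> (U $ k)))" for A :: "'p set"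
    using finite[of A]
  proof (induction A rule: finite_linorder_max_induct)
    case empty then show ?case using measurable_correspondence_const[OF K]
      by (intro exI[of _ "\<lambda>_. K"]) auto
  next
    case (insert b A)
    then obtain \<Psi> where \<Psi>0: "measurable_correspondence M \<Psi>"
      "\<forall>\<omega>\<in>space M. \<Psi> \<omega> \<subseteq> K \<and>
      (\<forall>U\<in>\<Psi> \<omega>. \<forall>V\<in>K. (\<forall>j\<in>A. V $ j = U $ j) \<longrightarrow> V \<in> \<Psi> \<omega>) \<and>
      (\<forall>k\<in>A. \<forall>U\<in>\<Psi> \<omega>. \<forall>V\<in>K. (\<forall>j\<in>A. j < k \<longrightarrow> V $ j = U $ j) \<longrightarrow> f \<omega> (V $ k) \<le> f \<omega> (U $ k))"
      by blast
    note \<Psi>1 = \<Psi>0(1) and \<Psi>2 = \<Psi>0(2)[THEN bspec, THEN conjunct1]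
      and \<Psi>3 = \<Psi>0(2)[THEN bspec, THEN conjunct2, THEN conjunct1, THEN bspec, THEN bspec, THEN mp]
      and \<Psi>4 = \<Psi>0(2)[THEN bspec, THEN conjunct2, THEN conjunct2, THEN bspec, THEN bspec, THEN bspec, THEN mp]
    have c: "caratheodory M (\<lambda>\<omega> U. f \<omega> (U $ b))"
      unfolding caratheodory_def
    proof (intro conjI ballI allI)
      fix \<omega> assume "\<omega> \<in> space M"
      then have 1: "continuous_on UNIV (f \<omega>)" using f by (simp add: caratheodory_def)
      have 2: "continuous_on UNIV (\<lambda>U :: real^'p::{finite,linorder}^'p::{finite,linorder}. U $ b)"
        by (intro linear_continuous_on bounded_linear_vec_nth)
      show "continuous_on UNIV (\<lambda>U. f \<omega> (U $ b))"
        using continuous_on_compose2[OF 1 2 subset_UNIV] .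
    next
      show "(\<lambda>\<omega>. f \<omega> (U $ b)) \<in> borel_measurable M" for U using f by (simp add: caratheodory_def)
    qed
    define \<Psi>' where "\<Psi>' \<omega> = {U \<in> \<Psi> \<omega>. f \<omega> (U $ b) = (SUP V\<in>\<Psi> \<omega>. f \<omega> (V $ b))}" for \<omega>
    have mx: "f \<omega> (V $ b) \<le> f \<omega> (U $ b)" if "\<omega> \<in> space M" "U \<in> \<Psi>' \<omega>" "V \<in> \<Psi> \<omega>" for \<omega> U V
    proof -
      have "f \<omega> (V $ b) \<le> (SUP V\<in>\<Psi> \<omega>. f \<omega> (V $ b))"
        by (rule continuous_attains_SUP(2)) (use that \<Psi>1 c in \<open>auto simp: measurable_correspondence_def caratheodory_def\<close>)
      then show ?thesis using that by (simp add: \<Psi>'_def)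
    qed
    show ?case
    proof (intro exI[of _ \<Psi>'] conjI ballI impI)
      show "measurable_correspondence M \<Psi>'"
        unfolding \<Psi>'_def by (rule measurable_correspondence_argmax[OF \<Psi>1 c])
      fix \<omega> assume \<omega>: "\<omega> \<in> space M"
      show "\<Psi>' \<omega> \<subseteq> K" using \<Psi>2[OF \<omega>] by (auto simp: \<Psi>'_def)
      fix U V assume U: "U \<in> \<Psi>' \<omega>" and V: "V \<in> K"
      show "V \<in> \<Psi>' \<omega>" if "\<forall>j\<in>insert b A. V $ j = U $ j"
        using \<Psi>3[OF \<omega> _ V, of U] U that by (auto simp: \<Psi>'_def)
      fix k assume k: "k \<in> insert b A" and eq: "\<forall>j\<in>insert b A. j < k \<longrightarrow> V $ j = U $ j"
      show "f \<omega> (V $ k) \<le> f \<omega> (U $ k)"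
      proof (cases "k = b")
        case True
        have "V \<in> \<Psi> \<omega>" using \<Psi>3[OF \<omega> _ V, of U] U eq insert.hyps(2) True by (auto simp: \<Psi>'_def)
        then show ?thesis using mx[OF \<omega> U] True by simp
      next
        case False
        then show ?thesis using \<Psi>4[OF \<omega> _ _ V, of k U] k eq U by (auto simp: \<Psi>'_def)
      qed
    qed
  qed
  from this[of UNIV] obtain \<Psi> where \<Psi>: "measurable_correspondence M \<Psi>"
    "\<forall>\<omega>\<in>space M. \<Psi> \<omega> \<subseteq> K \<and>
      (\<forall>k. \<forall>U\<in>\<Psi> \<omega>. \<forall>V\<in>K. (\<forall>j. j < k \<longrightarrow> V $ j = U $ j) \<longrightarrow> f \<omega> (V $ k) \<le> f \<omega> (U $ k))"
    by auto
  obtain U where "U \<in> borel_measurable M" "\<forall>\<omega>\<in>space M. U \<omega> \<in> \<Psi> \<omega>"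
    using measurable_correspondence_selection[OF \<Psi>(1)] by blast
  then show ?thesis using \<Psi>(2) unfolding greedy_def by (intro exI[of _ U]) blast
qed

section \<open>The multivariate central limit theorem\<close>

text \<open>The span of the characters. Integrals of its members converge as soon as characteristic
  functions do, and it is an algebra, so it contains the polynomials in sines of linear
  forms.\<close>

inductive trigonometric :: "('b::euclidean_space \<Rightarrow> complex) \<Rightarrow> bool" where
  exp: "trigonometric (\<lambda>x. c * iexp (t \<bullet> x))"
| add: "trigonometric F \<Longrightarrow> trigonometric G \<Longrightarrow> trigonometric (\<lambda>x. F x + G x)"

lemma trigonometric_const: "trigonometric (\<lambda>x. c)"
  using trigonometric.exp[of c 0] by simp

lemma trigonometric_mult:
  assumes "trigonometric F" "trigonometric G"
  shows "trigonometric (\<lambda>x. F x * G x)"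
  using assms
proof (induction F)
  case (exp c t)
  show ?case using exp(1)
  proof (induction G)
    case (exp d s)
    have "c * iexp (t \<bullet> x) * (d * iexp (s \<bullet> x)) = (c * d) * iexp ((t + s) \<bullet> x)" for x
      by (simp add: inner_add_left distrib_left flip: exp_add)
    then show ?case by (simp only: trigonometric.exp)
  next
    case (add F G)
    then show ?case using trigonometric.add[OF add.IH] by (simp add: distrib_left)
  qed
next
  case (add F G')
  then show ?case using trigonometric.add[OF add.IH] by (simp add: distrib_right)
qed

lemma trigonometric_sum:
  assumes "finite I" "\<And>i. i \<in> I \<Longrightarrow> trigonometric (F i)"
  shows "trigonometric (\<lambda>x. \<Sum>i\<in>I. F i x)"
  using assms by (induction I rule: finite_induct) (auto intro: trigonometric_const trigonometric.add)

lemma trigonometric_sin: "trigonometric (\<lambda>x. complex_of_real (sin (t \<bullet> x)))"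
proof -
  have "complex_of_real (sin y) = (- \<i> / 2) * iexp y + (\<i> / 2) * iexp (- y)" for y
    unfolding sin_of_real[symmetric] sin_exp_eq by (simp add: field_simps)
  then have "complex_of_real (sin (t \<bullet> x)) = (- \<i> / 2) * iexp (t \<bullet> x) + (\<i> / 2) * iexp ((- t) \<bullet> x)" for x
    by simp
  then show ?thesis
    using trigonometric.add[OF trigonometric.exp[of "- \<i> / 2" t] trigonometric.exp[of "\<i> / 2" "- t"]] by presburger
qed

lemma trigonometric_polynomial_sin:
  fixes q :: "'b::euclidean_space \<Rightarrow> real"
  assumes "real_polynomial_function q"
  shows "trigonometric (\<lambda>x. complex_of_real (q (\<Sum>b\<in>Basis. sin (x \<bullet> b / R) *\<^sub>R b)))"
  using assms
proof (induction q)
  case (linear f)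
  have "f (\<Sum>b\<in>Basis. sin (x \<bullet> b / R) *\<^sub>R b) = (\<Sum>b\<in>Basis. f b * sin ((b /\<^sub>R R) \<bullet> x))" for x
    using linear by (simp add: linear_sum[OF bounded_linear.linear] linear_cmul[OF bounded_linear.linear]
      inner_commute divide_inverse mult.commute)
  then show ?case
    by (simp add: trigonometric_sum trigonometric_mult trigonometric_const trigonometric_sin del: inner_scaleR_left)
next
  case (const c) show ?case by (rule trigonometric_const)
next
  case (add f g) then show ?case by (simp add: trigonometric.add)
next
  case (mult f g) then show ?case by (simp add: trigonometric_mult)
qed

lemma trigonometric_bounded_measurable:
  assumes "trigonometric F"
  shows "F \<in> borel_measurable borel" "\<exists>B. \<forall>x. norm (F x) \<le> B"
  using assms
proof (induction F)
  case (exp c t)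
  { case 1 show ?case by (intro borel_measurable_continuous_onI continuous_intros) }
  { case 2 show ?case by (auto simp: norm_mult intro: exI[of _ "norm c"]) }
next
  case (add F G)
  { case 1 show ?case using add by simp }
  { case 2
    obtain A B where "\<And>x. norm (F x) \<le> A" "\<And>x. norm (G x) \<le> B" using add by metis
    then show ?case by (intro exI[of _ "A + B"]) (meson add_mono norm_triangle_le) }
qed

lemma (in prob_space) trigonometric_integrable:
  assumes "trigonometric F" "Y \<in> borel_measurable M"
  shows "integrable M (\<lambda>\<omega>. F (Y \<omega>))"
proof -
  obtain B where "\<And>x. norm (F x) \<le> B" using trigonometric_bounded_measurable(2)[OF assms(1)] by blast
  then show ?thesis using trigonometric_bounded_measurable(1)[OF assms(1)] assms(2)
    by (intro integrable_const_bound[where B = B]) (auto intro: measurable_compose)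
qed

lemma trigonometric_integral_tendsto:
  assumes M: "prob_space M" and N: "prob_space N" "sets N = sets borel"
    and X: "\<And>n. X n \<in> borel_measurable M"
    and char: "\<And>t. (\<lambda>n. \<integral>\<omega>. iexp (t \<bullet> X n \<omega>) \<partial>M) \<longlonglongrightarrow> (\<integral>x. iexp (t \<bullet> x) \<partial>N)"
    and F: "trigonometric F"
  shows "(\<lambda>n. \<integral>\<omega>. F (X n \<omega>) \<partial>M) \<longlonglongrightarrow> (\<integral>x. F x \<partial>N)"
  using F
proof (induction F)
  case (exp c t)
  then show ?case using tendsto_mult_left[OF char[of t], of c] by simp
next
  case (add F G)
  have "(\<lambda>x. x) \<in> borel_measurable N" using N by (simp cong: measurable_cong_sets)
  note i = prob_space.trigonometric_integrable[OF N(1) _ this] prob_space.trigonometric_integrable[OF M _ X]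
  show ?case using tendsto_add[OF add.IH] add.hyps by (simp add: i)
qed

text \<open>Approximating \<open>f\<close> by a polynomial in \<open>sin (x \<bullet> b / R)\<close> keeps the approximation bounded outside the
  ball of radius \<open>R\<close>, where it may be bad.\<close>

lemma continuous_approx_polynomial_sin:
  fixes f :: "'b::euclidean_space \<Rightarrow> real"
  assumes f: "continuous_on UNIV f" and B: "\<And>x. \<bar>f x\<bar> \<le> B" and e: "0 < e" and R: "0 < R"
  obtains q where "real_polynomial_function q"
    "\<And>x. \<bar>q (\<Sum>b\<in>Basis. sin (x \<bullet> b / R) *\<^sub>R b)\<bar> \<le> B + e"
    "\<And>x. norm x \<le> R \<Longrightarrow> \<bar>f x - q (\<Sum>b\<in>Basis. sin (x \<bullet> b / R) *\<^sub>R b)\<bar> \<le> e"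
proof -
  \<comment> \<open>f written in the coordinates sin (x_b / R). The arcsine inverts the sine on
    [-pi/2, pi/2], which contains every x_b / R with norm x \<le> R.\<close>
  define h where "h s = f (\<Sum>b\<in>Basis. (R * arcsin (s \<bullet> b)) *\<^sub>R b)" for s
  define S where "S = cbox (- One) (One :: 'b)"
  have "continuous_on S h"
    unfolding h_def
    by (rule continuous_on_compose2[OF f])
      (auto simp: S_def mem_box inner_sum_left inner_Basis if_distrib cong: if_cong intro!: continuous_intros)
  moreover have "compact S" by (simp add: S_def compact_cbox)
  ultimately obtain q where q: "real_polynomial_function q" "\<And>s. s \<in> S \<Longrightarrow> \<bar>h s - q s\<bar> < e"
    using Stone_Weierstrass_real_polynomial_function e by blast
  define \<Phi> where "\<Phi> x = (\<Sum>b\<in>Basis. sin (x \<bullet> b / R) *\<^sub>R b)" for x :: 'b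
  have \<Phi>b: "\<Phi> x \<bullet> b = sin (x \<bullet> b / R)" if "b \<in> Basis" for x b
    using that by (simp add: \<Phi>_def inner_sum_left inner_Basis if_distrib cong: if_cong)
  have \<Phi>S: "\<Phi> x \<in> S" for x by (simp add: S_def mem_box \<Phi>b)
  show ?thesis
  proof (rule that[OF q(1)], fold \<Phi>_def)
    fix x
    have "\<bar>h (\<Phi> x)\<bar> \<le> B" by (simp add: h_def B)
    then show "\<bar>q (\<Phi> x)\<bar> \<le> B + e" using q(2)[OF \<Phi>S, of x] by linarith
    assume x: "norm x \<le> R"
    have "R * arcsin (\<Phi> x \<bullet> b) = x \<bullet> b" if b: "b \<in> Basis" for b
    proof -
      have "\<bar>x \<bullet> b / R\<bar> \<le> 1" using Basis_le_norm[OF b, of x] x R by simp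
      then have "- (pi / 2) \<le> x \<bullet> b / R" "x \<bullet> b / R \<le> pi / 2" using pi_ge_two by (auto simp only: abs_le_iff)
      then show ?thesis using R b by (simp add: \<Phi>b arcsin_sin)
    qed
    then have "h (\<Phi> x) = f x" by (simp add: h_def euclidean_representation)
    then show "\<bar>f x - q (\<Phi> x)\<bar> \<le> e" using q(2)[OF \<Phi>S, of x] by simp
  qed
qed

lemma (in prob_space) expectation_diff_tail_bound:
  fixes Y :: "'a \<Rightarrow> 'b::euclidean_space"
  assumes [measurable]: "Y \<in> borel_measurable M" "f \<in> borel_measurable borel" "g \<in> borel_measurable borel"
    and f: "\<And>x. \<bar>f x\<bar> \<le> B" and g: "\<And>x. \<bar>g x\<bar> \<le> B + e" and e: "0 < e"
    and fg: "\<And>x. norm x \<le> R \<Longrightarrow> \<bar>f x - g x\<bar> \<le> e"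
  shows "\<bar>expectation (\<lambda>\<omega>. f (Y \<omega>)) - expectation (\<lambda>\<omega>. g (Y \<omega>))\<bar> \<le> e + (2 * B + e) * prob {\<omega> \<in> space M. R < norm (Y \<omega>)}"
proof -
  let ?A = "{\<omega> \<in> space M. R < norm (Y \<omega>)}"
  have fB: "\<bar>f x\<bar> \<le> B + e" for x using f[of x] e by simp
  have i: "integrable M (\<lambda>\<omega>. f (Y \<omega>))" "integrable M (\<lambda>\<omega>. g (Y \<omega>))"
    using g fB by (auto intro!: integrable_const_bound[where B = "B + e"])
  have "\<bar>expectation (\<lambda>\<omega>. f (Y \<omega>)) - expectation (\<lambda>\<omega>. g (Y \<omega>))\<bar> = \<bar>expectation (\<lambda>\<omega>. f (Y \<omega>) - g (Y \<omega>))\<bar>"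
    using i by simp
  also have "\<dots> \<le> expectation (\<lambda>\<omega>. \<bar>f (Y \<omega>) - g (Y \<omega>)\<bar>)" by (rule integral_abs_bound)
  also have "\<dots> \<le> expectation (\<lambda>\<omega>. e + (2 * B + e) * indicator ?A \<omega>)"
  proof (rule integral_mono)
    fix \<omega> assume "\<omega> \<in> space M"
    then show "\<bar>f (Y \<omega>) - g (Y \<omega>)\<bar> \<le> e + (2 * B + e) * indicator ?A \<omega>"
      using fg[of "Y \<omega>"] f[of "Y \<omega>"] g[of "Y \<omega>"] e by (auto simp: indicator_def)
  next
    have "?A \<in> events" by measurable
    then show "integrable M (\<lambda>\<omega>. e + (2 * B + e) * indicator ?A \<omega>)"
      by (intro Bochner_Integration.integrable_add integrable_const integrable_mult_right integrable_real_indicator)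
         (auto simp: less_top[symmetric])
  qed (use i in auto)
  also have "\<dots> = e + (2 * B + e) * prob ?A"
  proof -
    have "?A \<in> events" by measurable
    then have "integrable M (\<lambda>\<omega>. (2 * B + e) * indicator ?A \<omega>)"
      by (intro integrable_mult_right integrable_real_indicator) (auto simp: less_top[symmetric])
    then show ?thesis using \<open>?A \<in> events\<close> by (subst Bochner_Integration.integral_add) (auto simp: prob_space)
  qed
  finally show ?thesis .
qed

lemma (in prob_space) norm_tail_small:
  fixes Y :: "'a \<Rightarrow> 'b::euclidean_space"
  assumes [measurable]: "Y \<in> borel_measurable M" and "e > 0"
  shows "\<exists>R>0. \<forall>r\<ge>R. prob {\<omega> \<in> space M. r < norm (Y \<omega>)} < e"
proof -
  have "(\<lambda>m. prob {\<omega> \<in> space M. real m < norm (Y \<omega>)}) \<longlonglongrightarrow> prob (\<Inter>m. {\<omega> \<in> space M. real m < norm (Y \<omega>)})"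
    by (intro finite_Lim_measure_decseq) (auto simp: decseq_def intro: order.strict_trans1)
  moreover have "(\<Inter>m. {\<omega> \<in> space M. real m < norm (Y \<omega>)}) = {}"
  proof -
    have "\<exists>m. \<not> real m < norm (Y \<omega>)" for \<omega>
      using reals_Archimedean2[of "norm (Y \<omega>)"] by (auto simp: not_less intro: less_imp_le)
    then show ?thesis by blast
  qed
  ultimately obtain m where m: "prob {\<omega> \<in> space M. real m < norm (Y \<omega>)} < e"
    using LIMSEQ_D[of _ _ e] \<open>e > 0\<close> by (metis (no_types, lifting) diff_zero measure_empty measure_nonneg order_refl real_norm_def abs_of_nonneg)
  have "prob {\<omega> \<in> space M. r < norm (Y \<omega>)} < e" if "r \<ge> real m + 1" for r
  proof -
    have "prob {\<omega> \<in> space M. r < norm (Y \<omega>)} \<le> prob {\<omega> \<in> space M. real m < norm (Y \<omega>)}"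
      using that by (intro finite_measure_mono) auto
    then show ?thesis using m by simp
  qed
  then show ?thesis by (intro exI[of _ "real m + 1"]) auto
qed

text \<open>The multivariate continuity theorem with tightness as a hypothesis; in the application
  it follows from bounds in mean. On a large ball f is approximated by a trigonometric sum that
  remains bounded outside.\<close>

theorem conv_in_distribution_char:
  fixes X :: "nat \<Rightarrow> 'a \<Rightarrow> 'b::euclidean_space"
  assumes M: "prob_space M" and N: "prob_space N" "sets N = sets borel"
    and X: "\<And>n. X n \<in> borel_measurable M"
    and char: "\<And>t. (\<lambda>n. \<integral>\<omega>. iexp (t \<bullet> X n \<omega>) \<partial>M) \<longlonglongrightarrow> (\<integral>x. iexp (t \<bullet> x) \<partial>N)"
    and tight: "\<And>e. e > 0 \<Longrightarrow> \<exists>R. \<forall>\<^sub>F n in sequentially. measure M {\<omega> \<in> space M. R < norm (X n \<omega>)} \<le> e"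
  shows "conv_in_distribution M X N"
  unfolding conv_in_distribution_def
proof (intro allI impI)
  interpret M: prob_space M by fact
  interpret N: prob_space N by fact
  have idN: "(\<lambda>x. x) \<in> borel_measurable N" using N by (simp cong: measurable_cong_sets)
  fix f :: "'b \<Rightarrow> real"
  assume f: "continuous_on UNIV f" and "bounded (range f)"
  then obtain B where B: "\<And>x. \<bar>f x\<bar> \<le> B" by (auto simp: bounded_iff)
  then have B0: "B \<ge> 0" by (meson abs_ge_zero order_trans)
  show "(\<lambda>n. \<integral>\<omega>. f (X n \<omega>) \<partial>M) \<longlonglongrightarrow> (\<integral>x. f x \<partial>N)"
  proof (rule LIMSEQ_I)
    fix d :: real assume d: "d > 0"
    \<comment> \<open>Exchanging f for Q costs at most e + (2 B + 1) e under each of the two laws,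
      and the convergence for Q costs e. The total (5 + 4 B) e has to stay below d.\<close>
    define e where "e = min 1 (d / (7 + 4 * B))"
    have e: "0 < e" "e \<le> 1" using d B0 by (auto simp: e_def)
    have ed: "(6 + 4 * B) * e < d"
    proof -
      have "(6 + 4 * B) * e < (7 + 4 * B) * e" using e by simp
      also have "\<dots> \<le> (7 + 4 * B) * (d / (7 + 4 * B))" using B0 by (intro mult_left_mono) (auto simp: e_def)
      finally show ?thesis using B0 by simp
    qed
    obtain R1 where R1: "\<forall>\<^sub>F n in sequentially. measure M {\<omega> \<in> space M. R1 < norm (X n \<omega>)} \<le> e"
      using tight e by blast
    obtain R2 where R2: "\<And>r. r \<ge> R2 \<Longrightarrow> measure N {x \<in> space N. r < norm x} < e"
      using N.norm_tail_small[OF idN e(1)] by blast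
    define R where "R = max 1 (max R1 R2)"
    have R: "R > 0" "R \<ge> R1" "R \<ge> R2" by (auto simp: R_def)
    obtain q where q: "real_polynomial_function q"
      "\<And>x. \<bar>q (\<Sum>b\<in>Basis. sin (x \<bullet> b / R) *\<^sub>R b)\<bar> \<le> B + e"
      "\<And>x. norm x \<le> R \<Longrightarrow> \<bar>f x - q (\<Sum>b\<in>Basis. sin (x \<bullet> b / R) *\<^sub>R b)\<bar> \<le> e"
      using continuous_approx_polynomial_sin[OF f B e(1) R(1)] by blast
    define Q where "Q x = q (\<Sum>b\<in>Basis. sin (x \<bullet> b / R) *\<^sub>R b)" for x
    have tQ: "trigonometric (\<lambda>x. complex_of_real (Q x))"
      unfolding Q_def by (rule trigonometric_polynomial_sin[OF q(1)])
    have [measurable]: "f \<in> borel_measurable borel" using f by (rule borel_measurable_continuous_onI)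
    have "(\<lambda>x. Re (complex_of_real (Q x))) \<in> borel_measurable borel"
      using trigonometric_bounded_measurable(1)[OF tQ] by measurable
    then have [measurable]: "Q \<in> borel_measurable borel" by simp
    have lim: "(\<lambda>n. \<integral>\<omega>. Q (X n \<omega>) \<partial>M) \<longlonglongrightarrow> (\<integral>x. Q x \<partial>N)"
      using trigonometric_integral_tendsto[OF M N X char tQ]
      by (simp add: integral_complex_of_real tendsto_of_real_iff)
    have "\<forall>\<^sub>F n in sequentially. \<bar>(\<integral>\<omega>. Q (X n \<omega>) \<partial>M) - (\<integral>x. Q x \<partial>N)\<bar> < e"
      using tendstoD[OF lim e(1)] by (simp add: dist_real_def)
    then have "\<forall>\<^sub>F n in sequentially. \<bar>(\<integral>\<omega>. f (X n \<omega>) \<partial>M) - (\<integral>x. f x \<partial>N)\<bar> < d"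
      using R1
    proof eventually_elim
      case (elim n)
      note [measurable] = X[of n]
      have "measure M {\<omega> \<in> space M. R < norm (X n \<omega>)} \<le> e"
        using elim(2) R by (intro order_trans[OF M.finite_measure_mono elim(2)]) auto
      then have 1: "(2 * B + e) * measure M {\<omega> \<in> space M. R < norm (X n \<omega>)} \<le> (2 * B + 1) * e"
        using B0 e by (intro mult_mono) auto
      have 2: "(2 * B + e) * measure N {x \<in> space N. R < norm x} \<le> (2 * B + 1) * e"
        using B0 e R2[OF R(3)] by (intro mult_mono) auto
      have 3: "\<bar>(\<integral>\<omega>. f (X n \<omega>) \<partial>M) - (\<integral>\<omega>. Q (X n \<omega>) \<partial>M)\<bar> \<le> e + (2 * B + e) * measure M {\<omega> \<in> space M. R < norm (X n \<omega>)}"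
        using q(2,3) e B unfolding Q_def[symmetric] by (intro M.expectation_diff_tail_bound) auto
      have 4: "\<bar>(\<integral>x. f x \<partial>N) - (\<integral>x. Q x \<partial>N)\<bar> \<le> e + (2 * B + e) * measure N {x \<in> space N. R < norm x}"
        using q(2,3) e B idN unfolding Q_def[symmetric] by (intro N.expectation_diff_tail_bound) auto
      have "\<bar>(\<integral>\<omega>. f (X n \<omega>) \<partial>M) - (\<integral>x. f x \<partial>N)\<bar> < 2 * (e + (2 * B + 1) * e) + e"
        using elim(1) order_trans[OF 3 add_left_mono[OF 1]] order_trans[OF 4 add_left_mono[OF 2]] by argo
      also have "\<dots> \<le> (6 + 4 * B) * e" using e by (simp add: algebra_simps)
      finally show ?case using ed by simp
    qed
    then show "\<exists>no. \<forall>n\<ge>no. norm ((\<integral>\<omega>. f (X n \<omega>) \<partial>M) - (\<integral>x. f x \<partial>N)) < d"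
      by (simp add: eventually_sequentially)
  qed
qed


section \<open>Centred normal laws with possibly singular covariance, and the central limit theorem
  for one linear form\<close>

lemma normal_law_moments:
  assumes s: "s \<ge> 0"
  shows "(\<integral>x. x \<partial>normal_law 0 s) = 0" "(\<integral>x. x\<^sup>2 \<partial>normal_law 0 s) = s\<^sup>2"
proof -
  have "(\<integral>x. x \<partial>normal_law 0 s) = 0 \<and> (\<integral>x. x\<^sup>2 \<partial>normal_law 0 s) = s\<^sup>2"
  proof (cases "s = 0")
    case True then show ?thesis by (simp add: normal_law_def integral_return)
  next
    case False
    then have s: "s > 0" using s by simp
    interpret prob_space "density lborel (\<lambda>x. ennreal (normal_density 0 s x))"
      using s by (rule prob_space_normal_density)
    have d: "distributed (density lborel (\<lambda>x. ennreal (normal_density 0 s x))) lborel (\<lambda>x. x) (normal_density 0 s)"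
      by (auto simp: distributed_def intro!: distr_id2)
    show ?thesis
      using normal_distributed_expectation[OF s d] normal_distributed_variance[OF s d] False
      by (simp add: normal_law_def)
  qed
  then show "(\<integral>x. x \<partial>normal_law 0 s) = 0" "(\<integral>x. x\<^sup>2 \<partial>normal_law 0 s) = s\<^sup>2" by auto
qed

lemma real_distribution_normal_law: "s \<ge> 0 \<Longrightarrow> real_distribution (normal_law m s)"
  by (auto simp: normal_law_def real_distribution_def real_distribution_axioms_def
      intro!: prob_space_return prob_space_normal_density)

lemma char_normal_law:
  assumes s: "s \<ge> 0"
  shows "char (normal_law 0 s) u = complex_of_real (exp (- (s * u)\<^sup>2 / 2))"
proof (cases "s = 0")
  case True then show ?thesis by (simp add: normal_law_def char_def integral_return)
next
  case False
  then have s: "s > 0" using s by simp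
  interpret prob_space std_normal_distribution
    by (rule prob_space_normal_density) simp
  have d: "distributed std_normal_distribution lborel (\<lambda>x. x) std_normal_density"
    by (auto simp: distributed_def intro!: distr_id2)
  have "distributed std_normal_distribution lborel (\<lambda>x. 0 + s * x) (normal_density (0 + s * 0) (\<bar>s\<bar> * 1))"
    using s by (intro normal_density_affine[OF d]) auto
  then have "distr std_normal_distribution lborel (\<lambda>x. s * x) = density lborel (\<lambda>x. ennreal (normal_density 0 s x))"
    using s by (simp add: distributed_def)
  then have "normal_law 0 s = distr std_normal_distribution borel (\<lambda>x. s * x)"
    using False by (simp add: normal_law_def cong: distr_cong)
  then have "char (normal_law 0 s) u = char std_normal_distribution (s * u)"
    by (simp add: char_def integral_distr mult_ac)
  then show ?thesis by (simp add: char_std_normal_distribution)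
qed

text \<open>The law of R g, where g has independent standard normal coordinates and R is a symmetric
  root of C. Nothing is inverted, so a singular C is covered; the one-dimensional marginals are
  identified by their characteristic functions.\<close>

theorem multivariate_normal_exists:
  fixes C :: "real^'q^'q"
  assumes C: "transpose C = C" and psd: "\<And>v. v \<bullet> (C *v v) \<ge> 0"
  shows "\<exists>N. multivariate_normal N \<and>
    (\<forall>t. (\<integral>x. iexp (t \<bullet> x) \<partial>N) = complex_of_real (exp (- (t \<bullet> (C *v t)) / 2))) \<and>
    (\<forall>q. (\<integral>x. x $ q \<partial>N) = 0 \<and> (\<integral>x. (x $ q)\<^sup>2 \<partial>N) = C $ q $ q)"
proof -
  obtain R where R: "transpose R = R" "R ** R = C" using positive_semidefinite_sqrt[OF C psd] .
  define G where "G = (\<Pi>\<^sub>M i\<in>(UNIV :: 'q set). std_normal_distribution)"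
  interpret S: prob_space std_normal_distribution by (rule prob_space_normal_density) simp
  interpret P: product_prob_space "\<lambda>i::'q. std_normal_distribution" ..
  have G: "prob_space G" unfolding G_def by (rule prob_space_PiM) (rule S.prob_space_axioms)
  interpret G: prob_space G by fact
  define Y :: "('q \<Rightarrow> real) \<Rightarrow> real^'q" where "Y g = R *v (\<chi> i. g i)" for g
  have gi [measurable]: "(\<lambda>g. g i) \<in> borel_measurable G" for i
    unfolding G_def by measurable
  have Yt: "t \<bullet> Y g = (\<Sum>i\<in>UNIV. (R *v t) $ i * g i)" for t g
    unfolding Y_def using symmetric_matrix_inner[OF R(1), of t "\<chi> i. g i"] by (simp add: inner_vec_def)
  have [measurable]: "Y \<in> borel_measurable G"
  proof (subst borel_measurable_euclidean_space, rule ballI)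
    fix b :: "real^'q"
    show "(\<lambda>g. Y g \<bullet> b) \<in> borel_measurable G"
      unfolding inner_commute[of _ b] Yt by measurable
  qed
  define N where "N = distr G borel Y"
  have N: "prob_space N" unfolding N_def by (rule G.prob_space_distr) simp
  interpret N: prob_space N by fact
  have sN: "sets N = sets borel" by (simp add: N_def)
  have char: "(\<integral>x. iexp (t \<bullet> x) \<partial>N) = complex_of_real (exp (- (t \<bullet> (C *v t)) / 2))" for t
  proof -
    define a where "a = R *v t"
    have "(\<integral>x. iexp (t \<bullet> x) \<partial>N) = (\<integral>g. iexp (t \<bullet> Y g) \<partial>G)"
      unfolding N_def by (rule integral_distr) measurable
    also have "\<dots> = (\<integral>g. (\<Prod>i\<in>UNIV. iexp (a $ i * g i)) \<partial>G)"
      unfolding Yt a_def by (simp add: sum_distrib_left exp_sum)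
    also have "\<dots> = (\<Prod>i\<in>UNIV. (\<integral>y. iexp (a $ i * y) \<partial>std_normal_distribution))"
      unfolding G_def by (rule P.product_integral_prod) (auto intro!: S.integrable_iexp)
    also have "\<dots> = (\<Prod>i\<in>UNIV. complex_of_real (exp (- (a $ i)\<^sup>2 / 2)))"
      using char_std_normal_distribution by (simp add: char_def fun_eq_iff)
    also have "\<dots> = complex_of_real (exp (\<Sum>i\<in>UNIV. - (a $ i)\<^sup>2 / 2))"
      by (simp add: exp_sum)
    also have "(\<Sum>i\<in>UNIV. - (a $ i)\<^sup>2 / 2) = - (a \<bullet> a) / 2"
      by (simp add: inner_vec_def power2_eq_square sum_negf sum_divide_distrib)
    also have "a \<bullet> a = t \<bullet> (C *v t)"
      unfolding a_def symmetric_matrix_inner[OF R(1)] R(2)[symmetric] by (simp add: matrix_vector_mul_assoc)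
    finally show ?thesis .
  qed
  have law: "distr N borel (\<lambda>x. x \<bullet> t) = normal_law 0 (sqrt (t \<bullet> (C *v t)))" for t
  proof (rule Levy_uniqueness)
    have [measurable]: "(\<lambda>x. x \<bullet> t) \<in> borel_measurable N" using sN by (simp cong: measurable_cong_sets)
    show "real_distribution (distr N borel (\<lambda>x. x \<bullet> t))"
      by (auto simp: real_distribution_def real_distribution_axioms_def intro!: N.prob_space_distr)
    show "real_distribution (normal_law 0 (sqrt (t \<bullet> (C *v t))))"
      using psd by (intro real_distribution_normal_law) simp
    show "char (distr N borel (\<lambda>x. x \<bullet> t)) = char (normal_law 0 (sqrt (t \<bullet> (C *v t))))"
    proof
      fix u
      have "char (distr N borel (\<lambda>x. x \<bullet> t)) u = (\<integral>x. iexp ((u *\<^sub>R t) \<bullet> x) \<partial>N)"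
        by (simp add: char_def integral_distr inner_commute)
      also have "\<dots> = char (normal_law 0 (sqrt (t \<bullet> (C *v t)))) u"
        unfolding char using psd
        by (simp add: char_normal_law power_mult_distrib matrix_vector_mult_scaleR power2_eq_square mult_ac)
      finally show "char (distr N borel (\<lambda>x. x \<bullet> t)) u = char (normal_law 0 (sqrt (t \<bullet> (C *v t)))) u" .
    qed
  qed
  have mom: "(\<integral>x. x $ q \<partial>N) = 0 \<and> (\<integral>x. (x $ q)\<^sup>2 \<partial>N) = C $ q $ q" for q
  proof -
    have Cq: "axis q 1 \<bullet> (C *v axis q 1) = C $ q $ q"
      by (simp add: matrix_vector_mult_basis inner_axis' column_def)
    then have nn: "C $ q $ q \<ge> 0" using psd[of "axis q 1"] by simp
    have d: "distr N borel (\<lambda>x. x $ q) = normal_law 0 (sqrt (C $ q $ q))"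
      using law[of "axis q 1"] unfolding Cq by (simp add: inner_axis)
    have m: "(\<lambda>x. x $ q) \<in> borel_measurable N"
      using sN by (simp cong: measurable_cong_sets)
    have "(\<integral>x. x $ q \<partial>N) = (\<integral>y. y \<partial>distr N borel (\<lambda>x. x $ q))"
      "(\<integral>x. (x $ q)\<^sup>2 \<partial>N) = (\<integral>y. y\<^sup>2 \<partial>distr N borel (\<lambda>x. x $ q))"
      by (subst integral_distr[OF m]; simp)+
    then show ?thesis unfolding d using nn by (simp add: normal_law_moments)
  qed
  have mn: "multivariate_normal N"
    unfolding multivariate_normal_def
  proof (intro conjI allI)
    fix t :: "real^'q"
    show "\<exists>m s. 0 \<le> s \<and> distr N borel (\<lambda>x. x \<bullet> t) = normal_law m s"
      by (intro exI[of _ 0] exI[of _ "sqrt (t \<bullet> (C *v t))"]) (simp add: law psd)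
  qed (fact N, fact sN)
  show ?thesis by (rule exI[of _ N], intro conjI allI mn char mom[THEN conjunct1] mom[THEN conjunct2])
qed

text \<open>The central limit theorem divides by the standard deviation s; evaluating the
  characteristic functions at s undoes this. If the variance is zero, the sums vanish almost
  everywhere.\<close>

lemma (in iid_sample) scaled_avg_char_tendsto:
  assumes h [measurable]: "h \<in> borel_measurable borel" and h2: "integrable D (\<lambda>v. (h v)\<^sup>2)" and h0: "(\<integral>v. h v \<partial>D) = 0"
  shows "(\<lambda>n. \<integral>\<omega>. iexp (sqrt (real n) * avg h (n, \<omega>)) \<partial>M) \<longlonglongrightarrow> complex_of_real (exp (- (\<integral>v. (h v)\<^sup>2 \<partial>D) / 2))"
proof (cases "(\<integral>v. (h v)\<^sup>2 \<partial>D) = 0")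
  case True
  have "expectation (\<lambda>\<omega>. iexp (sqrt (real n) * avg h (n, \<omega>))) = 1" for n
  proof -
    have "AE \<omega> in M. (\<Sum>i<n. h (z i \<omega>))\<^sup>2 = 0"
      using second_moment_sum[OF h h2 h0, of n] True
      by (subst integral_nonneg_eq_0_iff_AE[symmetric]) auto
    then have "AE \<omega> in M. iexp (sqrt (real n) * avg h (n, \<omega>)) = 1"
      by eventually_elim (simp add: avg_def)
    then have "expectation (\<lambda>\<omega>. iexp (sqrt (real n) * avg h (n, \<omega>))) = expectation (\<lambda>\<omega>. 1)"
      by (intro integral_cong_AE) auto
    then show ?thesis by (simp add: prob_space)
  qed
  then show ?thesis using True by simp
next
  case False
  define s where "s = sqrt (\<integral>v. (h v)\<^sup>2 \<partial>D)"
  have "(\<integral>v. (h v)\<^sup>2 \<partial>D) > 0" using False by (simp add: order_less_le)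
  then have s: "s > 0" "s\<^sup>2 = (\<integral>v. (h v)\<^sup>2 \<partial>D)" by (auto simp: s_def)
  have w: "weak_conv_m (\<lambda>n. distr M borel (\<lambda>x. (\<Sum>i<n. h (z i x)) / sqrt (n * s\<^sup>2))) std_normal_distribution"
  proof (rule central_limit_theorem_zero_mean[where \<mu> = "distr D borel h"])
    show "indep_vars (\<lambda>i. borel) (\<lambda>i \<omega>. h (z i \<omega>)) UNIV" using h by (rule indep_vars_z)
    show "expectation (\<lambda>\<omega>. h (z n \<omega>)) = 0" for n using h0 by (simp add: expectation_z)
    show "integrable M (\<lambda>x. (h (z n x))\<^sup>2)" for n using h2 integrable_z[of "\<lambda>v. (h v)\<^sup>2"] by simp
    show "variance (\<lambda>\<omega>. h (z n \<omega>)) = s\<^sup>2" for n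
      using expectation_z[of "\<lambda>v. (h v)\<^sup>2"] h0 by (simp add: expectation_z s)
    show "distr M borel (\<lambda>\<omega>. h (z n \<omega>)) = distr D borel h" for n
      unfolding distr_z[of n, symmetric] by (simp add: distr_distr comp_def)
  qed (use s in auto)
  have "(\<lambda>n. char (distr M borel (\<lambda>x. (\<Sum>i<n. h (z i x)) / sqrt (n * s\<^sup>2))) s) \<longlonglongrightarrow> char std_normal_distribution s"
  proof (rule levy_continuity1[OF _ real_dist_normal_dist w])
    show "real_distribution (distr M borel (\<lambda>x. (\<Sum>i<n. h (z i x)) / sqrt (n * s\<^sup>2)))" for n :: nat
      by (auto simp: real_distribution_def real_distribution_axioms_def intro!: prob_space_distr)
  qed
  moreover have "char (distr M borel (\<lambda>x. (\<Sum>i<n. h (z i x)) / sqrt (n * s\<^sup>2))) s =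
      expectation (\<lambda>\<omega>. iexp (sqrt (real n) * avg h (n, \<omega>)))" for n :: nat
  proof -
    have "s * ((\<Sum>i<n. h (z i x)) / sqrt (n * s\<^sup>2)) = sqrt (real n) * avg h (n, x)" for x
      using s(1) by (cases "n = 0") (auto simp: avg_def real_sqrt_mult field_simps)
    then show ?thesis by (simp add: char_def integral_distr del: of_real_mult)
  qed
  ultimately show ?thesis by (simp add: char_std_normal_distribution s)
qed

section \<open>Empirical distributions and estimating equations\<close>

lemma integral_empirical:
  assumes "h \<in> borel_measurable borel"
  shows "(\<integral>v. (h v :: real) \<partial>empirical n x) = (\<Sum>i<n. h (x i)) / real n"
proof -
  have "x \<in> measurable (uniform_count_measure {..<n}) borel"
    by (simp add: uniform_count_measure_def point_measure_def cong: measurable_cong_sets)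
  then have "(\<integral>v. h v \<partial>empirical n x) = (\<integral>i. h (x i) \<partial>uniform_count_measure {..<n})"
    unfolding empirical_def using assms by (rule integral_distr)
  also have "\<dots> = (\<Sum>i<n. h (x i)) / real n"
    unfolding uniform_count_measure_def
    by (subst lebesgue_integral_point_measure_finite) (auto simp: sum_divide_distrib)
  finally show ?thesis .
qed

lemma mean_vector_empirical: "mean_vector (empirical n x) = (\<Sum>i<n. x i) /\<^sub>R real n"
  by (simp add: mean_vector_def integral_empirical vec_eq_iff divide_inverse mult.commute)

lemma covariance_matrix_empirical:
  "covariance_matrix (empirical n x) $ k $ l =
    (\<Sum>i<n. (x i $ k - mean_vector (empirical n x) $ k) * (x i $ l - mean_vector (empirical n x) $ l)) / real n"
  by (simp add: covariance_matrix_def integral_empirical)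

lemma inner_covariance_matrix_empirical:
  "u \<bullet> (covariance_matrix (empirical n x) *v w) =
    (\<Sum>i<n. (u \<bullet> (x i - mean_vector (empirical n x))) * (w \<bullet> (x i - mean_vector (empirical n x)))) / real n"
proof -
  define y where "y i = x i - mean_vector (empirical n x)" for i
  have "u \<bullet> (covariance_matrix (empirical n x) *v w) =
      (\<Sum>k\<in>UNIV. \<Sum>l\<in>UNIV. \<Sum>i<n. (u $ k * y i $ k) * (w $ l * y i $ l)) / real n"
    by (simp add: inner_vec_def matrix_vector_mult_def covariance_matrix_empirical y_def
        sum_distrib_left sum_distrib_right sum_divide_distrib mult_ac)
  also have "(\<Sum>k\<in>UNIV. \<Sum>l\<in>UNIV. \<Sum>i<n. (u $ k * y i $ k) * (w $ l * y i $ l)) =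
      (\<Sum>i<n. \<Sum>k\<in>UNIV. \<Sum>l\<in>UNIV. (u $ k * y i $ k) * (w $ l * y i $ l))"
    by (subst sum.swap, subst (2) sum.swap) (simp add: sum.swap[of _ UNIV "{..<n}"])
  also have "\<dots> = (\<Sum>i<n. (u \<bullet> y i) * (w \<bullet> y i))"
    by (simp add: inner_vec_def sum_product)
  finally show ?thesis by (simp add: y_def)
qed

lemma covariance_matrix_empirical_psd:
  "transpose (covariance_matrix (empirical n x)) = covariance_matrix (empirical n x)"
  "u \<bullet> (covariance_matrix (empirical n x) *v u) \<ge> 0"
  by (simp_all add: transpose_def vec_eq_iff covariance_matrix_empirical mult.commute
      inner_covariance_matrix_empirical sum_nonneg)

lemma positive_definite_empirical_iff:
  "positive_definite (covariance_matrix (empirical n x)) \<longleftrightarrow> invertible (covariance_matrix (empirical n x))"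
  by (simp add: positive_definite_iff covariance_matrix_empirical_psd)

text \<open>The index for data that are already centred and whitened, where the standardization
  inside \<open>std_moment\<close> is trivial on unit vectors. Being a polynomial in u, it is
  continuous on the whole space.\<close>

definition empirical_index :: "real \<Rightarrow> nat \<Rightarrow> (nat \<Rightarrow> real^'p) \<Rightarrow> real^'p \<Rightarrow> real" where
  "empirical_index \<alpha> n s u = \<alpha> * ((\<Sum>i<n. (u \<bullet> s i) ^ 3) / real n)\<^sup>2
     + (1 - \<alpha>) * ((\<Sum>i<n. (u \<bullet> s i) ^ 4) / real n - 3)\<^sup>2"

context
  fixes n :: nat and x :: "nat \<Rightarrow> real^'p"
  assumes inv: "invertible (covariance_matrix (empirical n x))"
begin

private abbreviation "S \<equiv> covariance_matrix (empirical n x)"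
private abbreviation "s \<equiv> \<lambda>i. standardize (empirical n x) (x i)"

lemma empirical_nonempty: "n > 0"
proof (rule ccontr)
  assume "\<not> 0 < n"
  then have "S = 0" by (simp add: vec_eq_iff covariance_matrix_empirical)
  moreover obtain A where "S ** A = mat 1" using inv by (auto simp: invertible_def)
  ultimately have "(mat 1 :: real^'p^'p) $ k $ k = 0" for k by (metis times0_left zero_index)
  then show False by (simp add: mat_def)
qed

lemma inner_standardize: "u \<bullet> s i = (inv_sqrt S *v u) \<bullet> (x i - mean_vector (empirical n x))"
proof -
  have "transpose (inv_sqrt S) = inv_sqrt S"
    using inv_sqrt_works(1)[OF positive_definite_empirical_iff[THEN iffD2, OF inv]]
    by (simp add: positive_definite_def)
  then show ?thesis by (simp add: standardize_def symmetric_matrix_inner)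
qed

lemma sum_standardize: "(\<Sum>i<n. u \<bullet> s i) = 0"
proof -
  have "(\<Sum>i<n. x i - mean_vector (empirical n x)) = 0"
    using empirical_nonempty by (simp add: sum_subtractf mean_vector_empirical sum_constant_scaleR del: sum_constant)
  then show ?thesis unfolding inner_standardize by (simp flip: inner_sum_right)
qed

lemma sum_standardize_product: "(\<Sum>i<n. (u \<bullet> s i) * (w \<bullet> s i)) / real n = u \<bullet> w"
proof -
  let ?R = "inv_sqrt S"
  have pd: "positive_definite S" using inv by (simp add: positive_definite_empirical_iff)
  have R: "transpose ?R = ?R" using inv_sqrt_works(1)[OF pd] by (simp add: positive_definite_def)
  have "(\<Sum>i<n. (u \<bullet> s i) * (w \<bullet> s i)) / real n = (?R *v u) \<bullet> (S *v (?R *v w))"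
    unfolding inner_standardize inner_covariance_matrix_empirical ..
  also have "\<dots> = u \<bullet> ((?R ** S ** ?R) *v w)"
    by (simp add: symmetric_matrix_inner[OF R] matrix_vector_mul_assoc matrix_mul_assoc)
  finally show ?thesis using inv_sqrt_conjugate[OF pd] by simp
qed

lemma projection_index_empirical:
  assumes u: "norm u = 1"
  shows "projection_index \<alpha> (empirical n x) u = empirical_index \<alpha> n s u"
proof -
  have [measurable]: "(\<lambda>v. u \<bullet> standardize (empirical n x) v) \<in> borel_measurable borel"
    unfolding standardize_def matrix_vector_mult_diff_distrib
    by (intro borel_measurable_continuous_onI continuous_intros)
  have E: "(\<integral>v. u \<bullet> standardize (empirical n x) v \<partial>empirical n x) = 0"
    by (subst integral_empirical) (simp_all add: sum_standardize)
  have V: "(\<integral>v. (u \<bullet> standardize (empirical n x) v)\<^sup>2 \<partial>empirical n x) = 1"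
    using sum_standardize_product[of u u] u
    by (subst integral_empirical) (simp_all add: power2_eq_square norm_eq_1)
  have "std_moment r (empirical n x) (\<lambda>v. u \<bullet> standardize (empirical n x) v) =
      (\<Sum>i<n. (u \<bullet> s i) ^ r) / real n" for r
    unfolding std_moment_def E by (simp add: V integral_empirical)
  then show ?thesis by (simp add: projection_index_def empirical_index_def)
qed

end

text \<open>The angle \<theta> parametrizes the great circle through two orthonormal directions, so
  the unit-norm constraint is built in. The equation is half the derivative at \<theta> = 0.\<close>

lemma estimating_equation:
  fixes a b :: "nat \<Rightarrow> real" and n :: nat and \<alpha> :: real
  defines "f \<equiv> \<lambda>\<theta>. \<alpha> * ((\<Sum>i<n. (cos \<theta> * a i + sin \<theta> * b i) ^ 3) / real n)\<^sup>2
     + (1 - \<alpha>) * ((\<Sum>i<n. (cos \<theta> * a i + sin \<theta> * b i) ^ 4) / real n - 3)\<^sup>2"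
  assumes "d > 0" and max: "\<And>\<theta>. \<bar>\<theta>\<bar> < d \<Longrightarrow> f \<theta> \<le> f 0"
  shows "3 * \<alpha> * ((\<Sum>i<n. a i ^ 3) / real n) * ((\<Sum>i<n. (a i)\<^sup>2 * b i) / real n)
    + 4 * (1 - \<alpha>) * ((\<Sum>i<n. a i ^ 4) / real n - 3) * ((\<Sum>i<n. a i ^ 3 * b i) / real n) = 0"
proof -
  let ?l = "\<alpha> * (2 * ((\<Sum>i<n. a i ^ 3) / real n) * ((\<Sum>i<n. 3 * (a i)\<^sup>2 * b i) / real n))
    + (1 - \<alpha>) * (2 * ((\<Sum>i<n. a i ^ 4) / real n - 3) * ((\<Sum>i<n. 4 * a i ^ 3 * b i) / real n))"
  have D: "((\<lambda>\<theta>. (\<Sum>i<n. (cos \<theta> * a i + sin \<theta> * b i) ^ m) / real n) has_real_derivative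
      (\<Sum>i<n. real m * a i ^ (m - 1) * b i) / real n) (at 0)" for m
    by (rule DERIV_cdivide) (auto intro!: derivative_eq_intros sum.cong)
  define F where "F m \<theta> = (\<Sum>i<n. (cos \<theta> * a i + sin \<theta> * b i) ^ m) / real n" for m and \<theta> :: real
  have F: "(F 3 has_real_derivative (\<Sum>i<n. 3 * (a i)\<^sup>2 * b i) / real n) (at 0)"
    "(F 4 has_real_derivative (\<Sum>i<n. 4 * a i ^ 3 * b i) / real n) (at 0)"
    "F m 0 = (\<Sum>i<n. a i ^ m) / real n" for m
    using D[of 3] D[of 4] by (simp_all add: F_def[abs_def])
  have feq: "f = (\<lambda>\<theta>. \<alpha> * (F 3 \<theta>)\<^sup>2 + (1 - \<alpha>) * (F 4 \<theta> - 3)\<^sup>2)" by (simp add: f_def F_def)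
  have r: "((\<lambda>\<theta>. \<alpha> * (G \<theta>)\<^sup>2 + (1 - \<alpha>) * (H \<theta> - 3)\<^sup>2) has_real_derivative
      \<alpha> * (2 * G 0 * g) + (1 - \<alpha>) * (2 * (H 0 - 3) * h)) (at 0)"
    if "(G has_real_derivative g) (at 0)" "(H has_real_derivative h) (at 0)" for G H g h
    using that by (auto intro!: derivative_eq_intros simp: algebra_simps)
  have "(f has_real_derivative ?l) (at 0)"
    unfolding feq F(3)[symmetric] by (rule r[OF F(1,2)])
  then have l0: "?l = 0"
    by (rule DERIV_local_max[OF _ \<open>d > 0\<close>]) (use max in auto)
  have sums: "(\<Sum>i<n. 3 * (a i)\<^sup>2 * b i) / real n = 3 * ((\<Sum>i<n. (a i)\<^sup>2 * b i) / real n)"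
    "(\<Sum>i<n. 4 * a i ^ 3 * b i) / real n = 4 * ((\<Sum>i<n. a i ^ 3 * b i) / real n)"
    by (simp_all add: sum_distrib_left mult.assoc)
  have gen: "\<alpha> * (2 * A * (3 * B)) + (1 - \<alpha>) * (2 * C * (4 * E)) = 2 * (3 * \<alpha> * A * B + 4 * (1 - \<alpha>) * C * E)"
    for A B C E :: real by (simp add: algebra_simps)
  show ?thesis using l0 unfolding sums gen by (rule mult_left_cancel[THEN iffD1, rotated, of _ _ 0, unfolded mult_zero_right]) simp
qed

lemma empirical_index_estimating_equation:
  fixes s :: "nat \<Rightarrow> real^'p"
  assumes u: "norm u = 1" and w: "norm w = 1" and uw: "u \<bullet> w = 0"
    and e: "e > 0" and max: "\<And>\<theta>. norm (cos \<theta> *\<^sub>R u + sin \<theta> *\<^sub>R w) = 1 \<Longrightarrow> dist (cos \<theta> *\<^sub>R u + sin \<theta> *\<^sub>R w) u < e \<Longrightarrow>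
      empirical_index \<alpha> n s (cos \<theta> *\<^sub>R u + sin \<theta> *\<^sub>R w) \<le> empirical_index \<alpha> n s u"
  shows "3 * \<alpha> * ((\<Sum>i<n. (u \<bullet> s i) ^ 3) / real n) * ((\<Sum>i<n. (u \<bullet> s i)\<^sup>2 * (w \<bullet> s i)) / real n)
    + 4 * (1 - \<alpha>) * ((\<Sum>i<n. (u \<bullet> s i) ^ 4) / real n - 3) * ((\<Sum>i<n. (u \<bullet> s i) ^ 3 * (w \<bullet> s i)) / real n) = 0"
proof -
  let ?c = "\<lambda>\<theta>. cos \<theta> *\<^sub>R u + sin \<theta> *\<^sub>R w"
  have n1: "norm (?c \<theta>) = 1" for \<theta>
    using u w uw by (simp add: norm_eq_1 inner_add_left inner_add_right inner_commute[of w u] flip: power2_eq_square)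
  have "isCont ?c 0" by (intro continuous_intros)
  then obtain d where d: "d > 0" "\<And>\<theta>. dist \<theta> 0 < d \<Longrightarrow> dist (?c \<theta>) (?c 0) < e"
    using e unfolding continuous_at_eps_delta by blast
  show ?thesis
  proof (rule estimating_equation[OF d(1)])
    fix \<theta> :: real assume "\<bar>\<theta>\<bar> < d"
    then have "empirical_index \<alpha> n s (?c \<theta>) \<le> empirical_index \<alpha> n s u"
      using d(2)[of \<theta>] by (intro max n1) simp
    then show "\<alpha> * ((\<Sum>i<n. (cos \<theta> * (u \<bullet> s i) + sin \<theta> * (w \<bullet> s i)) ^ 3) / real n)\<^sup>2 +
         (1 - \<alpha>) * ((\<Sum>i<n. (cos \<theta> * (u \<bullet> s i) + sin \<theta> * (w \<bullet> s i)) ^ 4) / real n - 3)\<^sup>2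
         \<le> \<alpha> * ((\<Sum>i<n. (cos 0 * (u \<bullet> s i) + sin 0 * (w \<bullet> s i)) ^ 3) / real n)\<^sup>2 +
         (1 - \<alpha>) * ((\<Sum>i<n. (cos 0 * (u \<bullet> s i) + sin 0 * (w \<bullet> s i)) ^ 4) / real n - 3)\<^sup>2"
      by (simp add: empirical_index_def inner_add_left)
  qed
qed

section \<open>Identification and consistency\<close>

lemma orthogonal_row_norm: "orthogonal_matrix (U :: real^'n^'n) \<Longrightarrow> norm (U $ k) = 1"
  by (simp add: orthogonal_matrix_iff_rows norm_eq_1)

lemma mat_1_row: "mat 1 $ k = (axis k 1 :: real^'n)"
  by (auto simp: mat_def axis_def vec_eq_iff)

text \<open>A deterministic statement: randomness will enter only through the uniform distance
  between g and f. A failing sequence of greedy matrices has a limit point U0 by compactness, and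
  its rows are identified in the order of extraction.\<close>

lemma greedy_consistent:
  fixes K :: "(real^'p::{finite,linorder}^'p::{finite,linorder}) set" and f :: "real^'p::{finite,linorder} \<Rightarrow> real"
  assumes K: "compact K" "\<And>U. U \<in> K \<Longrightarrow> orthogonal_matrix U"
    and r: "r > 0" "\<And>U. orthogonal_matrix U \<Longrightarrow> norm (U - mat 1) < r \<Longrightarrow> U \<in> K"
    and f: "continuous_on UNIV f"
    and ident: "\<And>U k. U \<in> K \<Longrightarrow> (\<And>j. j < k \<Longrightarrow> U $ j = axis j 1) \<Longrightarrow> f (axis k 1) \<le> f (U $ k) \<Longrightarrow> U $ k = axis k 1"
    and e: "e > 0"
  shows "\<exists>d>0. \<forall>g U. (\<forall>u. norm u = 1 \<longrightarrow> \<bar>g u - f u\<bar> < d) \<longrightarrow> greedy K g U \<longrightarrow> norm (U - mat 1) < e"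
proof (rule ccontr)
  assume "\<not> ?thesis"
  then have "\<forall>m. \<exists>g U. (\<forall>u. norm u = 1 \<longrightarrow> \<bar>g u - f u\<bar> < 1 / real (Suc m)) \<and> greedy K g U \<and> \<not> norm (U - mat 1) < e"
    by (metis of_nat_0_less_iff zero_less_Suc zero_less_divide_1_iff)
  then obtain g U where gU: "\<And>m u. norm u = 1 \<Longrightarrow> \<bar>g m u - f u\<bar> < 1 / real (Suc m)"
    "\<And>m. greedy K (g m) (U m)" "\<And>m. e \<le> norm (U m - mat 1)"
    by (metis not_le)
  have UK: "U m \<in> K" for m using gU(2) by (simp add: greedy_def)
  obtain U0 \<rho> where \<rho>: "U0 \<in> K" "strict_mono \<rho>" "(U \<circ> \<rho>) \<longlonglongrightarrow> U0"
    using K(1) UK unfolding compact_def by metis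
  have lim: "(\<lambda>m. U (\<rho> m)) \<longlonglongrightarrow> U0" using \<rho>(3) by (simp add: comp_def)
  have "U0 $ k = axis k 1" for k
  proof (induction "card {..<k}" arbitrary: k rule: less_induct)
    case less
    have prev: "U0 $ j = axis j 1" if "j < k" for j
    proof (rule less)
      show "card {..<j} < card {..<k}" using that by (intro psubset_card_mono) auto
    qed
    have rowlim: "(\<lambda>m. U (\<rho> m) $ j) \<longlonglongrightarrow> U0 $ j" for j using lim by (rule tendsto_vec_nth)
    \<comment> \<open>The identity itself is no admissible competitor, as its earlier rows need not
      agree with those of U (\<rho> m). The adjusted matrices agree eventually, and their row k
      tends to the axis.\<close>
    obtain V where V: "\<And>m. orthogonal_matrix (V m)" "V \<longlonglongrightarrow> mat 1"
      "\<And>j. j < k \<Longrightarrow> \<forall>\<^sub>F m in sequentially. V m $ j = U (\<rho> m) $ j"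
    proof -
      have "(\<lambda>m. U (\<rho> m) $ j) \<longlonglongrightarrow> axis j 1" if "j \<in> {..<k}" for j
        using rowlim[of j] prev[of j] that by simp
      from orthogonal_matrix_adjust_rows[of "\<lambda>m. U (\<rho> m)" "{..<k}", OF K(2)[OF UK] this]
      show ?thesis using that by auto
    qed
    have "\<forall>\<^sub>F m in sequentially. dist (V m) (mat 1) < r" using V(2) r(1) by (rule tendstoD)
    moreover have "\<forall>\<^sub>F m in sequentially. \<forall>j\<in>{..<k}. V m $ j = U (\<rho> m) $ j"
      using V(3) by (intro eventually_ball_finite) auto
    \<comment> \<open>The factor 2 stems from exchanging g for f once on each side of the
      comparison.\<close>
    ultimately have ev: "\<forall>\<^sub>F m in sequentially. f (V m $ k) - 2 * (1 / real (Suc (\<rho> m))) \<le> f (U (\<rho> m) $ k)"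
    proof eventually_elim
      case (elim m)
      have "V m \<in> K" using r(2)[OF V(1)] elim(1) by (simp add: dist_norm)
      then have "g (\<rho> m) (V m $ k) \<le> g (\<rho> m) (U (\<rho> m) $ k)"
        using gU(2)[of "\<rho> m"] elim(2) by (auto simp: greedy_def)
      moreover have "norm (V m $ k) = 1" "norm (U (\<rho> m) $ k) = 1"
        using V(1) K(2)[OF UK] by (auto intro: orthogonal_row_norm)
      ultimately show ?case using gU(1)[of "V m $ k" "\<rho> m"] gU(1)[of "U (\<rho> m) $ k" "\<rho> m"] by linarith
    qed
    have "(\<lambda>m. 1 / real (Suc (\<rho> m))) \<longlonglongrightarrow> 0"
      using LIMSEQ_subseq_LIMSEQ[OF LIMSEQ_inverse_real_of_nat \<rho>(2)] by (simp add: comp_def inverse_eq_divide)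
    moreover have "(\<lambda>m. f (V m $ k)) \<longlonglongrightarrow> f (axis k 1)"
      using continuous_on_tendsto_compose[OF f tendsto_vec_nth[OF V(2), of k]] by (simp add: mat_1_row)
    ultimately have "(\<lambda>m. f (V m $ k) - 2 * (1 / real (Suc (\<rho> m)))) \<longlonglongrightarrow> f (axis k 1) - 2 * 0"
      by (intro tendsto_intros)
    moreover have "(\<lambda>m. f (U (\<rho> m) $ k)) \<longlonglongrightarrow> f (U0 $ k)"
      using continuous_on_tendsto_compose[OF f rowlim[of k]] by simp
    ultimately have "f (axis k 1) \<le> f (U0 $ k)"
      using ev by (intro tendsto_le[OF sequentially_bot]) auto
    then show ?case using ident[OF \<rho>(1) prev] by blast
  qed
  then have "U0 = mat 1" by (simp add: vec_eq_iff mat_1_row)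
  moreover have "(\<lambda>m. norm (U (\<rho> m) - mat 1)) \<longlonglongrightarrow> norm (U0 - mat 1)"
    using lim by (intro tendsto_intros)
  then have "e \<le> norm (U0 - mat 1)"
    using gU(3) by (intro tendsto_lowerbound) auto
  ultimately show False using e by simp
qed

text \<open>The index is even, so the rows are determined only up to sign; this set fixes a sign for
  which the identity can be the limit.\<close>

definition orthogonal_nonneg_diagonal :: "(real^'p^'p) set" where
  "orthogonal_nonneg_diagonal = {U. orthogonal_matrix U \<and> (\<forall>k. 0 \<le> U $ k $ k)}"

text \<open>When the component indices are not decreasing, global maximization would extract the
  components in another order. A neighbourhood of the identity enforces the given one.\<close>

definition orthogonal_near_identity :: "real \<Rightarrow> (real^'p^'p) set" where
  "orthogonal_near_identity d = {U. orthogonal_matrix U \<and> norm (U - mat 1) \<le> d}"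

lemma compact_orthogonal_nonneg_diagonal: "compact (orthogonal_nonneg_diagonal :: (real^'p^'p) set)"
proof -
  have "closed {U :: real^'p^'p. \<forall>k. 0 \<le> U $ k $ k}"
    by (intro closed_Collect_all closed_Collect_le continuous_intros)
  from compact_Int_closed[OF compact_orthogonal_matrices this] show ?thesis
    by (simp add: orthogonal_nonneg_diagonal_def Int_def)
qed

lemma compact_orthogonal_near_identity: "compact (orthogonal_near_identity d :: (real^'p^'p) set)"
proof -
  have "closed {U :: real^'p^'p. norm (U - mat 1) \<le> d}"
    by (intro closed_Collect_le continuous_intros)
  from compact_Int_closed[OF compact_orthogonal_matrices this] show ?thesis
    by (simp add: orthogonal_near_identity_def Int_def)
qed

lemma deflation_sphere_orthogonal:
  assumes "orthogonal_matrix U" "u \<in> deflation_sphere U k"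
  shows "norm u = 1" "j < k \<Longrightarrow> (U $ j) \<bullet> u = 0"
  using assms by (auto simp: deflation_sphere_def row_def inner_commute)

text \<open>The rotation extends an admissible unit vector close to row k to an orthogonal matrix
  close to U. This matrix is a competitor because U is interior to K relative to the orthogonal
  matrices.\<close>

lemma greedy_imp_local_max:
  fixes U :: "real^'p::{finite,linorder}^'p::{finite,linorder}"
  assumes g: "greedy K f U" and U: "orthogonal_matrix U"
    and r: "r > 0" "\<And>V. orthogonal_matrix V \<Longrightarrow> norm (V - U) < r \<Longrightarrow> V \<in> K"
  shows "\<exists>\<epsilon>>0. \<forall>u\<in>deflation_sphere U k. dist u (row k U) < \<epsilon> \<longrightarrow> f u \<le> f (row k U)"
proof -
  define C where "C = 2 * real CARD('p) + 1"
  define \<epsilon> where "\<epsilon> = min 1 (r / C)"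
  have C: "C > 0" by (simp add: C_def add_nonneg_pos)
  have "\<epsilon> > 0" using r C by (simp add: \<epsilon>_def)
  moreover have "f u \<le> f (row k U)" if u: "u \<in> deflation_sphere U k" and d: "dist u (row k U) < \<epsilon>" for u
  proof -
    have row: "row k U = U $ k" by (simp add: row_def vec_eq_iff)
    have d1: "norm (u - U $ k) \<le> 1" "norm (u - U $ k) < r / C"
      using d by (auto simp: \<epsilon>_def row dist_norm)
    obtain V where V: "orthogonal_matrix V" "V $ k = u"
      "\<And>j. j \<noteq> k \<Longrightarrow> (U $ j) \<bullet> u = 0 \<Longrightarrow> V $ j = U $ j"
      "norm (V - U) \<le> 2 * real CARD('p) * norm (u - U $ k)"
      using orthogonal_matrix_replace_row[OF U deflation_sphere_orthogonal(1)[OF U u] d1(1)] by metis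
    have "norm (V - U) \<le> C * norm (u - U $ k)"
      using V(4) norm_ge_zero[of "u - U $ k"] unfolding C_def distrib_right by linarith
    also have "\<dots> < C * (r / C)" using d1(2) C by (intro mult_strict_left_mono)
    finally have "V \<in> K" using C r(2)[OF V(1)] by simp
    moreover have "V $ j = U $ j" if "j < k" for j
      using V(3)[of j] deflation_sphere_orthogonal(2)[OF U u that] that by simp
    ultimately show ?thesis using g V(2) row by (auto simp: greedy_def)
  qed
  ultimately show ?thesis by blast
qed

text \<open>The reflection completes any admissible unit vector, at any distance, to an orthogonal
  competitor.\<close>

lemma greedy_imp_max:
  fixes U :: "real^'p::{finite,linorder}^'p::{finite,linorder}"
  assumes g: "greedy {U. orthogonal_matrix U} f U" and u: "u \<in> deflation_sphere U k"
  shows "f u \<le> f (row k U)"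
proof -
  have U: "orthogonal_matrix U" using g by (simp add: greedy_def)
  have row: "row k U = U $ k" by (simp add: row_def vec_eq_iff)
  obtain V where V: "orthogonal_matrix V" "V $ k = u"
      "\<And>j. j \<noteq> k \<Longrightarrow> (U $ j) \<bullet> u = 0 \<Longrightarrow> V $ j = U $ j"
    using orthogonal_matrix_reflect_row[OF U deflation_sphere_orthogonal(1)[OF U u]] by metis
  moreover have "V $ j = U $ j" if "j < k" for j
    using V(3)[of j] deflation_sphere_orthogonal(2)[OF U u that] that by simp
  ultimately show ?thesis using g row by (auto simp: greedy_def)
qed

text \<open>The reflected matrix may leave the set, so rows with negative diagonal entry are
  flipped. Evenness of f makes this harmless in row k, and the rows before k already have the right
  sign.\<close>

lemma greedy_nonneg_diagonal_imp_max:
  fixes U :: "real^'p::{finite,linorder}^'p::{finite,linorder}"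
  assumes g: "greedy orthogonal_nonneg_diagonal f U" and u: "u \<in> deflation_sphere U k"
    and even: "\<And>u. f (- u) = f u"
  shows "f u \<le> f (row k U)"
proof -
  have U: "orthogonal_matrix U" and Ukk: "\<And>k. 0 \<le> U $ k $ k"
    using g by (auto simp: greedy_def orthogonal_nonneg_diagonal_def)
  have row: "row k U = U $ k" by (simp add: row_def vec_eq_iff)
  obtain V where V: "orthogonal_matrix V" "V $ k = u"
      "\<And>j. j \<noteq> k \<Longrightarrow> (U $ j) \<bullet> u = 0 \<Longrightarrow> V $ j = U $ j"
    using orthogonal_matrix_reflect_row[OF U deflation_sphere_orthogonal(1)[OF U u]] by metis
  define V' where "V' = (\<chi> j. if V $ j $ j < 0 then - (V $ j) else V $ j)"
  have "orthogonal_matrix V'" using V(1) by (auto simp: V'_def orthogonal_matrix_iff_rows)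
  then have "V' \<in> orthogonal_nonneg_diagonal" by (simp add: orthogonal_nonneg_diagonal_def V'_def)
  moreover have "V' $ j = U $ j" if "j < k" for j
    using V(3)[of j] deflation_sphere_orthogonal(2)[OF U u that] that Ukk[of j] by (simp add: V'_def)
  ultimately have "f (V' $ k) \<le> f (U $ k)" using g by (auto simp: greedy_def)
  moreover have "f (V' $ k) = f u" using V(2) by (auto simp: V'_def even)
  ultimately show ?thesis by (simp add: row)
qed

text \<open>For independent standardized components, the sums are the third moment and, on unit
  vectors, the fourth moment minus 3 of the projection on u. This is the limit of
  \<open>empirical_index\<close>.\<close>

definition population_index :: "real \<Rightarrow> (real^'p) measure \<Rightarrow> real^'p \<Rightarrow> real" where
  "population_index \<alpha> D u = \<alpha> * (\<Sum>j\<in>UNIV. (u $ j) ^ 3 * gam D j)\<^sup>2 + (1 - \<alpha>) * (\<Sum>j\<in>UNIV. (u $ j) ^ 4 * kap D j)\<^sup>2"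

lemma continuous_on_population_index: "continuous_on UNIV (population_index \<alpha> D)"
  unfolding population_index_def by (intro continuous_intros)

lemma population_index_axis: "population_index \<alpha> D (axis k 1) = component_index \<alpha> D k"
proof -
  have "(axis k 1 $ j) ^ Suc m * c j = (if j = k then c j else 0)" for j :: 'a and m and c :: "'a \<Rightarrow> real"
    by (simp add: axis_def)
  from this[of _ 2] this[of _ 3] show ?thesis
    by (simp add: population_index_def component_index_def numeral_eq_Suc)
qed

text \<open>Cauchy-Schwarz after splitting off one factor u_j, whose squares sum to 1. The kurtosis
  term keeps a surplus factor u_j^2 \<le> 1, which is dropped.\<close>

lemma population_index_le:
  assumes \<alpha>: "0 \<le> \<alpha>" "\<alpha> \<le> 1" and u: "norm u = 1"
  shows "population_index \<alpha> D u \<le> (\<Sum>j\<in>UNIV. component_index \<alpha> D j * (u $ j) ^ 4)"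
proof -
  have cs: "(\<Sum>j\<in>UNIV. u $ j * w j)\<^sup>2 \<le> (\<Sum>j\<in>UNIV. (w j)\<^sup>2)" for w
  proof -
    have "(u \<bullet> (\<chi> j. w j))\<^sup>2 \<le> (u \<bullet> u) * ((\<chi> j. w j) \<bullet> (\<chi> j. w j))" by (rule Cauchy_Schwarz_ineq)
    then show ?thesis using u by (simp add: norm_eq_1) (simp add: inner_vec_def power2_eq_square)
  qed
  have u1: "(u $ j)\<^sup>2 \<le> 1" for j
    using component_le_norm_cart[of u j] u by (simp add: abs_square_le_1)
  have "(\<Sum>j\<in>UNIV. (u $ j) ^ 3 * gam D j)\<^sup>2 \<le> (\<Sum>j\<in>UNIV. (gam D j)\<^sup>2 * (u $ j) ^ 4)"
    using cs[of "\<lambda>j. (u $ j)\<^sup>2 * gam D j"]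
    by (simp add: power_mult_distrib power2_eq_square power3_eq_cube power4_eq_xxxx mult_ac)
  moreover have "(\<Sum>j\<in>UNIV. (u $ j) ^ 4 * kap D j)\<^sup>2 \<le> (\<Sum>j\<in>UNIV. (kap D j)\<^sup>2 * (u $ j) ^ 4)"
  proof -
    have "(\<Sum>j\<in>UNIV. (u $ j) ^ 4 * kap D j)\<^sup>2 \<le> (\<Sum>j\<in>UNIV. ((u $ j) ^ 3 * kap D j)\<^sup>2)"
      using cs[of "\<lambda>j. (u $ j) ^ 3 * kap D j"] by (simp add: power3_eq_cube power4_eq_xxxx mult_ac)
    also have "\<dots> \<le> (\<Sum>j\<in>UNIV. (kap D j)\<^sup>2 * (u $ j) ^ 4)"
    proof (rule sum_mono)
      fix j
      have "((u $ j) ^ 3 * kap D j)\<^sup>2 = (kap D j)\<^sup>2 * (u $ j) ^ 4 * (u $ j)\<^sup>2"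
        by (simp add: power_mult_distrib power2_eq_square power3_eq_cube power4_eq_xxxx mult_ac)
      also have "\<dots> \<le> (kap D j)\<^sup>2 * (u $ j) ^ 4 * 1" using u1 by (intro mult_left_mono) auto
      finally show "((u $ j) ^ 3 * kap D j)\<^sup>2 \<le> (kap D j)\<^sup>2 * (u $ j) ^ 4" by simp
    qed
    finally show ?thesis .
  qed
  ultimately have "population_index \<alpha> D u \<le> \<alpha> * (\<Sum>j\<in>UNIV. (gam D j)\<^sup>2 * (u $ j) ^ 4) + (1 - \<alpha>) * (\<Sum>j\<in>UNIV. (kap D j)\<^sup>2 * (u $ j) ^ 4)"
    unfolding population_index_def using \<alpha> by (intro add_mono mult_left_mono) auto
  also have "\<dots> = (\<Sum>j\<in>UNIV. component_index \<alpha> D j * (u $ j) ^ 4)"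
    by (simp add: component_index_def sum_distrib_left distrib_right mult.assoc flip: sum.distrib)
  finally show ?thesis .
qed

lemma component_index_nonneg: "0 \<le> \<alpha> \<Longrightarrow> \<alpha> \<le> 1 \<Longrightarrow> 0 \<le> component_index \<alpha> D k"
  by (simp add: component_index_def)

lemma sum_squares_unit: "norm (u :: real^'n) = 1 \<Longrightarrow> (\<Sum>j\<in>UNIV. (u $ j)\<^sup>2) = 1"
  by (simp add: norm_eq_1 inner_vec_def power2_eq_square)

lemma unit_vector_axisI:
  fixes u :: "real^'n"
  assumes "norm u = 1" "\<And>j. j \<noteq> k \<Longrightarrow> u $ j = 0" "u $ k \<ge> 0"
  shows "u = axis k 1"
proof -
  have "(\<Sum>j\<in>UNIV. (u $ j)\<^sup>2) = (\<Sum>j\<in>UNIV. if j = k then (u $ k)\<^sup>2 else 0)"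
    using assms(2) by (intro sum.cong) auto
  then have "(u $ k)\<^sup>2 = 1" using sum_squares_unit[OF assms(1)] by simp
  then have "u $ k = 1" using assms(3) by (simp add: power2_eq_1_iff)
  then show ?thesis using assms(2) by (auto simp: vec_eq_iff axis_def)
qed

lemma orthogonal_row_zero:
  fixes U :: "real^'n^'n"
  assumes "orthogonal_matrix U" "U $ j = axis j 1" "j \<noteq> k"
  shows "U $ k $ j = 0"
proof -
  have "(U $ k) \<bullet> (U $ j) = 0" using assms(1,3) by (auto simp: orthogonal_matrix_iff_rows)
  then show ?thesis by (simp add: assms(2) inner_axis)
qed

text \<open>Since u_j^4 \<le> u_j^2, the index of u is at most a weighted mean of the component
  indices. Coordinates before k vanish by orthogonality and those after k have smaller index, so all
  weight is at k; the diagonal condition fixes the sign.\<close>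

lemma identification_decreasing:
  fixes U :: "real^'p::{finite,linorder}^'p::{finite,linorder}"
  assumes \<alpha>: "0 \<le> \<alpha>" "\<alpha> \<le> 1" and dec: "index_decreasing \<alpha> D"
    and U: "U \<in> orthogonal_nonneg_diagonal" and prev: "\<And>j. j < k \<Longrightarrow> U $ j = axis j 1"
    and le: "population_index \<alpha> D (axis k 1) \<le> population_index \<alpha> D (U $ k)"
  shows "U $ k = axis k 1"
proof -
  define u where "u = U $ k"
  define c where "c = component_index \<alpha> D"
  have oU: "orthogonal_matrix U" and Ukk: "0 \<le> u $ k" using U by (auto simp: orthogonal_nonneg_diagonal_def u_def)
  have u: "norm u = 1" using oU by (simp add: u_def orthogonal_row_norm)
  have z: "u $ j = 0" if "j < k" for j
    using orthogonal_row_zero[OF oU prev[OF that]] that by (simp add: u_def)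
  have u4: "(u $ j) ^ 4 \<le> (u $ j)\<^sup>2" for j
  proof -
    have "(u $ j)\<^sup>2 \<le> 1" using component_le_norm_cart[of u j] u by (simp add: abs_square_le_1)
    then have "(u $ j)\<^sup>2 * (u $ j)\<^sup>2 \<le> (u $ j)\<^sup>2 * 1" by (intro mult_left_mono) auto
    then show ?thesis by (simp add: power2_eq_square power4_eq_xxxx)
  qed
  have c0: "0 \<le> c j" for j using \<alpha> by (simp add: c_def component_index_nonneg)
  have "c k \<le> (\<Sum>j\<in>UNIV. c j * (u $ j) ^ 4)"
    using le population_index_le[OF \<alpha> u, of D] by (simp add: population_index_axis c_def u_def)
  also have "\<dots> \<le> (\<Sum>j\<in>UNIV. c j * (u $ j)\<^sup>2)" by (intro sum_mono mult_left_mono u4 c0)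
  finally have "0 \<le> (\<Sum>j\<in>UNIV. c j * (u $ j)\<^sup>2) - c k * (\<Sum>j\<in>UNIV. (u $ j)\<^sup>2)"
    using sum_squares_unit[OF u] by simp
  also have "\<dots> = - (\<Sum>j\<in>UNIV. (c k - c j) * (u $ j)\<^sup>2)"
    by (simp add: sum_distrib_left sum_subtractf left_diff_distrib)
  finally have s: "(\<Sum>j\<in>UNIV. (c k - c j) * (u $ j)\<^sup>2) \<le> 0" by simp
  have nn: "0 \<le> (c k - c j) * (u $ j)\<^sup>2" for j
    using dec z[of j] by (cases j k rule: linorder_cases) (auto simp: index_decreasing_def c_def less_imp_le)
  have "(\<Sum>j\<in>UNIV. (c k - c j) * (u $ j)\<^sup>2) = 0" using s nn by (intro antisym sum_nonneg) auto
  then have zero: "(c k - c j) * (u $ j)\<^sup>2 = 0" for j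
    using nn by (subst (asm) sum_nonneg_eq_0_iff) auto
  have "u $ j = 0" if "j \<noteq> k" for j
  proof (cases "j < k")
    case False
    then have "c j < c k" using dec that by (auto simp: index_decreasing_def c_def)
    then show ?thesis using zero[of j] by simp
  qed (rule z)
  then show ?thesis using unit_vector_axisI[OF u _ Ukk] by (simp add: u_def)
qed

text \<open>Put s = 1 - u_k^2. The index of u is at most c_k (1 - s)^2 + C s^2: leaving the axis
  loses 2 c_k s to first order and gains only to second order, so a small s must be 0.\<close>

lemma identification_local:
  fixes D :: "(real^'p::{finite,linorder}) measure"
  assumes \<alpha>: "0 \<le> \<alpha>" "\<alpha> \<le> 1" and pos: "\<And>k l. k < l \<Longrightarrow> component_index \<alpha> D k > 0"
  shows "\<exists>d>0. \<forall>U k. U \<in> orthogonal_near_identity d \<longrightarrow> (\<forall>j<k. U $ j = axis j 1) \<longrightarrow>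
    population_index \<alpha> D (axis k 1) \<le> population_index \<alpha> D (U $ k) \<longrightarrow> U $ k = axis k 1"
proof -
  define c where "c = component_index \<alpha> D"
  define C where "C = (\<Sum>j\<in>UNIV. c j)"
  have c0: "0 \<le> c j" for j using \<alpha> by (simp add: c_def component_index_nonneg)
  have cC: "c j \<le> C" for j unfolding C_def using c0 by (intro member_le_sum) auto
  define m where "m = Min (insert 1 (c ` {k. 0 < c k}))"
  have m: "0 < m" "0 < c k \<Longrightarrow> m \<le> c k" for k unfolding m_def by auto
  \<comment> \<open>Ensures d^2 \<le> 1 / 4 and d^2 C < m \<le> c_k. With s \<le> d^2 this gives s
    (c_k + C) < 2 c_k, which excludes s > 0.\<close>
  define d where "d = min (1 / 2) (m / (C + 1))"
  have C0: "0 \<le> C" using c0 by (simp add: C_def sum_nonneg)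
  have d: "0 < d" "d \<le> 1 / 2" using m C0 unfolding d_def by (simp, intro min.cobounded1)
  have dC: "d\<^sup>2 * C < m"
  proof -
    have "d\<^sup>2 * C \<le> d * C" using d C0 by (intro mult_right_mono) (auto simp: power2_eq_square)
    also have "\<dots> < d * (C + 1)" using d by simp
    also have "\<dots> \<le> m / (C + 1) * (C + 1)" using C0 by (intro mult_right_mono) (auto simp: d_def)
    finally show ?thesis using C0 by simp
  qed
  have "U $ k = axis k 1" if U: "U \<in> orthogonal_near_identity d" and prev: "\<And>j. j < k \<Longrightarrow> U $ j = axis j 1"
    and le: "population_index \<alpha> D (axis k 1) \<le> population_index \<alpha> D (U $ k)" for U k
  proof -
    define u where "u = U $ k"
    have oU: "orthogonal_matrix U" using U by (simp add: orthogonal_near_identity_def)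
    have u: "norm u = 1" using oU by (simp add: u_def orthogonal_row_norm)
    have "norm (u - axis k 1) \<le> norm (U - mat 1)"
      using Finite_Cartesian_Product.norm_nth_le[of "U - mat 1" k] by (simp add: u_def mat_1_row)
    then have ud: "norm (u - axis k 1) \<le> d" using U by (simp add: orthogonal_near_identity_def)
    define s where "s = 1 - (u $ k)\<^sup>2"
    have "(norm (u - axis k 1))\<^sup>2 = 2 - 2 * u $ k"
      unfolding power2_norm_eq_inner using u
      by (simp add: inner_diff_left inner_diff_right inner_axis inner_axis' norm_eq_1 algebra_simps)
    then have uk: "2 - 2 * u $ k \<le> d\<^sup>2" using ud power_mono[OF ud, of 2] by simp
    have d2: "d\<^sup>2 \<le> 1 / 4" using d power_mono[of d "1/2" 2] by (simp add: power2_eq_square)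
    then have ukpos: "u $ k \<ge> 0" using uk by simp
    have s_sum: "s = (\<Sum>j\<in>UNIV - {k}. (u $ j)\<^sup>2)"
      using sum_squares_unit[OF u] sum.remove[of UNIV k "\<lambda>j. (u $ j)\<^sup>2"] by (simp add: s_def)
    then have s0: "0 \<le> s" by (simp add: sum_nonneg)
    have "0 \<le> (1 - u $ k)\<^sup>2" by simp
    then have sd: "s \<le> d\<^sup>2" using uk unfolding s_def power2_diff by simp
    have uj: "(u $ j)\<^sup>2 \<le> s" if "j \<noteq> k" for j
      unfolding s_sum using that by (intro member_le_sum) auto
    have "s = 0"
    proof (cases "\<exists>l. k < l")
      case True
      then have ck: "0 < c k" using pos by (auto simp: c_def)
      have "c k \<le> (\<Sum>j\<in>UNIV. c j * (u $ j) ^ 4)"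
        using le population_index_le[OF \<alpha> u, of D] by (simp add: population_index_axis c_def u_def)
      also have "\<dots> = c k * (u $ k) ^ 4 + (\<Sum>j\<in>UNIV - {k}. c j * (u $ j) ^ 4)"
        by (rule sum.remove) auto
      also have "(\<Sum>j\<in>UNIV - {k}. c j * (u $ j) ^ 4) \<le> (\<Sum>j\<in>UNIV - {k}. C * s * (u $ j)\<^sup>2)"
      proof (rule sum_mono)
        fix j assume "j \<in> UNIV - {k}"
        then have "c j * ((u $ j)\<^sup>2 * (u $ j)\<^sup>2) \<le> C * (s * (u $ j)\<^sup>2)"
          using uj[of j] c0[of j] cC[of j] C0 by (intro mult_mono mult_right_mono) auto
        then show "c j * (u $ j) ^ 4 \<le> C * s * (u $ j)\<^sup>2"
          by (simp add: power2_eq_square power4_eq_xxxx mult_ac)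
      qed
      also have "\<dots> = C * s * s" by (simp add: s_sum flip: sum_distrib_left)
      also have "(u $ k) ^ 4 = (1 - s)\<^sup>2" by (simp add: s_def power2_eq_square power4_eq_xxxx)
      finally have "0 \<le> s * (s * (c k + C) - 2 * c k)" by (simp add: power2_eq_square algebra_simps)
      moreover have "s * (c k + C) - 2 * c k < 0"
      proof -
        have "s * (c k + C) \<le> d\<^sup>2 * (c k + C)" using sd c0[of k] C0 by (intro mult_right_mono) auto
        also have "\<dots> = d\<^sup>2 * c k + d\<^sup>2 * C" by (simp add: algebra_simps)
        also have "d\<^sup>2 * c k \<le> 1 / 4 * c k" using d2 ck by (intro mult_right_mono) auto
        finally show ?thesis using dC m(2)[OF ck] ck by simp
      qed
      ultimately show ?thesis using s0 by (simp add: zero_le_mult_iff)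
    next
      \<comment> \<open>Here k is the last index. All earlier rows are axes, so orthogonality alone
        removes the other coordinates and the index of k may be zero.\<close>
      case False
      have "u $ j = 0" if "j \<noteq> k" for j
        using orthogonal_row_zero[OF oU prev that] False that by (simp add: u_def) (meson linorder_neqE)
      then show ?thesis unfolding s_sum by simp
    qed
    then have "(\<Sum>j\<in>UNIV - {k}. (u $ j)\<^sup>2) = 0" using s_sum by simp
    then have "u $ j = 0" if "j \<noteq> k" for j
      using that by (subst (asm) sum_nonneg_eq_0_iff) auto
    then show ?thesis using unit_vector_axisI[OF u _ ukpos] by (simp add: u_def)
  qed
  then show ?thesis using d(1) by blast
qed

section \<open>Linearization of the estimating equations\<close>

context iid_sample
begin

lemma avg_sum: "finite I \<Longrightarrow> avg (\<lambda>v. \<Sum>i\<in>I. f i v) T = (\<Sum>i\<in>I. avg (f i) T)"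
  unfolding avg_def by (subst sum.swap) (simp add: sum_divide_distrib)

lemma avg_cmult: "avg (\<lambda>v. c * f v) T = c * avg f T"
  by (simp add: avg_def sum_distrib_left)

lemma avg_add: "avg (\<lambda>v. f v + g v) T = avg f T + avg g T"
  by (simp add: avg_def sum.distrib add_divide_distrib)

end

section \<open>Moments of independent components and their empirical multilinear forms\<close>

locale ica_sample = iid_sample M D z
  for M :: "'a measure" and D :: "(real^'p) measure" and z :: "nat \<Rightarrow> 'a \<Rightarrow> real^'p" +
  assumes indep_components: "prob_space.indep_vars D (\<lambda>_. borel) (\<lambda>k v. v $ k) UNIV"
    and mean_component: "\<And>k. (\<integral>v. v $ k \<partial>D) = 0"
    and variance_component: "\<And>k. (\<integral>v. (v $ k)\<^sup>2 \<partial>D) = 1"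
    and sixth_moment: "\<And>k. integrable D (\<lambda>v. (v $ k) ^ 6)"
begin

sublocale D: prob_space D by (rule prob_space_D)

lemma moment_integrable:
  assumes "m \<le> 6"
  shows "integrable D (\<lambda>v. (v $ k) ^ m)"
proof (rule Bochner_Integration.integrable_bound)
  show "integrable D (\<lambda>v. 1 + (v $ k) ^ 6)" using sixth_moment by simp
  have "\<bar>x\<bar> ^ m \<le> 1 + \<bar>x\<bar> ^ 6" for x :: real
  proof (cases "\<bar>x\<bar> \<le> 1")
    case True
    then have "\<bar>x\<bar> ^ m \<le> 1" by (simp add: power_le_one)
    then show ?thesis by (simp add: add_increasing2)
  next
    case False
    then have "\<bar>x\<bar> ^ m \<le> \<bar>x\<bar> ^ 6" using assms by (intro power_increasing) auto
    then show ?thesis by simp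
  qed
  then show "AE v in D. norm ((v $ k) ^ m) \<le> norm (1 + (v $ k) ^ 6)"
    by (simp add: power_abs)
qed simp

lemma product_moment:
  assumes "\<And>k. e k \<le> 6"
  shows "integrable D (\<lambda>v. \<Prod>k\<in>UNIV. (v $ k) ^ e k)"
    "(\<integral>v. (\<Prod>k\<in>UNIV. (v $ k) ^ e k) \<partial>D) = (\<Prod>k\<in>UNIV. \<integral>v. (v $ k) ^ e k \<partial>D)"
proof -
  have i: "D.indep_vars (\<lambda>_. borel) (\<lambda>k v. (v $ k) ^ e k) UNIV"
    using D.indep_vars_compose2[OF indep_components, of "\<lambda>k x. x ^ e k" "\<lambda>_. borel"] by simp
  show "integrable D (\<lambda>v. \<Prod>k\<in>UNIV. (v $ k) ^ e k)"
    "(\<integral>v. (\<Prod>k\<in>UNIV. (v $ k) ^ e k) \<partial>D) = (\<Prod>k\<in>UNIV. \<integral>v. (v $ k) ^ e k \<partial>D)"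
    using D.indep_vars_integrable[OF _ i] D.indep_vars_lebesgue_integral[OF _ i] moment_integrable assms
    by auto
qed

lemma product_moment2:
  assumes "k \<noteq> l" "i \<le> 6" "j \<le> 6"
  shows "integrable D (\<lambda>v. (v $ k) ^ i * (v $ l) ^ j)"
    "(\<integral>v. (v $ k) ^ i * (v $ l) ^ j \<partial>D) = (\<integral>v. (v $ k) ^ i \<partial>D) * (\<integral>v. (v $ l) ^ j \<partial>D)"
proof -
  define e where "e m = (if m = k then i else if m = l then j else 0)" for m
  have e6: "e m \<le> 6" for m using assms by (simp add: e_def)
  have p: "(\<Prod>m\<in>UNIV. f m (e m)) = f k i * f l j" if "\<And>m. f m 0 = 1" for f :: "'p \<Rightarrow> nat \<Rightarrow> real"
  proof -
    have "(\<Prod>m\<in>UNIV. f m (e m)) = (\<Prod>m\<in>{k, l}. f m (e m))"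
      by (rule prod.mono_neutral_right) (auto simp: e_def that)
    then show ?thesis using assms(1) by (simp add: e_def)
  qed
  show "integrable D (\<lambda>v. (v $ k) ^ i * (v $ l) ^ j)"
    "(\<integral>v. (v $ k) ^ i * (v $ l) ^ j \<partial>D) = (\<integral>v. (v $ k) ^ i \<partial>D) * (\<integral>v. (v $ l) ^ j \<partial>D)"
    using product_moment[of e, OF e6] p[of "\<lambda>m i. (v $ m) ^ i" for v] p[of "\<lambda>m i. \<integral>v. (v $ m) ^ i \<partial>D"] D.prob_space
    by simp_all
qed

text \<open>Independent centred coordinates are added one at a time, carrying the moments up to
  order four together. The term 3 (\<Sum> u_j^2)^2 is the Gaussian part of the fourth moment and
  equals 3 on the unit sphere.\<close>

lemma moments_projection:
  fixes u :: "real^'p"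
  shows "(\<integral>v. (u \<bullet> v) ^ 3 \<partial>D) = (\<Sum>j\<in>UNIV. (u $ j) ^ 3 * gam D j)"
    "(\<integral>v. (u \<bullet> v) ^ 4 \<partial>D) = (\<Sum>j\<in>UNIV. (u $ j) ^ 4 * kap D j) + 3 * (\<Sum>j\<in>UNIV. (u $ j)\<^sup>2)\<^sup>2"
proof -
  define X where "X j v = u $ j * v $ j" for j and v :: "real^'p"
  define S where "S A v = (\<Sum>j\<in>A. X j v)" for A v
  have XI: "integrable D (\<lambda>v. X j v ^ m)" if "m \<le> 4" for j m
    using moment_integrable[of m j] that by (simp add: X_def power_mult_distrib)
  have XE: "(\<integral>v. X j v ^ m \<partial>D) = (u $ j) ^ m * (\<integral>v. (v $ j) ^ m \<partial>D)" for j m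
    by (simp add: X_def power_mult_distrib)
  have ind: "D.indep_vars (\<lambda>_. borel) X UNIV"
    unfolding X_def using D.indep_vars_compose2[OF indep_components, of "\<lambda>k x. u $ k * x" "\<lambda>_. borel"] by simp
  have "(\<forall>m\<le>4. integrable D (\<lambda>v. S A v ^ m)) \<and> (\<integral>v. S A v \<partial>D) = 0 \<and> (\<integral>v. S A v ^ 2 \<partial>D) = (\<Sum>j\<in>A. (u $ j)\<^sup>2)
    \<and> (\<integral>v. S A v ^ 3 \<partial>D) = (\<Sum>j\<in>A. (u $ j) ^ 3 * gam D j)
    \<and> (\<integral>v. S A v ^ 4 \<partial>D) = (\<Sum>j\<in>A. (u $ j) ^ 4 * kap D j) + 3 * (\<Sum>j\<in>A. (u $ j)\<^sup>2)\<^sup>2" for A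
    using finite[of A]
  proof (induction A rule: finite_induct)
    case empty
    have "integrable D (\<lambda>v. (0::real) ^ m)" for m by simp
    then show ?case by (simp add: S_def)
  next
    case (insert b A)
    have SI: "integrable D (\<lambda>v. S A v ^ m)" if "m \<le> 4" for m using insert.IH that by blast
    have ib: "D.indep_var borel (X b) borel (S A)"
      unfolding S_def by (rule D.indep_vars_sum) (use insert D.indep_vars_subset[OF ind] in auto)
    have ib2: "D.indep_var borel (\<lambda>v. X b v ^ i) borel (\<lambda>v. S A v ^ j)" for i j
      using D.indep_var_compose[OF ib, of "\<lambda>x. x ^ i" borel "\<lambda>x. x ^ j" borel] by (simp add: comp_def)
    have PI: "integrable D (\<lambda>v. X b v ^ i * S A v ^ j)" if "i \<le> 4" "j \<le> 4" for i j
      by (rule D.indep_var_integrable[OF ib2 XI[OF that(1)] SI[OF that(2)]])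
    have PE: "(\<integral>v. X b v ^ i * S A v ^ j \<partial>D) = (\<integral>v. X b v ^ i \<partial>D) * (\<integral>v. S A v ^ j \<partial>D)" if "i \<le> 4" "j \<le> 4" for i j
      by (rule D.indep_var_lebesgue_integral[OF ib2 XI[OF that(1)] SI[OF that(2)]])
    have eq: "S (insert b A) v = X b v + S A v" for v using insert by (simp add: S_def)
    have bin: "(x + y) ^ m = (\<Sum>i\<le>m. real (m choose i) * (x ^ i * y ^ (m - i)))" for x y :: real and m
      by (simp add: binomial_ring mult.assoc)
    have I: "integrable D (\<lambda>v. S (insert b A) v ^ m)" if "m \<le> 4" for m
      unfolding eq bin using that by (intro Bochner_Integration.integrable_sum integrable_mult_right PI) auto
    have E: "(\<integral>v. S (insert b A) v ^ m \<partial>D) = (\<Sum>i\<le>m. real (m choose i) * ((\<integral>v. X b v ^ i \<partial>D) * (\<integral>v. S A v ^ (m - i) \<partial>D)))"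
      if "m \<le> 4" for m
      unfolding eq bin using that
      by (subst Bochner_Integration.integral_sum) (auto simp: PI PE intro!: integrable_mult_right sum.cong)
    have m: "(\<integral>v. (v $ b) ^ 4 \<partial>D) = kap D b + 3" "(\<integral>v. (v $ b) ^ 3 \<partial>D) = gam D b"
      by (simp_all add: kap_def bet_def gam_def)
    define \<mu> where "\<mu> i = (\<integral>v. X b v ^ i \<partial>D)" for i
    define \<sigma> where "\<sigma> i = (\<integral>v. S A v ^ i \<partial>D)" for i
    have \<mu>: "\<mu> 0 = 1" "\<mu> 1 = 0" "\<mu> 2 = (u $ b)\<^sup>2" "\<mu> 3 = (u $ b) ^ 3 * gam D b" "\<mu> 4 = (u $ b) ^ 4 * (kap D b + 3)"
      using XE[of b 1] D.prob_space by (simp_all add: \<mu>_def XE m mean_component variance_component)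
    have \<sigma>: "\<sigma> 0 = 1" "\<sigma> 1 = 0" "\<sigma> 2 = (\<Sum>j\<in>A. (u $ j)\<^sup>2)" "\<sigma> 3 = (\<Sum>j\<in>A. (u $ j) ^ 3 * gam D j)"
      "\<sigma> 4 = (\<Sum>j\<in>A. (u $ j) ^ 4 * kap D j) + 3 * (\<Sum>j\<in>A. (u $ j)\<^sup>2)\<^sup>2"
      using insert.IH D.prob_space by (simp_all add: \<sigma>_def)
    have s: "(\<Sum>i\<le>1. real (1 choose i) * (\<mu> i * \<sigma> (1 - i))) = \<mu> 0 * \<sigma> 1 + \<mu> 1 * \<sigma> 0"
      "(\<Sum>i\<le>2. real (2 choose i) * (\<mu> i * \<sigma> (2 - i))) = \<mu> 0 * \<sigma> 2 + 2 * (\<mu> 1 * \<sigma> 1) + \<mu> 2 * \<sigma> 0"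
      "(\<Sum>i\<le>3. real (3 choose i) * (\<mu> i * \<sigma> (3 - i))) = \<mu> 0 * \<sigma> 3 + 3 * (\<mu> 1 * \<sigma> 2) + 3 * (\<mu> 2 * \<sigma> 1) + \<mu> 3 * \<sigma> 0"
      "(\<Sum>i\<le>4. real (4 choose i) * (\<mu> i * \<sigma> (4 - i))) = \<mu> 0 * \<sigma> 4 + 4 * (\<mu> 1 * \<sigma> 3) + 6 * (\<mu> 2 * \<sigma> 2) + 4 * (\<mu> 3 * \<sigma> 1) + \<mu> 4 * \<sigma> 0"
      by (simp_all add: numeral_eq_Suc)
    have E': "(\<integral>v. S (insert b A) v ^ m \<partial>D) = (\<Sum>i\<le>m. real (m choose i) * (\<mu> i * \<sigma> (m - i)))" if "m \<le> 4" for m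
      using E[OF that] by (simp only: \<mu>_def \<sigma>_def)
    have "(\<integral>v. S (insert b A) v \<partial>D) = 0"
      using E'[of 1] unfolding s \<mu> \<sigma> by simp
    moreover have "(\<integral>v. S (insert b A) v ^ 2 \<partial>D) = (\<Sum>j\<in>insert b A. (u $ j)\<^sup>2)"
      using E'[of 2] insert.hyps unfolding s \<mu> \<sigma> by simp
    moreover have "(\<integral>v. S (insert b A) v ^ 3 \<partial>D) = (\<Sum>j\<in>insert b A. (u $ j) ^ 3 * gam D j)"
      using E'[of 3] insert.hyps unfolding s \<mu> \<sigma> by simp
    moreover have "(\<integral>v. S (insert b A) v ^ 4 \<partial>D) = (\<Sum>j\<in>insert b A. (u $ j) ^ 4 * kap D j) + 3 * (\<Sum>j\<in>insert b A. (u $ j)\<^sup>2)\<^sup>2"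
      using E'[of 4] insert.hyps unfolding s \<mu> \<sigma>
      by (simp add: power2_sum distrib_left)
    ultimately show ?case using I by blast
  qed
  from this[of UNIV] show "(\<integral>v. (u \<bullet> v) ^ 3 \<partial>D) = (\<Sum>j\<in>UNIV. (u $ j) ^ 3 * gam D j)"
    "(\<integral>v. (u \<bullet> v) ^ 4 \<partial>D) = (\<Sum>j\<in>UNIV. (u $ j) ^ 4 * kap D j) + 3 * (\<Sum>j\<in>UNIV. (u $ j)\<^sup>2)\<^sup>2"
    by (simp_all add: S_def X_def inner_vec_def)
qed

text \<open>The constant coordinate \<open>None\<close> makes centring linear and turns moments of lower order into
  special cases of those of order four.\<close>

definition hom :: "real^'p \<Rightarrow> real^('p option)" where
  "hom v = (\<chi> a. case a of None \<Rightarrow> 1 | Some k \<Rightarrow> v $ k)"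

definition smom4 :: "nat \<times> 'a \<Rightarrow> real^('p option) \<Rightarrow> real^('p option) \<Rightarrow> real^('p option) \<Rightarrow> real^('p option) \<Rightarrow> real" where
  "smom4 T x y u w = avg (\<lambda>v. (x \<bullet> hom v) * (y \<bullet> hom v) * (u \<bullet> hom v) * (w \<bullet> hom v)) T"

definition mom4 :: "real^('p option) \<Rightarrow> real^('p option) \<Rightarrow> real^('p option) \<Rightarrow> real^('p option) \<Rightarrow> real" where
  "mom4 x y u w = (\<integral>v. (x \<bullet> hom v) * (y \<bullet> hom v) * (u \<bullet> hom v) * (w \<bullet> hom v) \<partial>D)"

lemma inner_hom_axis [simp]: "axis None 1 \<bullet> hom v = 1" "axis (Some k) 1 \<bullet> hom v = v $ k"
  by (simp_all add: hom_def inner_axis')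

lemma hom_product_integrable:
  "integrable D (\<lambda>v. hom v $ a * hom v $ b * hom v $ c * hom v $ d)"
proof -
  define e where "e k = (\<Sum>x\<leftarrow>[a, b, c, d]. if x = Some k then 1 else 0 :: nat)" for k
  have "hom v $ x = (\<Prod>k\<in>UNIV. (v $ k) ^ (if x = Some k then 1 else 0))" for v x
  proof (cases x)
    case (Some j)
    have "(\<Prod>k\<in>UNIV. (v $ k) ^ (if x = Some k then 1 else 0)) = (\<Prod>k\<in>UNIV. if k = j then v $ k else 1)"
      using Some by (intro prod.cong) auto
    then show ?thesis using Some by (simp add: hom_def)
  qed (simp add: hom_def)
  then have "hom v $ a * hom v $ b * hom v $ c * hom v $ d = (\<Prod>k\<in>UNIV. (v $ k) ^ e k)" for v
    by (simp add: e_def power_add prod.distrib mult.assoc)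
  moreover have "e k \<le> 6" for k by (simp add: e_def)
  ultimately show ?thesis using product_moment(1)[of e] by simp
qed

lemma inner_product4:
  fixes x y u w h :: "real^('p option)"
  shows "(x \<bullet> h) * (y \<bullet> h) * (u \<bullet> h) * (w \<bullet> h) =
    (\<Sum>a\<in>UNIV. \<Sum>b\<in>UNIV. \<Sum>c\<in>UNIV. \<Sum>d\<in>UNIV. (x $ a * y $ b * u $ c * w $ d) * (h $ a * h $ b * h $ c * h $ d))"
proof -
  have "(x \<bullet> h) * (y \<bullet> h) * (u \<bullet> h) * (w \<bullet> h) = (x \<bullet> h) * ((y \<bullet> h) * ((u \<bullet> h) * (w \<bullet> h)))" by simp
  also have "\<dots> = (\<Sum>a\<in>UNIV. \<Sum>b\<in>UNIV. \<Sum>c\<in>UNIV. \<Sum>d\<in>UNIV. (x $ a * h $ a) * ((y $ b * h $ b) * ((u $ c * h $ c) * (w $ d * h $ d))))"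
    unfolding inner_vec_def inner_real_def sum_distrib_right by (simp only: sum_distrib_left)
  finally show ?thesis by (simp only: mult_ac)
qed

lemma smom4_expand: "smom4 T x y u w = (\<Sum>a\<in>UNIV. \<Sum>b\<in>UNIV. \<Sum>c\<in>UNIV. \<Sum>d\<in>UNIV. (x $ a * y $ b * u $ c * w $ d) *
    avg (\<lambda>v. hom v $ a * hom v $ b * hom v $ c * hom v $ d) T)"
  unfolding smom4_def inner_product4 by (simp add: avg_sum avg_cmult)

lemma mom4_expand: "mom4 x y u w = (\<Sum>a\<in>UNIV. \<Sum>b\<in>UNIV. \<Sum>c\<in>UNIV. \<Sum>d\<in>UNIV. (x $ a * y $ b * u $ c * w $ d) *
    (\<integral>v. hom v $ a * hom v $ b * hom v $ c * hom v $ d \<partial>D))"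
  unfolding mom4_def inner_product4
  by (simp add: hom_product_integrable Bochner_Integration.integrable_sum)

lemma hom_measurable [measurable]: "(\<lambda>v. hom v $ a) \<in> borel_measurable borel"
  by (cases a) (auto simp: hom_def)

text \<open>By multilinearity the form is a finite sum of coordinates of the arguments times fixed
  sample averages. The law of large numbers therefore applies although the arguments are
  random.\<close>

lemma smom4_tendsto:
  assumes "(x \<longlongrightarrow> x') (prob_filter M)" "(y \<longlongrightarrow> y') (prob_filter M)" "(u \<longlongrightarrow> u') (prob_filter M)" "(w \<longlongrightarrow> w') (prob_filter M)"
  shows "((\<lambda>T. smom4 T (x T) (y T) (u T) (w T)) \<longlongrightarrow> mom4 x' y' u' w') (prob_filter M)"
  unfolding smom4_expand mom4_expand
  by (intro tendsto_sum tendsto_mult tendsto_vec_nth assms weak_law_of_large_numbers hom_product_integrable) measurable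

lemma smom4_slot: "smom4 T x y u w = (\<Sum>a\<in>UNIV. x $ a * smom4 T (axis a 1) y u w)"
proof -
  have "(x \<bullet> hom v) * (y \<bullet> hom v) * (u \<bullet> hom v) * (w \<bullet> hom v) =
      (\<Sum>a\<in>UNIV. x $ a * ((axis a 1 \<bullet> hom v) * (y \<bullet> hom v) * (u \<bullet> hom v) * (w \<bullet> hom v)))" for v
    by (simp add: inner_axis' inner_vec_def[of x] sum_distrib_right mult.assoc)
  then show ?thesis by (simp add: smom4_def avg_sum avg_cmult)
qed

text \<open>A coordinate that occurs exactly once splits off by independence and has mean
  zero.\<close>

lemma mom4_axis_zero:
  assumes "(\<Sum>x\<leftarrow>[a, b, c, d]. if x = Some l then 1 else 0 :: nat) = 1"
  shows "mom4 (axis a 1) (axis b 1) (axis c 1) (axis d 1) = 0"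
proof -
  define e where "e k = (\<Sum>x\<leftarrow>[a, b, c, d]. if x = Some k then 1 else 0 :: nat)" for k
  have el: "e l = 1" using assms by (simp add: e_def)
  have "axis x 1 \<bullet> hom v = (\<Prod>k\<in>UNIV. (v $ k) ^ (if x = Some k then 1 else 0))" for v x
  proof (cases x)
    case (Some j)
    have "(\<Prod>k\<in>UNIV. (v $ k) ^ (if x = Some k then 1 else 0)) = (\<Prod>k\<in>UNIV. if k = j then v $ k else 1)"
      using Some by (intro prod.cong) auto
    then show ?thesis using Some by simp
  qed simp
  then have "(axis a 1 \<bullet> hom v) * (axis b 1 \<bullet> hom v) * (axis c 1 \<bullet> hom v) * (axis d 1 \<bullet> hom v) = (\<Prod>k\<in>UNIV. (v $ k) ^ e k)" for v
    by (simp add: e_def power_add prod.distrib mult.assoc)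
  moreover have "e k \<le> 6" for k by (simp add: e_def)
  ultimately have "mom4 (axis a 1) (axis b 1) (axis c 1) (axis d 1) = (\<Prod>k\<in>UNIV. \<integral>v. (v $ k) ^ e k \<partial>D)"
    using product_moment(2)[of e] by (simp add: mom4_def)
  also have "\<dots> = 0"
    by (rule prod_zero) (auto intro!: exI[of _ l] simp: el mean_component)
  finally show ?thesis .
qed

abbreviation "one_ax \<equiv> axis None 1 :: real^('p option)"
abbreviation "ax k \<equiv> axis (Some k) 1 :: real^('p option)"

text \<open>The coefficients of the linearized equations. The first slot ranges over all directions
  in which a row can be perturbed, with \<open>None\<close> the direction of the centring
  shift.\<close>

lemma mom4_values:
  "mom4 (axis a 1) one_ax one_ax one_ax = (if a = None then 1 else 0)"
  "mom4 (axis a 1) (ax k) one_ax one_ax = (if a = Some k then 1 else 0)"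
  "mom4 (axis a 1) (ax k) (ax k) one_ax = (if a = None then 1 else if a = Some k then gam D k else 0)"
  "k \<noteq> l \<Longrightarrow> mom4 (axis a 1) (ax k) (ax l) one_ax = 0"
  "mom4 (axis a 1) (ax k) (ax k) (ax k) = (if a = None then gam D k else if a = Some k then bet D k else 0)"
  "k \<noteq> l \<Longrightarrow> mom4 (axis a 1) (ax k) (ax k) (ax l) = (if a = Some l then 1 else 0)"
  subgoal
  proof (cases a)
    case None then show ?thesis using D.prob_space by (simp add: mom4_def)
  next
    case (Some j) then show ?thesis using mom4_axis_zero[of j a None None None] by simp
  qed
  subgoal
  proof (cases "a = Some k")
    case True then show ?thesis using variance_component[of k] by (simp add: mom4_def power2_eq_square)
  next
    case False then show ?thesis using mom4_axis_zero[of k a "Some k" None None] by simp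
  qed
  subgoal
  proof (cases a)
    case None then show ?thesis using variance_component[of k] by (simp add: mom4_def power2_eq_square)
  next
    case (Some j)
    then show ?thesis using mom4_axis_zero[of j a "Some k" "Some k" None]
      by (cases "j = k") (auto simp: mom4_def gam_def power3_eq_cube)
  qed
  subgoal
    using mom4_axis_zero[of l a "Some k" "Some l" None] mom4_axis_zero[of k a "Some k" "Some l" None]
    by (cases "a = Some k") auto
  subgoal
  proof (cases a)
    case None then show ?thesis by (simp add: mom4_def gam_def power3_eq_cube)
  next
    case (Some j)
    then show ?thesis using mom4_axis_zero[of j a "Some k" "Some k" "Some k"]
      by (cases "j = k") (auto simp: mom4_def bet_def power4_eq_xxxx)
  qed
  subgoal
  proof (cases "a = Some l")
    assume kl: "k \<noteq> l"
    case True
    have "mom4 (axis a 1) (ax k) (ax k) (ax l) = (\<integral>v. (v $ k)\<^sup>2 * (v $ l)\<^sup>2 \<partial>D)"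
      using True by (simp add: mom4_def power2_eq_square mult_ac)
    then show ?thesis using True product_moment2(2)[OF kl, of 2 2] by (simp add: variance_component)
  next
    assume kl: "k \<noteq> l"
    case False then show ?thesis using kl mom4_axis_zero[of l a "Some k" "Some k" "Some l"] by simp
  qed
  done

text \<open>Slots are changed from estimate to limit one at a time. By symmetry of the form each
  difference can be moved to the first slot, where \<open>slot_linearization\<close>
  applies.\<close>

lemma smom4_telescope:
  "smom4 T x one_ax one_ax one_ax = smom4 T x' one_ax one_ax one_ax + smom4 T (x - x') one_ax one_ax one_ax"
  "smom4 T x y one_ax one_ax = smom4 T x' y' one_ax one_ax + smom4 T (y - y') x one_ax one_ax + smom4 T (x - x') y' one_ax one_ax"
  "smom4 T x x y one_ax = smom4 T x' x' y' one_ax + smom4 T (y - y') x x one_ax + smom4 T (x - x') x y' one_ax + smom4 T (x - x') x' y' one_ax"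
  "smom4 T x x x y = smom4 T x' x' x' y' + smom4 T (y - y') x x x + smom4 T (x - x') x x y' + smom4 T (x - x') x x' y' + smom4 T (x - x') x' x' y'"
  unfolding smom4_def avg_add[symmetric]
  by (rule arg_cong2[where f = avg]; simp add: fun_eq_iff inner_diff_left algebra_simps)+

end

lemma sum_UNIV_option: "(\<Sum>a\<in>UNIV. f a) = f None + (\<Sum>j\<in>UNIV. f (Some j))" for f :: "'p::finite option \<Rightarrow> real"
  by (simp add: UNIV_option_conv sum.reindex)

lemma sum_option_values:
  fixes x :: "'p::finite option \<Rightarrow> real"
  shows "(\<Sum>a\<in>UNIV. x a * (if a = None then c else if a = Some k then e else 0)) = x None * c + x (Some k) * e"
    "(\<Sum>a\<in>UNIV. x a * (if a = Some k then e else 0)) = x (Some k) * e"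
  by (simp_all add: sum_UNIV_option if_distrib[of "(*) _"] cong: if_cong)

lemma smallo_cmult: "f \<in> o[F](g) \<Longrightarrow> (\<lambda>x. c * f x) \<in> o[F](g)" for f g :: "_ \<Rightarrow> real"
  by (cases "c = 0") auto

lemma smallo_mult_bounded:
  fixes c h g :: "_ \<Rightarrow> real"
  assumes "(c \<longlongrightarrow> 0) F" "\<And>x. \<bar>h x\<bar> \<le> g x"
  shows "(\<lambda>x. c x * h x) \<in> o[F](g)"
proof -
  have "c \<in> o[F](\<lambda>_. 1)" using assms(1) by (intro smalloI_tendsto) auto
  moreover have "h \<in> O[F](g)" using assms(2) by (intro bigoI[where c = 1]) (auto intro!: always_eventually simp: order_trans[OF _ abs_ge_self])
  ultimately have "(\<lambda>x. c x * h x) \<in> o[F](\<lambda>x. 1 * g x)" by (rule landau_o.small_big_mult)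
  then show ?thesis by simp
qed

text \<open>w k stands for row k of the estimate extended by its centring shift. Beyond consistency
  only two exact moment identities are required, on events of probability tending to one.\<close>

locale linearization = ica_sample M D z
  for M :: "'a measure" and D :: "(real^'p) measure" and z :: "nat \<Rightarrow> 'a \<Rightarrow> real^'p" +
  fixes w :: "'p \<Rightarrow> nat \<times> 'a \<Rightarrow> real^('p option)"
  assumes w_tendsto: "\<And>k. (w k \<longlongrightarrow> axis (Some k) 1) (prob_filter M)"
    and centered: "\<And>k. \<forall>\<^sub>F T in prob_filter M. smom4 T (w k T) one_ax one_ax one_ax = 0"
    and whitened: "\<And>k l. \<forall>\<^sub>F T in prob_filter M. smom4 T (w k T) (w l T) one_ax one_ax = (if k = l then 1 else 0)"
begin

definition root_n :: "nat \<times> 'a \<Rightarrow> real" where "root_n T = sqrt (real (fst T))"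

text \<open>The component \<open>None\<close> is the scaled shift due to centring.\<close>

definition \<Delta> :: "'p \<Rightarrow> 'p option \<Rightarrow> nat \<times> 'a \<Rightarrow> real" where
  "\<Delta> k a T = root_n T * (w k T - ax k) $ a"

text \<open>The scaled averages that appear undamped in the estimating equations. They are included
  so that their product with a vanishing coefficient is negligible.\<close>

definition moment_noise :: "nat \<times> 'a \<Rightarrow> real" where
  "moment_noise T = (\<Sum>k\<in>UNIV. \<Sum>l\<in>UNIV - {k}. \<bar>root_n T * avg (\<lambda>v. (v $ k)\<^sup>2 * v $ l) T\<bar> + \<bar>root_n T * avg (\<lambda>v. (v $ k) ^ 3 * v $ l) T\<bar>)"

text \<open>Terms that are of smaller order than \<open>error_scale\<close> can be neglected: \<open>error_scale\<close> contains the error itself, so no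
  rate of convergence has to be known in advance.\<close>

definition error_scale :: "nat \<times> 'a \<Rightarrow> real" where
  "error_scale T = (\<Sum>k\<in>UNIV. \<Sum>a\<in>UNIV. \<bar>\<Delta> k a T\<bar>) + moment_noise T"

lemma \<Delta>_le_error_scale: "\<bar>\<Delta> k a T\<bar> \<le> error_scale T"
proof -
  have "\<bar>\<Delta> k a T\<bar> \<le> (\<Sum>a\<in>UNIV. \<bar>\<Delta> k a T\<bar>)" by (rule member_le_sum) auto
  also have "\<dots> \<le> (\<Sum>k\<in>UNIV. \<Sum>a\<in>UNIV. \<bar>\<Delta> k a T\<bar>)"
    by (rule member_le_sum[of k UNIV "\<lambda>k. \<Sum>a\<in>UNIV. \<bar>\<Delta> k a T\<bar>"]) (auto intro: sum_nonneg)
  also have "\<dots> \<le> error_scale T" by (simp add: error_scale_def moment_noise_def sum_nonneg)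
  finally show ?thesis .
qed

lemma moment_noise_le_error_scale:
  assumes "k \<noteq> l"
  shows "\<bar>root_n T * avg (\<lambda>v. (v $ k)\<^sup>2 * v $ l) T\<bar> \<le> error_scale T" "\<bar>root_n T * avg (\<lambda>v. (v $ k) ^ 3 * v $ l) T\<bar> \<le> error_scale T"
proof -
  let ?s = "\<lambda>k l. \<bar>root_n T * avg (\<lambda>v. (v $ k)\<^sup>2 * v $ l) T\<bar> + \<bar>root_n T * avg (\<lambda>v. (v $ k) ^ 3 * v $ l) T\<bar>"
  have "?s k l \<le> (\<Sum>l\<in>UNIV - {k}. ?s k l)" using assms by (intro member_le_sum) auto
  also have "\<dots> \<le> moment_noise T"
    unfolding moment_noise_def by (rule member_le_sum[of k UNIV "\<lambda>k. \<Sum>l\<in>UNIV - {k}. ?s k l"]) (auto intro: sum_nonneg)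
  also have "\<dots> \<le> error_scale T" by (simp add: error_scale_def sum_nonneg)
  finally show "\<bar>root_n T * avg (\<lambda>v. (v $ k)\<^sup>2 * v $ l) T\<bar> \<le> error_scale T" "\<bar>root_n T * avg (\<lambda>v. (v $ k) ^ 3 * v $ l) T\<bar> \<le> error_scale T"
    by auto
qed

text \<open>The remainder is exactly the sum over a of \<Delta> times the difference between an
  empirical coefficient and its limit. These differences tend to 0 in probability as soon as the
  other slots converge.\<close>

lemma slot_linearization:
  assumes "(y \<longlongrightarrow> y') (prob_filter M)" "(u \<longlongrightarrow> u') (prob_filter M)" "(x \<longlongrightarrow> x') (prob_filter M)"
  shows "(\<lambda>T. root_n T * smom4 T (w k T - ax k) (y T) (u T) (x T) - (\<Sum>a\<in>UNIV. \<Delta> k a T * mom4 (axis a 1) y' u' x')) \<in> o[prob_filter M](error_scale)"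
proof -
  have "root_n T * smom4 T (w k T - ax k) (y T) (u T) (x T) - (\<Sum>a\<in>UNIV. \<Delta> k a T * mom4 (axis a 1) y' u' x') =
      (\<Sum>a\<in>UNIV. (smom4 T (axis a 1) (y T) (u T) (x T) - mom4 (axis a 1) y' u' x') * \<Delta> k a T)" for T
    unfolding smom4_slot[of T "w k T - ax k"] \<Delta>_def
    by (simp add: sum_distrib_left algebra_simps flip: sum_subtractf)
  moreover have "(\<lambda>T. \<Sum>a\<in>UNIV. (smom4 T (axis a 1) (y T) (u T) (x T) - mom4 (axis a 1) y' u' x') * \<Delta> k a T) \<in> o[prob_filter M](error_scale)"
  proof (intro big_sum_in_smallo smallo_mult_bounded \<Delta>_le_error_scale)
    fix a
    show "((\<lambda>T. smom4 T (axis a 1) (y T) (u T) (x T) - mom4 (axis a 1) y' u' x') \<longlongrightarrow> 0) (prob_filter M)"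
      using smom4_tendsto[OF tendsto_const assms, of "axis a 1"] by (simp add: LIM_zero)
  qed
  ultimately show ?thesis by simp
qed

lemma smallo_eventually_cong:
  assumes "f \<in> o[prob_filter M](error_scale)" "\<forall>\<^sub>F T in prob_filter M. f T = f' T"
  shows "f' \<in> o[prob_filter M](error_scale)"
  using assms landau_o.small.in_cong by blast

lemma centering_expansion:
  "(\<lambda>T. \<Delta> k None T + root_n T * avg (\<lambda>v. v $ k) T) \<in> o[prob_filter M](error_scale)"
proof -
  have s: "(\<lambda>T. root_n T * smom4 T (w k T - ax k) one_ax one_ax one_ax - \<Delta> k None T) \<in> o[prob_filter M](error_scale)"
    using slot_linearization[OF tendsto_const tendsto_const tendsto_const, of k one_ax one_ax one_ax]
    by (simp add: mom4_values sum_UNIV_option)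
  have "\<forall>\<^sub>F T in prob_filter M. (-1) * (root_n T * smom4 T (w k T - ax k) one_ax one_ax one_ax - \<Delta> k None T) = \<Delta> k None T + root_n T * avg (\<lambda>v. v $ k) T"
    using centered[of k]
  proof eventually_elim
    case (elim T)
    have "smom4 T (ax k) one_ax one_ax one_ax = avg (\<lambda>v. v $ k) T" by (simp add: smom4_def)
    then have "smom4 T (w k T - ax k) one_ax one_ax one_ax = - avg (\<lambda>v. v $ k) T"
      using elim smom4_telescope(1)[of T "w k T" "ax k"] by simp
    then show ?case by simp
  qed
  from smallo_eventually_cong[OF smallo_cmult[OF s] this] show ?thesis .
qed

lemma whitening_expansion:
  "(\<lambda>T. \<Delta> l (Some k) T + \<Delta> k (Some l) T + root_n T * (avg (\<lambda>v. v $ k * v $ l) T - (if k = l then 1 else 0))) \<in> o[prob_filter M](error_scale)"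
proof -
  have s1: "(\<lambda>T. root_n T * smom4 T (w l T - ax l) (w k T) one_ax one_ax - \<Delta> l (Some k) T) \<in> o[prob_filter M](error_scale)"
    using slot_linearization[OF w_tendsto[of k] tendsto_const tendsto_const, of l one_ax one_ax]
    by (simp add: mom4_values sum_UNIV_option if_distrib cong: if_cong)
  have s2: "(\<lambda>T. root_n T * smom4 T (w k T - ax k) (ax l) one_ax one_ax - \<Delta> k (Some l) T) \<in> o[prob_filter M](error_scale)"
    using slot_linearization[OF tendsto_const tendsto_const tendsto_const, of k "ax l" one_ax one_ax]
    by (simp add: mom4_values sum_UNIV_option if_distrib cong: if_cong)
  have "\<forall>\<^sub>F T in prob_filter M. (-1) * ((root_n T * smom4 T (w l T - ax l) (w k T) one_ax one_ax - \<Delta> l (Some k) T) + (root_n T * smom4 T (w k T - ax k) (ax l) one_ax one_ax - \<Delta> k (Some l) T))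
     = \<Delta> l (Some k) T + \<Delta> k (Some l) T + root_n T * (avg (\<lambda>v. v $ k * v $ l) T - (if k = l then 1 else 0))"
    using whitened[of k l]
  proof eventually_elim
    case (elim T)
    have "smom4 T (ax k) (ax l) one_ax one_ax = avg (\<lambda>v. v $ k * v $ l) T" by (simp add: smom4_def)
    then have "smom4 T (w l T - ax l) (w k T) one_ax one_ax + smom4 T (w k T - ax k) (ax l) one_ax one_ax = (if k = l then 1 else 0) - avg (\<lambda>v. v $ k * v $ l) T"
      using elim smom4_telescope(2)[of T "w k T" "w l T" "ax k" "ax l"] by simp
    from arg_cong[OF this, of "\<lambda>x. root_n T * x"] show ?case
      unfolding distrib_left right_diff_distrib by linarith
  qed
  from smallo_eventually_cong[OF smallo_cmult[OF sum_in_smallo(1)[OF s1 s2]] this] show ?thesis .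
qed

text \<open>The three expansions determine \<open>\<Delta> k (Some l)\<close> up to a remainder of smaller order, because
  the coefficient of \<open>\<Delta> l (Some k)\<close> in the estimating equation exceeds that of \<open>\<Delta> k (Some l)\<close> by \<open>d\<close>.\<close>

lemma estimating_expansion:
  assumes kl: "k \<noteq> l"
    and est: "\<forall>\<^sub>F T in prob_filter M. 3 * \<alpha> * smom4 T (w k T) (w k T) (w k T) one_ax * smom4 T (w k T) (w k T) (w l T) one_ax
      + 4 * (1 - \<alpha>) * (smom4 T (w k T) (w k T) (w k T) (w k T) - 3) * smom4 T (w k T) (w k T) (w k T) (w l T) = 0"
    and d: "d = 3 * \<alpha> * (gam D k)\<^sup>2 + 4 * (1 - \<alpha>) * (kap D k)\<^sup>2" "d \<noteq> 0"
    and ab: "a = 3 * \<alpha> * gam D k" "b = 4 * (1 - \<alpha>) * kap D k"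
  shows "(\<lambda>T. \<Delta> k (Some l) T - root_n T * avg (\<lambda>v. (a * ((v $ k)\<^sup>2 - 1 - gam D k * v $ k)
      + b * ((v $ k) ^ 3 - gam D k - bet D k * v $ k)) / d * v $ l) T) \<in> o[prob_filter M](error_scale)"
proof -
  define p where "p T = root_n T * avg (\<lambda>v. (v $ k)\<^sup>2 * v $ l) T" for T
  define q where "q T = root_n T * avg (\<lambda>v. (v $ k) ^ 3 * v $ l) T" for T
  define m where "m T = root_n T * avg (\<lambda>v. v $ l) T" for T
  define c where "c T = root_n T * avg (\<lambda>v. v $ k * v $ l) T" for T
  define P where "P T = root_n T * smom4 T (w k T) (w k T) (w l T) one_ax" for T
  define Q where "Q T = root_n T * smom4 T (w k T) (w k T) (w k T) (w l T)" for T
  note wk = w_tendsto[of k] and wl = w_tendsto[of l]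
  have f1: "(\<lambda>T. \<Delta> l None T + m T) \<in> o[prob_filter M](error_scale)"
    unfolding m_def by (rule centering_expansion)
  have f2: "(\<lambda>T. \<Delta> l (Some k) T + \<Delta> k (Some l) T + c T) \<in> o[prob_filter M](error_scale)"
    using whitening_expansion[of l k] kl by (simp add: c_def)
  have f3: "(\<lambda>T. P T - (p T + \<Delta> l None T + gam D k * \<Delta> l (Some k) T)) \<in> o[prob_filter M](error_scale)"
  proof -
    have s1: "(\<lambda>T. root_n T * smom4 T (w l T - ax l) (w k T) (w k T) one_ax - (\<Delta> l None T + gam D k * \<Delta> l (Some k) T)) \<in> o[prob_filter M](error_scale)"
      using slot_linearization[OF wk wk tendsto_const, of l one_ax]
      by (simp add: mom4_values sum_option_values mult.commute)
    have s2: "(\<lambda>T. root_n T * smom4 T (w k T - ax k) (w k T) (ax l) one_ax) \<in> o[prob_filter M](error_scale)"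
      using slot_linearization[OF wk tendsto_const tendsto_const, of k "ax l" one_ax] by (simp add: mom4_values kl)
    have s3: "(\<lambda>T. root_n T * smom4 T (w k T - ax k) (ax k) (ax l) one_ax) \<in> o[prob_filter M](error_scale)"
      using slot_linearization[OF tendsto_const tendsto_const tendsto_const, of k "ax k" "ax l" one_ax] by (simp add: mom4_values kl)
    have eq: "(root_n T * smom4 T (w l T - ax l) (w k T) (w k T) one_ax - (\<Delta> l None T + gam D k * \<Delta> l (Some k) T))
       + root_n T * smom4 T (w k T - ax k) (w k T) (ax l) one_ax + root_n T * smom4 T (w k T - ax k) (ax k) (ax l) one_ax
       = P T - (p T + \<Delta> l None T + gam D k * \<Delta> l (Some k) T)" for T
    proof -
      have "smom4 T (ax k) (ax k) (ax l) one_ax = avg (\<lambda>v. (v $ k)\<^sup>2 * v $ l) T" by (simp add: smom4_def power2_eq_square)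
      then show ?thesis unfolding P_def p_def smom4_telescope(3)[of T "w k T" "w l T" "ax k" "ax l"]
        by (simp add: distrib_left)
    qed
    from sum_in_smallo(1)[OF sum_in_smallo(1)[OF s1 s2] s3] show ?thesis by (simp only: eq)
  qed
  \<comment> \<open>Each of the three slots where w k is exchanged for its limit contributes one
    \<Delta> k (Some l), with coefficient E(v_k^2 v_l^2) = 1. The corresponding terms of the third
    moment vanish in \<open>f3\<close>.\<close>
  have f4: "(\<lambda>T. Q T - (q T + gam D k * \<Delta> l None T + bet D k * \<Delta> l (Some k) T + 3 * \<Delta> k (Some l) T)) \<in> o[prob_filter M](error_scale)"
  proof -
    have s1: "(\<lambda>T. root_n T * smom4 T (w l T - ax l) (w k T) (w k T) (w k T) - (gam D k * \<Delta> l None T + bet D k * \<Delta> l (Some k) T)) \<in> o[prob_filter M](error_scale)"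
      using slot_linearization[OF wk wk wk, of l]
      by (simp add: mom4_values sum_option_values mult.commute)
    have s2: "(\<lambda>T. root_n T * smom4 T (w k T - ax k) (w k T) (w k T) (ax l) - \<Delta> k (Some l) T) \<in> o[prob_filter M](error_scale)"
      using slot_linearization[OF wk wk tendsto_const, of k "ax l"]
      by (simp add: mom4_values kl sum_option_values)
    have s3: "(\<lambda>T. root_n T * smom4 T (w k T - ax k) (w k T) (ax k) (ax l) - \<Delta> k (Some l) T) \<in> o[prob_filter M](error_scale)"
      using slot_linearization[OF wk tendsto_const tendsto_const, of k "ax k" "ax l"]
      by (simp add: mom4_values kl sum_option_values)
    have s4: "(\<lambda>T. root_n T * smom4 T (w k T - ax k) (ax k) (ax k) (ax l) - \<Delta> k (Some l) T) \<in> o[prob_filter M](error_scale)"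
      using slot_linearization[OF tendsto_const tendsto_const tendsto_const, of k "ax k" "ax k" "ax l"]
      by (simp add: mom4_values kl sum_option_values)
    have eq: "(root_n T * smom4 T (w l T - ax l) (w k T) (w k T) (w k T) - (gam D k * \<Delta> l None T + bet D k * \<Delta> l (Some k) T))
       + (root_n T * smom4 T (w k T - ax k) (w k T) (w k T) (ax l) - \<Delta> k (Some l) T)
       + (root_n T * smom4 T (w k T - ax k) (w k T) (ax k) (ax l) - \<Delta> k (Some l) T)
       + (root_n T * smom4 T (w k T - ax k) (ax k) (ax k) (ax l) - \<Delta> k (Some l) T)
       = Q T - (q T + gam D k * \<Delta> l None T + bet D k * \<Delta> l (Some k) T + 3 * \<Delta> k (Some l) T)" for T
    proof -
      have "smom4 T (ax k) (ax k) (ax k) (ax l) = avg (\<lambda>v. (v $ k) ^ 3 * v $ l) T" by (simp add: smom4_def power3_eq_cube)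
      then show ?thesis unfolding Q_def q_def smom4_telescope(4)[of T "w k T" "w l T" "ax k" "ax l"]
        by (simp add: distrib_left)
    qed
    from sum_in_smallo(1)[OF sum_in_smallo(1)[OF sum_in_smallo(1)[OF s1 s2] s3] s4] show ?thesis by (simp only: eq)
  qed
  \<comment> \<open>The estimating equation has random leading factors with limits a and b. Their
    deviations are o(1), while P and Q are bounded by multiples of \<open>error_scale\<close> up to
    smaller terms, so the limits may be substituted.\<close>
  have f5: "(\<lambda>T. a * P T + b * Q T) \<in> o[prob_filter M](error_scale)"
  proof -
    let ?G = "\<lambda>T. 3 * \<alpha> * (smom4 T (w k T) (w k T) (w k T) one_ax - gam D k)"
    let ?H = "\<lambda>T. 4 * (1 - \<alpha>) * (smom4 T (w k T) (w k T) (w k T) (w k T) - 3 - kap D k)"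
    have "((\<lambda>T. smom4 T (w k T) (w k T) (w k T) one_ax) \<longlongrightarrow> gam D k) (prob_filter M)"
      using smom4_tendsto[OF wk wk wk tendsto_const, of one_ax] by (simp add: mom4_values)
    then have G: "(?G \<longlongrightarrow> 0) (prob_filter M)" by (intro tendsto_mult_right_zero LIM_zero)
    have "((\<lambda>T. smom4 T (w k T) (w k T) (w k T) (w k T) - 3) \<longlongrightarrow> kap D k) (prob_filter M)"
      using tendsto_diff[OF smom4_tendsto[OF wk wk wk wk] tendsto_const[of 3]] by (simp add: mom4_values kap_def)
    then have H: "(?H \<longlongrightarrow> 0) (prob_filter M)" by (intro tendsto_mult_right_zero LIM_zero)
    have small: "(\<lambda>T. c T * f T) \<in> o[prob_filter M](error_scale)"
      if "f \<in> o[prob_filter M](error_scale)" "(c \<longlongrightarrow> 0) (prob_filter M)" for f c :: "nat \<times> 'a \<Rightarrow> real"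
    proof -
      have "c \<in> o[prob_filter M](\<lambda>_. 1)" using that(2) by (intro smalloI_tendsto) auto
      from landau_o.small.mult[OF this that(1)] show ?thesis by simp
    qed
    note bd = smallo_mult_bounded[where g = error_scale]
    have gP: "(\<lambda>T. ?G T * P T) \<in> o[prob_filter M](error_scale)"
    proof -
      have "(\<lambda>T. ?G T * (P T - (p T + \<Delta> l None T + gam D k * \<Delta> l (Some k) T)) +
         (?G T * p T + ?G T * \<Delta> l None T + gam D k * (?G T * \<Delta> l (Some k) T))) \<in> o[prob_filter M](error_scale)"
        unfolding p_def
        by (intro sum_in_smallo(1) smallo_cmult small[OF f3[unfolded p_def] G] bd[OF G] \<Delta>_le_error_scale moment_noise_le_error_scale kl)
      then show ?thesis by (simp add: algebra_simps)
    qed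
    have hQ: "(\<lambda>T. ?H T * Q T) \<in> o[prob_filter M](error_scale)"
    proof -
      have "(\<lambda>T. ?H T * (Q T - (q T + gam D k * \<Delta> l None T + bet D k * \<Delta> l (Some k) T + 3 * \<Delta> k (Some l) T)) +
         (?H T * q T + gam D k * (?H T * \<Delta> l None T) + bet D k * (?H T * \<Delta> l (Some k) T) + 3 * (?H T * \<Delta> k (Some l) T))) \<in> o[prob_filter M](error_scale)"
        unfolding q_def
        by (intro sum_in_smallo(1) smallo_cmult small[OF f4[unfolded q_def] H] bd[OF H] \<Delta>_le_error_scale moment_noise_le_error_scale kl)
      then show ?thesis by (simp add: algebra_simps)
    qed
    have "\<forall>\<^sub>F T in prob_filter M. (-1) * (?G T * P T + ?H T * Q T) = a * P T + b * Q T"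
      using est
    proof eventually_elim
      case (elim T)
      from arg_cong[OF this, of "\<lambda>x. root_n T * x"] show ?case
        unfolding P_def Q_def ab by (simp add: algebra_simps)
    qed
    from smallo_eventually_cong[OF smallo_cmult[OF sum_in_smallo(1)[OF gP hQ]] this] show ?thesis .
  qed
  \<comment> \<open>This combination eliminates the shift by centring and \<Delta> l (Some k) by
    whitening, leaving \<Delta> k (Some l) as the only unknown.\<close>
  have fin: "(\<lambda>T. (- 1 / d) * ((a * P T + b * Q T) - a * (P T - (p T + \<Delta> l None T + gam D k * \<Delta> l (Some k) T))
      - b * (Q T - (q T + gam D k * \<Delta> l None T + bet D k * \<Delta> l (Some k) T + 3 * \<Delta> k (Some l) T))
      - (a + b * gam D k) * (\<Delta> l None T + m T)
      - (a * gam D k + b * bet D k) * (\<Delta> l (Some k) T + \<Delta> k (Some l) T + c T))) \<in> o[prob_filter M](error_scale)"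
    by (intro smallo_cmult sum_in_smallo(2) f1 f2 f3 f4 f5)
  \<comment> \<open>Eliminating \<Delta> l (Some k) contributes a \<gamma> + b \<beta> and the three
    slots of \<open>f4\<close> subtract 3 b; this is how the kurtosis \<beta> - 3 enters the
    denominator.\<close>
  have dab: "d = a * gam D k + b * (bet D k - 3)" by (simp add: d ab kap_def power2_eq_square algebra_simps)
  have "(- 1 / d) * ((a * P T + b * Q T) - a * (P T - (p T + \<Delta> l None T + gam D k * \<Delta> l (Some k) T))
      - b * (Q T - (q T + gam D k * \<Delta> l None T + bet D k * \<Delta> l (Some k) T + 3 * \<Delta> k (Some l) T))
      - (a + b * gam D k) * (\<Delta> l None T + m T)
      - (a * gam D k + b * bet D k) * (\<Delta> l (Some k) T + \<Delta> k (Some l) T + c T)) =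
     \<Delta> k (Some l) T - root_n T * avg (\<lambda>v. (a * ((v $ k)\<^sup>2 - 1 - gam D k * v $ k)
      + b * ((v $ k) ^ 3 - gam D k - bet D k * v $ k)) / d * v $ l) T" for T
  proof -
    have "(a * ((v $ k)\<^sup>2 - 1 - gam D k * v $ k) + b * ((v $ k) ^ 3 - gam D k - bet D k * v $ k)) / d * v $ l =
       (a / d) * ((v $ k)\<^sup>2 * v $ l) + ((b / d) * ((v $ k) ^ 3 * v $ l) + ((- (a + b * gam D k) / d) * v $ l
         + (- (a * gam D k + b * bet D k) / d) * (v $ k * v $ l)))" for v :: "real^'p"
      using d(2) by (simp add: field_simps)
    then have e1: "root_n T * avg (\<lambda>v. (a * ((v $ k)\<^sup>2 - 1 - gam D k * v $ k) + b * ((v $ k) ^ 3 - gam D k - bet D k * v $ k)) / d * v $ l) T =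
      (a / d) * p T + ((b / d) * q T + ((- (a + b * gam D k) / d) * m T + (- (a * gam D k + b * bet D k) / d) * c T))"
      by (simp only: avg_add avg_cmult p_def q_def m_def c_def distrib_left mult.left_commute[of "root_n T"])
    have e2: "(- 1 / d) * ((a * P T + b * Q T) - a * (P T - (p T + \<Delta> l None T + gam D k * \<Delta> l (Some k) T))
      - b * (Q T - (q T + gam D k * \<Delta> l None T + bet D k * \<Delta> l (Some k) T + 3 * \<Delta> k (Some l) T))
      - (a + b * gam D k) * (\<Delta> l None T + m T)
      - (a * gam D k + b * bet D k) * (\<Delta> l (Some k) T + \<Delta> k (Some l) T + c T)) =
      (d * \<Delta> k (Some l) T - (a * p T + b * q T - (a + b * gam D k) * m T - (a * gam D k + b * bet D k) * c T)) / d"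
      using d(2) by (simp add: dab divide_simps) (simp add: algebra_simps)
    show ?thesis unfolding e1 e2 using d(2) by (simp add: field_simps)
  qed
  then show ?thesis using fin by simp
qed

end

definition (in prob_space) bounded_mean :: "(nat \<times> 'a \<Rightarrow> real) \<Rightarrow> bool" where
  "bounded_mean f \<longleftrightarrow> (\<exists>B. \<forall>n. integrable M (\<lambda>\<omega>. f (n, \<omega>)) \<and> expectation (\<lambda>\<omega>. \<bar>f (n, \<omega>)\<bar>) \<le> B)"

lemma (in prob_space) bounded_mean_add:
  assumes "bounded_mean f" "bounded_mean g"
  shows "bounded_mean (\<lambda>T. f T + g T)"
proof -
  obtain A B where f: "\<And>n. integrable M (\<lambda>\<omega>. f (n, \<omega>))" "\<And>n. expectation (\<lambda>\<omega>. \<bar>f (n, \<omega>)\<bar>) \<le> A"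
    and g: "\<And>n. integrable M (\<lambda>\<omega>. g (n, \<omega>))" "\<And>n. expectation (\<lambda>\<omega>. \<bar>g (n, \<omega>)\<bar>) \<le> B"
    using assms unfolding bounded_mean_def by blast
  have "expectation (\<lambda>\<omega>. \<bar>f (n, \<omega>) + g (n, \<omega>)\<bar>) \<le> A + B" for n
  proof -
    have "expectation (\<lambda>\<omega>. \<bar>f (n, \<omega>) + g (n, \<omega>)\<bar>) \<le> expectation (\<lambda>\<omega>. \<bar>f (n, \<omega>)\<bar> + \<bar>g (n, \<omega>)\<bar>)"
      using f(1) g(1) by (intro integral_mono) auto
    then show ?thesis using f[of n] g[of n] by simp
  qed
  then show ?thesis using f(1) g(1) unfolding bounded_mean_def by (intro exI[of _ "A + B"]) simp
qed

lemma (in prob_space) bounded_mean_sum: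
  assumes "\<And>i. i \<in> I \<Longrightarrow> bounded_mean (f i)"
  shows "bounded_mean (\<lambda>T. \<Sum>i\<in>I. f i T)"
proof (cases "finite I")
  case True then show ?thesis using assms
  proof (induction I rule: finite_induct)
    case empty show ?case by (simp add: bounded_mean_def) (rule exI[of _ 0], simp)
  qed (simp add: bounded_mean_add)
next
  case False then show ?thesis by (simp add: bounded_mean_def) (rule exI[of _ 0], simp)
qed

context iid_sample
begin

definition centered_L2 :: "(real^'p \<Rightarrow> real) \<Rightarrow> bool" where
  "centered_L2 h \<longleftrightarrow> h \<in> borel_measurable borel \<and> integrable D (\<lambda>v. (h v)\<^sup>2) \<and> (\<integral>v. h v \<partial>D) = 0"

lemma centered_L2_integrable: "centered_L2 h \<Longrightarrow> integrable D h"
  by (rule finite_measure.square_integrable_imp_integrable[OF prob_space.finite_measure[OF prob_space_D]])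
     (auto simp: centered_L2_def)

lemma centered_L2_add:
  assumes "centered_L2 f" "centered_L2 h"
  shows "centered_L2 (\<lambda>v. f v + h v)"
proof -
  note i = centered_L2_integrable[OF assms(1)] centered_L2_integrable[OF assms(2)]
  note a = assms[unfolded centered_L2_def]
  have [measurable]: "f \<in> borel_measurable borel" "h \<in> borel_measurable borel" using a by auto
  have "integrable D (\<lambda>v. (f v + h v)\<^sup>2)"
  proof (rule Bochner_Integration.integrable_bound)
    show "integrable D (\<lambda>v. 2 * (f v)\<^sup>2 + 2 * (h v)\<^sup>2)" using a by auto
    have "(x + y)\<^sup>2 \<le> 2 * x\<^sup>2 + 2 * y\<^sup>2" for x y :: real
      using zero_le_power2[of "x - y"] by (simp add: power2_sum power2_diff)
    then show "AE v in D. norm ((f v + h v)\<^sup>2) \<le> norm (2 * (f v)\<^sup>2 + 2 * (h v)\<^sup>2)" by simp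
  qed simp
  then show ?thesis using a i by (simp add: centered_L2_def)
qed

lemma centered_L2_cmult: "centered_L2 f \<Longrightarrow> centered_L2 (\<lambda>v. c * f v)"
  unfolding centered_L2_def by (auto simp: power_mult_distrib intro!: borel_measurable_times)

lemma centered_L2_sum: "(\<And>i. i \<in> I \<Longrightarrow> centered_L2 (f i)) \<Longrightarrow> centered_L2 (\<lambda>v. \<Sum>i\<in>I. f i v)"
proof (induction I rule: infinite_finite_induct)
  case (insert i I) then show ?case by (simp add: centered_L2_add)
qed (simp_all add: centered_L2_def)

lemma bounded_mean_scaled_avg:
  assumes "centered_L2 h"
  shows "bounded_mean (\<lambda>T. \<bar>sqrt (real (fst T)) * avg h T\<bar>)"
  using mean_scaled_avg_bound[of h] assms
  unfolding bounded_mean_def centered_L2_def by (intro exI[of _ "1 + (\<integral>v. (h v)\<^sup>2 \<partial>D)"]) simp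

end

context ica_sample
begin

text \<open>The exponent 3 is the largest whose square is controlled by the sixth moment.\<close>

lemma centered_L2_monomial:
  assumes "k \<noteq> l" "i \<le> 3"
  shows "centered_L2 (\<lambda>v. (v $ k) ^ i * v $ l)"
proof -
  have "integrable D (\<lambda>v. (v $ k) ^ (i * 2) * (v $ l)\<^sup>2)"
    using assms by (intro product_moment2) auto
  then have "integrable D (\<lambda>v. ((v $ k) ^ i * v $ l)\<^sup>2)"
    by (simp add: power_mult_distrib flip: power_mult)
  moreover have "(\<integral>v. (v $ k) ^ i * v $ l \<partial>D) = 0"
    using product_moment2(2)[OF assms(1), of i 1] assms(2) by (simp add: mean_component)
  ultimately show ?thesis by (simp add: centered_L2_def)
qed

lemma centered_L2_component: "centered_L2 (\<lambda>v. v $ k)"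
  using moment_integrable[of 2 k] by (simp add: centered_L2_def mean_component)

lemma centered_L2_square: "centered_L2 (\<lambda>v. (v $ k)\<^sup>2 - 1)"
proof -
  have "((x\<^sup>2 - 1)\<^sup>2 :: real) = x ^ 4 - 2 * x\<^sup>2 + 1" for x
    by (simp add: power2_eq_square power4_eq_xxxx algebra_simps)
  then show ?thesis using moment_integrable[of 2 k] moment_integrable[of 4 k] D.prob_space
    by (simp add: centered_L2_def variance_component)
qed

end

context linearization
begin

text \<open>Absorption: the total remainder H satisfies H = o(H + Z'), hence H = o(Z'). Now Z'
  consists of scaled averages only and is bounded in mean, so the remainder tends to 0. This yields
  the root-n rate along the way.\<close>

theorem linearization_remainder:
  assumes \<psi>: "\<And>k a. centered_L2 (\<psi> k a)"
    and approx: "\<And>k a. (\<lambda>T. \<Delta> k a T - root_n T * avg (\<psi> k a) T) \<in> o[prob_filter M](error_scale)"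
    and meas: "\<And>n k a. (\<lambda>\<omega>. w k (n, \<omega>) $ a) \<in> borel_measurable M"
  shows "((\<lambda>T. \<Delta> k a T - root_n T * avg (\<psi> k a) T) \<longlongrightarrow> 0) (prob_filter M)"
proof -
  define H where "H T = (\<Sum>k\<in>UNIV. \<Sum>a\<in>UNIV. \<bar>\<Delta> k a T - root_n T * avg (\<psi> k a) T\<bar>)" for T
  define Z' where "Z' T = (\<Sum>k\<in>UNIV. \<Sum>a\<in>UNIV. \<bar>root_n T * avg (\<psi> k a) T\<bar>) + moment_noise T" for T
  have Hg: "H \<in> o[prob_filter M](error_scale)"
    unfolding H_def by (intro big_sum_in_smallo) (use approx in simp)
  have gle: "error_scale T \<le> H T + Z' T" for T
  proof -
    have "(\<Sum>k\<in>UNIV. \<Sum>a\<in>UNIV. \<bar>\<Delta> k a T\<bar>) \<le> (\<Sum>k\<in>UNIV. \<Sum>a\<in>UNIV. \<bar>\<Delta> k a T - root_n T * avg (\<psi> k a) T\<bar> + \<bar>root_n T * avg (\<psi> k a) T\<bar>)"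
      by (intro sum_mono) simp
    then show ?thesis by (simp add: error_scale_def H_def Z'_def sum.distrib)
  qed
  have H0: "0 \<le> H T" and Z'0: "0 \<le> Z' T" and g0: "0 \<le> error_scale T" for T
    by (simp_all add: H_def Z'_def moment_noise_def error_scale_def sum_nonneg)
  \<comment> \<open>The constant c / (1 + c) is the one for which H \<le> (c / (1 + c)) (H + Z')
    rearranges to H \<le> c Z'.\<close>
  have HZ: "H \<in> o[prob_filter M](Z')"
  proof (rule landau_o.smallI)
    fix c :: real assume c: "c > 0"
    have "\<forall>\<^sub>F T in prob_filter M. norm (H T) \<le> (c / (1 + c)) * norm (error_scale T)"
      using Hg c by (intro landau_o.smallD) auto
    then show "\<forall>\<^sub>F T in prob_filter M. norm (H T) \<le> c * norm (Z' T)"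
    proof eventually_elim
      case (elim T)
      have "(1 + c) * H T \<le> c * error_scale T" using elim c H0[of T] g0[of T] by (simp add: field_simps)
      also have "\<dots> \<le> c * (H T + Z' T)" using gle[of T] c by (intro mult_left_mono) auto
      finally have "H T \<le> c * Z' T" by (simp add: algebra_simps)
      then show ?case using H0[of T] Z'0[of T] by simp
    qed
  qed
  have one: "(\<lambda>T. \<Delta> k a T - root_n T * avg (\<psi> k a) T) \<in> o[prob_filter M](Z')"
  proof (rule landau_o.big_small_trans[OF _ HZ], rule bigoI[where c = 1], rule always_eventually, rule allI)
    fix T
    have "\<bar>\<Delta> k a T - root_n T * avg (\<psi> k a) T\<bar> \<le> (\<Sum>a\<in>UNIV. \<bar>\<Delta> k a T - root_n T * avg (\<psi> k a) T\<bar>)"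
      by (rule member_le_sum[of a UNIV "\<lambda>a. \<bar>\<Delta> k a T - root_n T * avg (\<psi> k a) T\<bar>"]) auto
    also have "\<dots> \<le> H T"
      unfolding H_def by (rule member_le_sum[of k UNIV "\<lambda>k. \<Sum>a\<in>UNIV. \<bar>\<Delta> k a T - root_n T * avg (\<psi> k a) T\<bar>"]) (auto intro: sum_nonneg)
    finally show "norm (\<Delta> k a T - root_n T * avg (\<psi> k a) T) \<le> 1 * norm (H T)" using H0[of T] by simp
  qed
  have "bounded_mean Z'"
    unfolding Z'_def moment_noise_def root_n_def
    using centered_L2_monomial[of _ _ 2] centered_L2_monomial[of _ _ 3]
    by (intro bounded_mean_add bounded_mean_sum bounded_mean_scaled_avg \<psi>) auto
  then obtain B where "\<forall>n. integrable M (\<lambda>\<omega>. Z' (n, \<omega>)) \<and> expectation (\<lambda>\<omega>. \<bar>Z' (n, \<omega>)\<bar>) \<le> B"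
    unfolding bounded_mean_def by blast
  then have B: "integrable M (\<lambda>\<omega>. \<bar>Z' (n, \<omega>)\<bar>)" "expectation (\<lambda>\<omega>. \<bar>Z' (n, \<omega>)\<bar>) \<le> B" for n
    by auto
  show ?thesis
  proof (rule smallo_bounded_mean_tendsto[OF one _ B])
    fix n
    have [measurable]: "\<psi> k a \<in> borel_measurable borel" using \<psi> by (simp add: centered_L2_def)
    note [measurable] = meas[of k n a]
    show "(\<lambda>\<omega>. \<Delta> k a (n, \<omega>) - root_n (n, \<omega>) * avg (\<psi> k a) (n, \<omega>)) \<in> borel_measurable M"
      by (simp add: \<Delta>_def root_n_def)
  qed
qed

end

section \<open>Consistency of the sample moments\<close>

lemma borel_measurable_vec:
  fixes f :: "'a \<Rightarrow> 'b::euclidean_space^'n"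
  assumes [measurable]: "\<And>i. (\<lambda>x. f x $ i) \<in> borel_measurable M"
  shows "f \<in> borel_measurable M"
  by (subst borel_measurable_euclidean_space) (simp add: inner_vec_def)

lemma borel_measurable_vec_nth:
  fixes f :: "'a \<Rightarrow> 'b::euclidean_space^'n"
  assumes "f \<in> borel_measurable M"
  shows "(\<lambda>x. f x $ i) \<in> borel_measurable M"
  using measurable_compose[OF assms borel_measurable_continuous_onI[OF linear_continuous_on[OF bounded_linear_vec_nth]]] .

lemma positive_definite_borel: "{S :: real^'n^'n. positive_definite S} \<in> sets borel"
proof -
  have "closed {S :: real^'n^'n. \<forall>i j. S $ i $ j = S $ j $ i}"
    by (intro closed_Collect_all closed_Collect_eq continuous_intros)
  moreover have "closed {S :: real^'n^'n. \<forall>v. 0 \<le> (\<Sum>i\<in>UNIV. \<Sum>j\<in>UNIV. v $ i * (S $ i $ j * v $ j))}"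
    by (intro closed_Collect_all closed_Collect_le continuous_intros)
  moreover have "open {S :: real^'n^'n. det S \<noteq> 0}"
    unfolding det_def by (intro open_Collect_neq continuous_intros)
  ultimately have "{S :: real^'n^'n. \<forall>i j. S $ i $ j = S $ j $ i} \<inter>
      {S. \<forall>v. 0 \<le> (\<Sum>i\<in>UNIV. \<Sum>j\<in>UNIV. v $ i * (S $ i $ j * v $ j))} \<inter> {S. det S \<noteq> 0} \<in> sets borel"
    by auto
  also have "{S :: real^'n^'n. \<forall>i j. S $ i $ j = S $ j $ i} \<inter>
      {S. \<forall>v. 0 \<le> (\<Sum>i\<in>UNIV. \<Sum>j\<in>UNIV. v $ i * (S $ i $ j * v $ j))} \<inter> {S. det S \<noteq> 0} = {S. positive_definite S}"
    by (auto simp: positive_definite_iff invertible_det_nz transpose_def vec_eq_iff inner_vec_def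
        matrix_vector_mult_def sum_distrib_left)
  finally show ?thesis .
qed

context ica_sample
begin

definition sample_mean :: "nat \<times> 'a \<Rightarrow> real^'p" where
  "sample_mean T = mean_vector (empirical (fst T) (\<lambda>i. z i (snd T)))"

definition sample_cov :: "nat \<times> 'a \<Rightarrow> real^'p^'p" where
  "sample_cov T = covariance_matrix (empirical (fst T) (\<lambda>i. z i (snd T)))"

text \<open>The default \<open>mat 1\<close> makes the standardized data defined and measurable at
  every sample point; the event where it is used has probability tending to zero.\<close>

definition sample_isqrt :: "nat \<times> 'a \<Rightarrow> real^'p^'p" where
  "sample_isqrt T = (if positive_definite (sample_cov T) then inv_sqrt (sample_cov T) else mat 1)"

definition std :: "nat \<times> 'a \<Rightarrow> nat \<Rightarrow> real^'p" where
  "std T i = sample_isqrt T *v (z i (snd T) - sample_mean T)"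

lemma positive_definite_sample_cov: "positive_definite (sample_cov T) \<longleftrightarrow> invertible (sample_cov T)"
  unfolding sample_cov_def by (rule positive_definite_empirical_iff)

lemma sample_mean_nth: "sample_mean T $ k = avg (\<lambda>v. v $ k) T"
  by (simp add: sample_mean_def mean_vector_empirical avg_def divide_inverse mult.commute)

lemma sum_product_shift:
  "(\<Sum>i<n. (x i - A) * (y i - B)) = (\<Sum>i<n. x i * y i) - B * (\<Sum>i<n. x i) - A * (\<Sum>i<n. y i) + real n * A * B"
  for x y :: "nat \<Rightarrow> real"
  by (induction n) (simp_all add: algebra_simps)

lemma sample_cov_nth: "fst T > 0 \<Longrightarrow> sample_cov T $ k $ l = avg (\<lambda>v. v $ k * v $ l) T - avg (\<lambda>v. v $ k) T * avg (\<lambda>v. v $ l) T"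
  by (simp add: sample_cov_def covariance_matrix_empirical sample_mean_def[symmetric] sample_mean_nth avg_def sum_product_shift)
    (simp add: field_simps)

lemma transpose_sample_isqrt: "transpose (sample_isqrt T) = sample_isqrt T"
  using inv_sqrt_works(1)[of "sample_cov T"] by (simp add: sample_isqrt_def positive_definite_def)

lemma sample_mean_measurable [measurable]: "(\<lambda>\<omega>. sample_mean (n, \<omega>)) \<in> borel_measurable M"
  by (rule borel_measurable_vec) (simp add: sample_mean_nth)

lemma sample_cov_measurable [measurable]: "(\<lambda>\<omega>. sample_cov (n, \<omega>)) \<in> borel_measurable M"
proof (intro borel_measurable_vec)
  fix k l
  show "(\<lambda>\<omega>. sample_cov (n, \<omega>) $ k $ l) \<in> borel_measurable M"
  proof (cases "n = 0")
    case True then show ?thesis by (simp add: sample_cov_def covariance_matrix_empirical)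
  next
    case False then show ?thesis by (simp add: sample_cov_nth)
  qed
qed

lemma sample_isqrt_measurable [measurable]: "(\<lambda>\<omega>. sample_isqrt (n, \<omega>)) \<in> borel_measurable M"
proof -
  have "(\<lambda>S :: real^'p^'p. if S \<in> {S. positive_definite S} then inv_sqrt S else mat 1) \<in> borel_measurable borel"
    by (rule borel_measurable_continuous_on_if[OF positive_definite_borel continuous_on_inv_sqrt continuous_on_const])
  from measurable_compose[OF sample_cov_measurable this] show ?thesis by (simp add: sample_isqrt_def)
qed

lemma std_measurable [measurable]: "(\<lambda>\<omega>. std (n, \<omega>) i $ k) \<in> borel_measurable M"
proof -
  have [measurable]: "(\<lambda>\<omega>. sample_isqrt (n, \<omega>) $ k $ l) \<in> borel_measurable M" "(\<lambda>\<omega>. sample_mean (n, \<omega>) $ l) \<in> borel_measurable M"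
    "(\<lambda>\<omega>. z i \<omega> $ l) \<in> borel_measurable M" for l
    by (intro borel_measurable_vec_nth; measurable)+
  show ?thesis by (simp add: std_def matrix_vector_mult_def)
qed

lemma caratheodory_empirical_index: "caratheodory M (\<lambda>\<omega>. empirical_index \<alpha> n (std (n, \<omega>)))"
  unfolding caratheodory_def empirical_index_def
proof (intro conjI ballI allI)
  show "(\<lambda>\<omega>. \<alpha> * ((\<Sum>i<n. (u \<bullet> std (n, \<omega>) i) ^ 3) / real n)\<^sup>2 + (1 - \<alpha>) * ((\<Sum>i<n. (u \<bullet> std (n, \<omega>) i) ^ 4) / real n - 3)\<^sup>2)
     \<in> borel_measurable M" for u
    by (simp add: inner_vec_def)
qed (cases "n = 0"; auto intro!: continuous_intros)

lemma eventually_pos: "\<forall>\<^sub>F T in prob_filter M. fst T > 0"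
  using eventually_prob_filter_sequentially[OF eventually_gt_at_top[of 0]] .

lemma avg_component_tendsto: "(avg (\<lambda>v. v $ k) \<longlongrightarrow> 0) (prob_filter M)"
  using weak_law_of_large_numbers[of "\<lambda>v. v $ k"] moment_integrable[of 1 k] by (simp add: mean_component)

lemma sample_mean_tendsto: "(sample_mean \<longlongrightarrow> 0) (prob_filter M)"
  by (rule vec_tendstoI) (simp add: sample_mean_nth avg_component_tendsto)

lemma sample_cov_tendsto: "(sample_cov \<longlongrightarrow> mat 1) (prob_filter M)"
proof (intro vec_tendstoI)
  fix k l
  have "((\<lambda>T. smom4 T (ax k) (ax l) one_ax one_ax) \<longlongrightarrow> mom4 (ax k) (ax l) one_ax one_ax) (prob_filter M)"
    by (intro smom4_tendsto tendsto_const)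
  then have "(avg (\<lambda>v. v $ k * v $ l) \<longlongrightarrow> mat 1 $ k $ l) (prob_filter M)"
    by (simp add: smom4_def mom4_values mat_def)
  from tendsto_diff[OF this tendsto_mult[OF avg_component_tendsto[of k] avg_component_tendsto[of l]]]
  have "((\<lambda>T. avg (\<lambda>v. v $ k * v $ l) T - avg (\<lambda>v. v $ k) T * avg (\<lambda>v. v $ l) T) \<longlongrightarrow> mat 1 $ k $ l) (prob_filter M)" by simp
  then show "((\<lambda>T. sample_cov T $ k $ l) \<longlongrightarrow> mat 1 $ k $ l) (prob_filter M)"
    by (rule Lim_transform_eventually) (use eventually_pos in eventually_elim, simp add: sample_cov_nth)
qed

text \<open>The determinant is continuous and nonzero at the limit \<open>mat 1\<close>;
  semidefiniteness holds at every sample point.\<close>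

lemma eventually_positive_definite: "\<forall>\<^sub>F T in prob_filter M. positive_definite (sample_cov T)"
proof -
  have "((\<lambda>T. det (sample_cov T)) \<longlongrightarrow> det (mat 1 :: real^'p^'p)) (prob_filter M)"
    unfolding det_def by (intro tendsto_intros tendsto_vec_nth sample_cov_tendsto)
  then have "\<forall>\<^sub>F T in prob_filter M. det (sample_cov T) \<noteq> 0"
    by (intro tendsto_imp_eventually_ne) auto
  then show ?thesis
    by eventually_elim (simp add: positive_definite_sample_cov invertible_det_nz)
qed

lemma sample_isqrt_tendsto: "(sample_isqrt \<longlongrightarrow> mat 1) (prob_filter M)"
proof -
  have "((\<lambda>T. inv_sqrt (sample_cov T)) \<longlongrightarrow> inv_sqrt (mat 1)) (prob_filter M)"
    by (rule continuous_on_tendsto_compose[OF continuous_on_inv_sqrt sample_cov_tendsto])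
       (use eventually_positive_definite positive_definite_mat_1 in auto)
  then have "((\<lambda>T. inv_sqrt (sample_cov T)) \<longlongrightarrow> mat 1) (prob_filter M)" by (simp add: inv_sqrt_mat_1)
  then show ?thesis
    by (rule Lim_transform_eventually) (use eventually_positive_definite in eventually_elim, simp add: sample_isqrt_def)
qed

lemma hom_nth: "hom v $ None = 1" "hom v $ Some j = v $ j"
  by (simp_all add: hom_def)

text \<open>The coordinate \<open>None\<close> is chosen so that pairing with \<open>hom v\<close>
  gives y \<bullet> (v - sample mean). Centring thus becomes part of a linear form in the uncentred
  data.\<close>

definition lift :: "nat \<times> 'a \<Rightarrow> real^'p \<Rightarrow> real^('p option)" where
  "lift T y = (\<chi> a. case a of None \<Rightarrow> - (y \<bullet> sample_mean T) | Some j \<Rightarrow> y $ j)"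

lemma lift_nth [simp]: "lift T y $ None = - (y \<bullet> sample_mean T)" "lift T y $ Some j = y $ j"
  by (simp_all add: lift_def)

lemma lift_inner_hom: "lift T y \<bullet> hom v = y \<bullet> (v - sample_mean T)"
  by (simp add: inner_vec_def[of "lift T y"] sum_UNIV_option hom_def inner_diff_right)
    (simp add: inner_vec_def)

lemma lift_tendsto:
  assumes "(y \<longlongrightarrow> axis k 1) (prob_filter M)"
  shows "((\<lambda>T. lift T (y T)) \<longlongrightarrow> ax k) (prob_filter M)"
proof (rule vec_tendstoI)
  fix a
  show "((\<lambda>T. lift T (y T) $ a) \<longlongrightarrow> ax k $ a) (prob_filter M)"
  proof (cases a)
    case None
    have "((\<lambda>T. - (y T \<bullet> sample_mean T)) \<longlongrightarrow> - (axis k 1 \<bullet> (0 :: real^'p))) (prob_filter M)"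
      by (rule tendsto_minus[OF tendsto_inner[OF assms sample_mean_tendsto]])
    then show ?thesis using None by (simp add: axis_def)
  next
    case (Some j)
    have "((\<lambda>T. y T $ j) \<longlongrightarrow> axis k 1 $ j) (prob_filter M)" by (intro tendsto_vec_nth assms)
    then show ?thesis using Some by (simp add: axis_def)
  qed
qed

lemma inner_std: "u \<bullet> std T i = lift T (sample_isqrt T *v u) \<bullet> hom (z i (snd T))"
  unfolding lift_inner_hom std_def by (simp add: symmetric_matrix_inner[OF transpose_sample_isqrt])

lemma power_sum_expand:
  fixes f :: "'i \<Rightarrow> real"
  shows "(\<Sum>i\<in>I. f i) ^ 3 = (\<Sum>i\<in>I. \<Sum>j\<in>I. \<Sum>k\<in>I. f i * f j * f k)"
    "(\<Sum>i\<in>I. f i) ^ 4 = (\<Sum>i\<in>I. \<Sum>j\<in>I. \<Sum>k\<in>I. \<Sum>l\<in>I. f i * f j * f k * f l)"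
  by (simp_all add: power3_eq_cube power4_eq_xxxx mult.assoc flip: sum_distrib_left sum_distrib_right)

text \<open>On the unit sphere the monomials in u are bounded by 1, so uniformity over u reduces to
  the convergence of finitely many coefficients.\<close>

lemma empirical_moments_uniform:
  assumes "d > 0"
  shows "\<forall>\<^sub>F T in prob_filter M. \<forall>u. norm u = 1 \<longrightarrow>
      \<bar>(\<Sum>i<fst T. (u \<bullet> std T i) ^ 3) / real (fst T) - (\<integral>v. (u \<bullet> v) ^ 3 \<partial>D)\<bar> < d \<and>
      \<bar>(\<Sum>i<fst T. (u \<bullet> std T i) ^ 4) / real (fst T) - (\<integral>v. (u \<bullet> v) ^ 4 \<partial>D)\<bar> < d"
proof -
  define h where "h T j = lift T (sample_isqrt T *v axis j 1)" for T j
  have h: "((\<lambda>T. h T j) \<longlongrightarrow> ax j) (prob_filter M)" for j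
  proof -
    have "((\<lambda>T. sample_isqrt T *v axis j 1) \<longlongrightarrow> axis j 1) (prob_filter M)"
    proof (rule vec_tendstoI)
      fix i
      have "((\<lambda>T. sample_isqrt T $ i $ j) \<longlongrightarrow> mat 1 $ i $ j) (prob_filter M)" by (intro tendsto_vec_nth sample_isqrt_tendsto)
      moreover have "(sample_isqrt T *v axis j 1) $ i = sample_isqrt T $ i $ j" for T
        by (simp add: matrix_vector_mult_basis column_def)
      moreover have "mat 1 $ i $ j = (axis j 1 :: real^'p) $ i" by (simp add: mat_def axis_def)
      ultimately show "((\<lambda>T. (sample_isqrt T *v axis j 1) $ i) \<longlongrightarrow> axis j 1 $ i) (prob_filter M)"
        by (simp only:)
    qed
    then show ?thesis unfolding h_def by (rule lift_tendsto)
  qed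
  have std: "u \<bullet> std T i = (\<Sum>j\<in>UNIV. u $ j * (h T j \<bullet> hom (z i (snd T))))" for u T i
  proof -
    have "u \<bullet> std T i = (\<Sum>j\<in>UNIV. u $ j * (axis j 1 \<bullet> std T i))"
      by (simp add: inner_vec_def[of u] inner_axis')
    then show ?thesis by (simp add: inner_std h_def)
  qed
  define \<delta>3 where "\<delta>3 T = (\<Sum>i\<in>UNIV. \<Sum>j\<in>UNIV. \<Sum>k\<in>UNIV. \<bar>smom4 T (h T i) (h T j) (h T k) one_ax - mom4 (ax i) (ax j) (ax k) one_ax\<bar>)" for T
  define \<delta>4 where "\<delta>4 T = (\<Sum>i\<in>UNIV. \<Sum>j\<in>UNIV. \<Sum>k\<in>UNIV. \<Sum>l\<in>UNIV. \<bar>smom4 T (h T i) (h T j) (h T k) (h T l) - mom4 (ax i) (ax j) (ax k) (ax l)\<bar>)" for T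
  have "(\<delta>3 \<longlongrightarrow> 0) (prob_filter M)" "(\<delta>4 \<longlongrightarrow> 0) (prob_filter M)"
    unfolding \<delta>3_def \<delta>4_def by (intro tendsto_null_sum tendsto_rabs_zero LIM_zero smom4_tendsto h tendsto_const)+
  then have ev: "\<forall>\<^sub>F T in prob_filter M. \<delta>3 T < d \<and> \<delta>4 T < d"
    using assms by (intro eventually_conj order_tendstoD(2)) auto
  have b3: "\<bar>(\<Sum>i<fst T. (u \<bullet> std T i) ^ 3) / real (fst T) - (\<integral>v. (u \<bullet> v) ^ 3 \<partial>D)\<bar> \<le> \<delta>3 T" if u: "norm u = 1" for u T
  proof -
    have ui: "\<bar>u $ i\<bar> \<le> 1" for i using component_le_norm_cart[of u i] u by simp
    have e: "(\<Sum>i<fst T. (u \<bullet> std T i) ^ 3) / real (fst T) = (\<Sum>i\<in>UNIV. \<Sum>j\<in>UNIV. \<Sum>k\<in>UNIV. (u $ i * u $ j * u $ k) * smom4 T (h T i) (h T j) (h T k) one_ax)"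
    proof -
      have "(\<Sum>i<fst T. (u \<bullet> std T i) ^ 3) / real (fst T) = avg (\<lambda>v. \<Sum>i\<in>UNIV. \<Sum>j\<in>UNIV. \<Sum>k\<in>UNIV. (u $ i * u $ j * u $ k) *
         ((h T i \<bullet> hom v) * (h T j \<bullet> hom v) * (h T k \<bullet> hom v) * (one_ax \<bullet> hom v))) T"
        unfolding std power_sum_expand avg_def by (simp add: mult_ac)
      then show ?thesis by (simp add: avg_sum avg_cmult smom4_def)
    qed
    have E: "(\<integral>v. (u \<bullet> v) ^ 3 \<partial>D) = (\<Sum>i\<in>UNIV. \<Sum>j\<in>UNIV. \<Sum>k\<in>UNIV. (u $ i * u $ j * u $ k) * mom4 (ax i) (ax j) (ax k) one_ax)"
    proof -
      have "(\<integral>v. (u \<bullet> v) ^ 3 \<partial>D) = (\<integral>v. (\<Sum>i\<in>UNIV. \<Sum>j\<in>UNIV. \<Sum>k\<in>UNIV. (u $ i * u $ j * u $ k) * (hom v $ Some i * hom v $ Some j * hom v $ Some k * hom v $ None)) \<partial>D)"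
        unfolding inner_vec_def power_sum_expand by (simp add: hom_def mult_ac)
      also have "\<dots> = (\<Sum>i\<in>UNIV. \<Sum>j\<in>UNIV. \<Sum>k\<in>UNIV. (u $ i * u $ j * u $ k) * (\<integral>v. hom v $ Some i * hom v $ Some j * hom v $ Some k * hom v $ None \<partial>D))"
        by (simp add: hom_product_integrable Bochner_Integration.integrable_sum)
      finally show ?thesis by (simp add: mom4_def hom_nth)
    qed
    have "\<bar>(\<Sum>i<fst T. (u \<bullet> std T i) ^ 3) / real (fst T) - (\<integral>v. (u \<bullet> v) ^ 3 \<partial>D)\<bar> =
      \<bar>\<Sum>i\<in>UNIV. \<Sum>j\<in>UNIV. \<Sum>k\<in>UNIV. (u $ i * u $ j * u $ k) * (smom4 T (h T i) (h T j) (h T k) one_ax - mom4 (ax i) (ax j) (ax k) one_ax)\<bar>"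
      unfolding e E by (simp add: right_diff_distrib sum_subtractf)
    also have "\<dots> \<le> \<delta>3 T"
      unfolding \<delta>3_def
    proof (intro order_trans[OF sum_abs] sum_mono)
      fix i j k
      have "\<bar>u $ i * u $ j * u $ k\<bar> \<le> 1 * 1 * 1" unfolding abs_mult by (intro mult_mono ui) auto
      then show "\<bar>(u $ i * u $ j * u $ k) * (smom4 T (h T i) (h T j) (h T k) one_ax - mom4 (ax i) (ax j) (ax k) one_ax)\<bar> \<le>
         \<bar>smom4 T (h T i) (h T j) (h T k) one_ax - mom4 (ax i) (ax j) (ax k) one_ax\<bar>"
        by (subst abs_mult) (rule mult_left_le_one_le; simp)
    qed
    finally show ?thesis .
  qed
  have b4: "\<bar>(\<Sum>i<fst T. (u \<bullet> std T i) ^ 4) / real (fst T) - (\<integral>v. (u \<bullet> v) ^ 4 \<partial>D)\<bar> \<le> \<delta>4 T" if u: "norm u = 1" for u T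
  proof -
    have ui: "\<bar>u $ i\<bar> \<le> 1" for i using component_le_norm_cart[of u i] u by simp
    have e: "(\<Sum>i<fst T. (u \<bullet> std T i) ^ 4) / real (fst T) = (\<Sum>i\<in>UNIV. \<Sum>j\<in>UNIV. \<Sum>k\<in>UNIV. \<Sum>l\<in>UNIV. (u $ i * u $ j * u $ k * u $ l) * smom4 T (h T i) (h T j) (h T k) (h T l))"
    proof -
      have "(\<Sum>i<fst T. (u \<bullet> std T i) ^ 4) / real (fst T) = avg (\<lambda>v. \<Sum>i\<in>UNIV. \<Sum>j\<in>UNIV. \<Sum>k\<in>UNIV. \<Sum>l\<in>UNIV. (u $ i * u $ j * u $ k * u $ l) *
         ((h T i \<bullet> hom v) * (h T j \<bullet> hom v) * (h T k \<bullet> hom v) * (h T l \<bullet> hom v))) T"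
        unfolding std power_sum_expand avg_def by (simp add: mult_ac)
      then show ?thesis by (simp add: avg_sum avg_cmult smom4_def)
    qed
    have E: "(\<integral>v. (u \<bullet> v) ^ 4 \<partial>D) = (\<Sum>i\<in>UNIV. \<Sum>j\<in>UNIV. \<Sum>k\<in>UNIV. \<Sum>l\<in>UNIV. (u $ i * u $ j * u $ k * u $ l) * mom4 (ax i) (ax j) (ax k) (ax l))"
    proof -
      have "(\<integral>v. (u \<bullet> v) ^ 4 \<partial>D) = (\<integral>v. (\<Sum>i\<in>UNIV. \<Sum>j\<in>UNIV. \<Sum>k\<in>UNIV. \<Sum>l\<in>UNIV. (u $ i * u $ j * u $ k * u $ l) * (hom v $ Some i * hom v $ Some j * hom v $ Some k * hom v $ Some l)) \<partial>D)"
        unfolding inner_vec_def power_sum_expand by (simp add: hom_def mult_ac)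
      also have "\<dots> = (\<Sum>i\<in>UNIV. \<Sum>j\<in>UNIV. \<Sum>k\<in>UNIV. \<Sum>l\<in>UNIV. (u $ i * u $ j * u $ k * u $ l) * (\<integral>v. hom v $ Some i * hom v $ Some j * hom v $ Some k * hom v $ Some l \<partial>D))"
        by (simp add: hom_product_integrable Bochner_Integration.integrable_sum)
      finally show ?thesis by (simp add: mom4_def hom_nth)
    qed
    have "\<bar>(\<Sum>i<fst T. (u \<bullet> std T i) ^ 4) / real (fst T) - (\<integral>v. (u \<bullet> v) ^ 4 \<partial>D)\<bar> =
      \<bar>\<Sum>i\<in>UNIV. \<Sum>j\<in>UNIV. \<Sum>k\<in>UNIV. \<Sum>l\<in>UNIV. (u $ i * u $ j * u $ k * u $ l) * (smom4 T (h T i) (h T j) (h T k) (h T l) - mom4 (ax i) (ax j) (ax k) (ax l))\<bar>"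
      unfolding e E by (simp add: right_diff_distrib sum_subtractf)
    also have "\<dots> \<le> \<delta>4 T"
      unfolding \<delta>4_def
    proof (intro order_trans[OF sum_abs] sum_mono)
      fix i j k l
      have "\<bar>u $ i * u $ j * u $ k * u $ l\<bar> \<le> 1 * 1 * 1 * 1" unfolding abs_mult by (intro mult_mono ui) auto
      then show "\<bar>(u $ i * u $ j * u $ k * u $ l) * (smom4 T (h T i) (h T j) (h T k) (h T l) - mom4 (ax i) (ax j) (ax k) (ax l))\<bar> \<le>
         \<bar>smom4 T (h T i) (h T j) (h T k) (h T l) - mom4 (ax i) (ax j) (ax k) (ax l)\<bar>"
        by (subst abs_mult) (rule mult_left_le_one_le; simp)
    qed
    finally show ?thesis .
  qed
  show ?thesis using ev by eventually_elim (use b3 b4 in \<open>meson order.strict_trans1\<close>)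
qed

lemma empirical_index_uniform:
  assumes \<alpha>: "0 \<le> \<alpha>" "\<alpha> \<le> 1" and d: "d > 0"
  shows "\<forall>\<^sub>F T in prob_filter M. \<forall>u. norm u = 1 \<longrightarrow> \<bar>empirical_index \<alpha> (fst T) (std T) u - population_index \<alpha> D u\<bar> < d"
proof -
  define B where "B = (\<Sum>j\<in>UNIV. \<bar>gam D j\<bar>) + (\<Sum>j\<in>UNIV. \<bar>kap D j\<bar>)"
  have B0: "B \<ge> 0" by (simp add: B_def sum_nonneg)
  \<comment> \<open>If |x - y| < e \<le> 1 and |y| \<le> B, then |x^2 - y^2| \<le> e (1 + 2 B),
    which this choice keeps below d.\<close>
  define e where "e = min 1 (d / (2 + 2 * B))"
  have e: "0 < e" "e \<le> 1" using d B0 by (auto simp: e_def)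
  have ed: "e * (1 + 2 * B) < d"
  proof -
    have "e * (1 + 2 * B) < e * (2 + 2 * B)" using e by simp
    also have "\<dots> \<le> d / (2 + 2 * B) * (2 + 2 * B)" using B0 by (intro mult_right_mono) (auto simp: e_def)
    finally show ?thesis using B0 by simp
  qed
  have sq: "\<bar>x\<^sup>2 - y\<^sup>2\<bar> \<le> e * (1 + 2 * B)" if "\<bar>x - y\<bar> < e" "\<bar>y\<bar> \<le> B" for x y :: real
  proof -
    have "\<bar>x\<^sup>2 - y\<^sup>2\<bar> = \<bar>x - y\<bar> * \<bar>x + y\<bar>" by (simp add: power2_eq_square square_diff_square_factored abs_mult mult.commute)
    also have "\<dots> \<le> e * (1 + 2 * B)" using that e by (intro mult_mono) auto
    finally show ?thesis .
  qed
  show ?thesis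
    using empirical_moments_uniform[OF e(1)]
  proof eventually_elim
    case (elim T)
    show ?case
    proof (intro allI impI)
      fix u :: "real^'p" assume u: "norm u = 1"
      define x3 where "x3 = (\<Sum>i<fst T. (u \<bullet> std T i) ^ 3) / real (fst T)"
      define x4 where "x4 = (\<Sum>i<fst T. (u \<bullet> std T i) ^ 4) / real (fst T) - 3"
      define y3 where "y3 = (\<Sum>j\<in>UNIV. (u $ j) ^ 3 * gam D j)"
      define y4 where "y4 = (\<Sum>j\<in>UNIV. (u $ j) ^ 4 * kap D j)"
      have ui: "\<bar>u $ i\<bar> \<le> 1" for i using component_le_norm_cart[of u i] u by simp
      have bound: "\<bar>\<Sum>j\<in>UNIV. (u $ j) ^ m * c j\<bar> \<le> (\<Sum>j\<in>UNIV. \<bar>c j\<bar>)" for m c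
        by (intro order_trans[OF sum_abs] sum_mono) (simp add: abs_mult power_abs mult_left_le_one_le power_le_one ui)
      have y: "\<bar>y3\<bar> \<le> B" "\<bar>y4\<bar> \<le> B"
        unfolding B_def y3_def y4_def by (intro order_trans[OF bound]; simp add: sum_nonneg)+
      \<comment> \<open>On unit vectors the Gaussian part of the population fourth moment is 3 and
        cancels the 3 subtracted in x4.\<close>
      have xy: "\<bar>x3 - y3\<bar> < e" "\<bar>x4 - y4\<bar> < e"
        using elim u by (auto simp: x3_def x4_def y3_def y4_def moments_projection sum_squares_unit algebra_simps)
      have "\<bar>empirical_index \<alpha> (fst T) (std T) u - population_index \<alpha> D u\<bar> = \<bar>\<alpha> * (x3\<^sup>2 - y3\<^sup>2) + (1 - \<alpha>) * (x4\<^sup>2 - y4\<^sup>2)\<bar>"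
        by (simp add: empirical_index_def population_index_def x3_def x4_def y3_def y4_def algebra_simps)
      also have "\<dots> \<le> \<alpha> * \<bar>x3\<^sup>2 - y3\<^sup>2\<bar> + (1 - \<alpha>) * \<bar>x4\<^sup>2 - y4\<^sup>2\<bar>"
        using \<alpha> by (intro order_trans[OF abs_triangle_ineq]) (simp add: abs_mult)
      also have "\<dots> \<le> \<alpha> * (e * (1 + 2 * B)) + (1 - \<alpha>) * (e * (1 + 2 * B))"
        using \<alpha> by (intro add_mono mult_left_mono sq xy y) auto
      also have "\<dots> < d" using ed by (simp add: algebra_simps)
      finally show "\<bar>empirical_index \<alpha> (fst T) (std T) u - population_index \<alpha> D u\<bar> < d" .
    qed
  qed
qed

end

section \<open>Asymptotic normality of the estimate\<close>

lemma norm_iexp_diff_le: "norm (iexp x - iexp y) \<le> \<bar>x - y\<bar>"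
proof -
  have "iexp x - iexp y = iexp y * (iexp (x - y) - 1)"
    by (simp add: right_diff_distrib flip: exp_add)
  then have "norm (iexp x - iexp y) = norm (iexp (x - y) - 1)" by (simp add: norm_mult)
  also have "\<dots> \<le> \<bar>x - y\<bar>" using iexp_approx1[of "x - y" 0] by simp
  finally show ?thesis .
qed

text \<open>Slutsky's lemma for characteristic functions: the integrands differ by at most |X - Y|
  on the good event and by at most 2 elsewhere.\<close>

lemma (in prob_space) iexp_expectation_diff_tendsto:
  fixes X Y :: "nat \<times> 'a \<Rightarrow> real"
  assumes XY: "((\<lambda>T. X T - Y T) \<longlongrightarrow> 0) (prob_filter M)"
    and [measurable]: "\<And>n. (\<lambda>\<omega>. X (n, \<omega>)) \<in> borel_measurable M" "\<And>n. (\<lambda>\<omega>. Y (n, \<omega>)) \<in> borel_measurable M"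
  shows "(\<lambda>n. expectation (\<lambda>\<omega>. iexp (X (n, \<omega>))) - expectation (\<lambda>\<omega>. iexp (Y (n, \<omega>)))) \<longlonglongrightarrow> 0"
proof (rule LIMSEQ_I)
  fix e :: real assume e: "e > 0"
  have "\<forall>\<^sub>F T in prob_filter M. \<bar>X T - Y T\<bar> \<le> e / 2"
    using tendstoD[OF XY, of "e / 2"] e by (auto elim: eventually_mono)
  from LIMSEQ_D[OF prob_not_eventually[OF this], of "e / 8"] e
  obtain N where N: "\<And>n. n \<ge> N \<Longrightarrow> prob {\<omega> \<in> space M. \<not> \<bar>X (n, \<omega>) - Y (n, \<omega>)\<bar> \<le> e / 2} < e / 8" by auto
  have "norm (expectation (\<lambda>\<omega>. iexp (X (n, \<omega>))) - expectation (\<lambda>\<omega>. iexp (Y (n, \<omega>)))) < e" if n: "n \<ge> N" for n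
  proof -
    let ?A = "{\<omega> \<in> space M. \<not> \<bar>X (n, \<omega>) - Y (n, \<omega>)\<bar> \<le> e / 2}"
    have A: "?A \<in> events" by measurable
    have i: "integrable M (\<lambda>\<omega>. iexp (X (n, \<omega>)))" "integrable M (\<lambda>\<omega>. iexp (Y (n, \<omega>)))"
      by (auto intro!: integrable_const_bound[where B = 1])
    have iA: "integrable M (\<lambda>\<omega>. 2 * indicator ?A \<omega> :: real)"
      using A by (intro integrable_mult_right integrable_real_indicator) (auto simp: less_top[symmetric])
    have "norm (expectation (\<lambda>\<omega>. iexp (X (n, \<omega>))) - expectation (\<lambda>\<omega>. iexp (Y (n, \<omega>)))) =
        norm (expectation (\<lambda>\<omega>. iexp (X (n, \<omega>)) - iexp (Y (n, \<omega>))))" using i by simp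
    also have "\<dots> \<le> expectation (\<lambda>\<omega>. norm (iexp (X (n, \<omega>)) - iexp (Y (n, \<omega>))))" by (rule integral_norm_bound)
    also have "\<dots> \<le> expectation (\<lambda>\<omega>. e / 2 + 2 * indicator ?A \<omega>)"
    proof (rule integral_mono)
      fix \<omega> assume \<omega>: "\<omega> \<in> space M"
      show "norm (iexp (X (n, \<omega>)) - iexp (Y (n, \<omega>))) \<le> e / 2 + 2 * indicator ?A \<omega>"
      proof (cases "\<omega> \<in> ?A")
        case True
        have "norm (iexp (X (n, \<omega>)) - iexp (Y (n, \<omega>))) \<le> 1 + 1" by (rule order_trans[OF norm_triangle_ineq4]) simp
        then show ?thesis using True e by simp
      next
        case False
        then show ?thesis using \<omega> norm_iexp_diff_le[of "X (n, \<omega>)" "Y (n, \<omega>)"] by simp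
      qed
    next
      show "integrable M (\<lambda>\<omega>. norm (iexp (X (n, \<omega>)) - iexp (Y (n, \<omega>))))"
        by (intro integrable_norm Bochner_Integration.integrable_diff i)
      show "integrable M (\<lambda>\<omega>. e / 2 + 2 * indicator ?A \<omega>)"
        by (intro Bochner_Integration.integrable_add iA integrable_const)
    qed
    also have "\<dots> = e / 2 + 2 * prob ?A"
      using A by (subst Bochner_Integration.integral_add[OF _ iA]) (auto simp: prob_space)
    finally show ?thesis using N[OF n] e by linarith
  qed
  then show "\<exists>no. \<forall>n\<ge>no. norm (expectation (\<lambda>\<omega>. iexp (X (n, \<omega>))) - expectation (\<lambda>\<omega>. iexp (Y (n, \<omega>))) - 0) < e"
    by (intro exI[of _ N]) simp
qed

context iid_sample
begin

lemma centered_L2_product_integrable: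
  assumes "centered_L2 f" "centered_L2 h"
  shows "integrable D (\<lambda>v. f v * h v)"
proof (rule Bochner_Integration.integrable_bound)
  show "integrable D (\<lambda>v. (f v)\<^sup>2 + (h v)\<^sup>2)" using assms by (simp add: centered_L2_def)
  have "\<bar>x * y\<bar> \<le> x\<^sup>2 + y\<^sup>2" for x y :: real
    using sum_squares_bound[of "\<bar>x\<bar>" "\<bar>y\<bar>"] mult_nonneg_nonneg[of "\<bar>x\<bar>" "\<bar>y\<bar>"]
    unfolding abs_mult power2_abs by linarith
  then show "AE v in D. norm (f v * h v) \<le> norm ((f v)\<^sup>2 + (h v)\<^sup>2)" by simp
  show "(\<lambda>v. f v * h v) \<in> borel_measurable D"
    using assms by (auto simp: centered_L2_def intro!: borel_measurable_times)
qed

text \<open>The Cramer-Wold device: each linear form of X is, up to a vanishing term, a scaled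
  average of one centred function h t. The limit has the covariance matrix C of the functions
  \<psi>, and tightness follows from the bound in mean of the scaled averages.\<close>

theorem asymptotic_normality_of_linear_approximation:
  fixes X :: "nat \<Rightarrow> 'a \<Rightarrow> real^'q" and \<psi> :: "'q \<Rightarrow> real^'p \<Rightarrow> real"
  assumes \<psi>: "\<And>q. centered_L2 (\<psi> q)"
    and X [measurable]: "\<And>n. X n \<in> borel_measurable M"
    and approx: "\<And>q. ((\<lambda>T. X (fst T) (snd T) $ q - sqrt (real (fst T)) * avg (\<psi> q) T) \<longlongrightarrow> 0) (prob_filter M)"
  shows "\<exists>N. multivariate_normal N \<and> conv_in_distribution M X N \<and>
    (\<forall>q. (\<integral>x. x $ q \<partial>N) = 0 \<and> (\<integral>x. (x $ q)\<^sup>2 \<partial>N) = (\<integral>v. (\<psi> q v)\<^sup>2 \<partial>D))"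
proof -
  define C where "C = (\<chi> q r. \<integral>v. \<psi> q v * \<psi> r v \<partial>D)"
  have [measurable]: "\<psi> q \<in> borel_measurable borel" for q using \<psi> by (simp add: centered_L2_def)
  define h where "h t v = (\<Sum>q\<in>UNIV. t $ q * \<psi> q v)" for t v
  have hL2: "centered_L2 (h t)" for t
    unfolding h_def by (intro centered_L2_sum centered_L2_cmult \<psi>)
  then have [measurable]: "h t \<in> borel_measurable borel" for t by (simp add: centered_L2_def)
  have quad: "t \<bullet> (C *v t) = (\<integral>v. (h t v)\<^sup>2 \<partial>D)" for t
  proof -
    have "(\<integral>v. (h t v)\<^sup>2 \<partial>D) = (\<integral>v. (\<Sum>q\<in>UNIV. \<Sum>r\<in>UNIV. (t $ q * t $ r) * (\<psi> q v * \<psi> r v)) \<partial>D)"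
      unfolding h_def power2_eq_square sum_product by (simp add: mult_ac)
    also have "\<dots> = (\<Sum>q\<in>UNIV. \<Sum>r\<in>UNIV. (t $ q * t $ r) * (\<integral>v. \<psi> q v * \<psi> r v \<partial>D))"
      by (simp add: centered_L2_product_integrable \<psi> Bochner_Integration.integrable_sum)
    also have "\<dots> = t \<bullet> (C *v t)"
      by (simp add: inner_vec_def matrix_vector_mult_def C_def sum_distrib_left mult_ac)
    finally show ?thesis by simp
  qed
  have sym: "transpose C = C" by (simp add: C_def transpose_def vec_eq_iff mult.commute)
  have psd: "t \<bullet> (C *v t) \<ge> 0" for t unfolding quad by simp
  obtain N where N: "multivariate_normal N"
    "\<And>t. (\<integral>x. iexp (t \<bullet> x) \<partial>N) = complex_of_real (exp (- (t \<bullet> (C *v t)) / 2))"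
    "\<And>q. (\<integral>x. x $ q \<partial>N) = 0 \<and> (\<integral>x. (x $ q)\<^sup>2 \<partial>N) = C $ q $ q"
    using multivariate_normal_exists[OF sym psd] by blast
  have "conv_in_distribution M X N"
  proof (rule conv_in_distribution_char)
    show "prob_space M" by (rule prob_space_axioms)
    show "prob_space N" "sets N = sets borel" using N(1) by (auto simp: multivariate_normal_def)
    show "(\<lambda>n. \<integral>\<omega>. iexp (t \<bullet> X n \<omega>) \<partial>M) \<longlonglongrightarrow> (\<integral>x. iexp (t \<bullet> x) \<partial>N)" for t
    proof -
      have lin: "t \<bullet> X (fst T) (snd T) - sqrt (real (fst T)) * avg (h t) T =
          (\<Sum>q\<in>UNIV. t $ q * (X (fst T) (snd T) $ q - sqrt (real (fst T)) * avg (\<psi> q) T))" for T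
        by (simp add: h_def[abs_def] avg_sum avg_cmult inner_vec_def right_diff_distrib sum_subtractf sum_distrib_left mult_ac)
      have "((\<lambda>T. t \<bullet> X (fst T) (snd T) - sqrt (real (fst T)) * avg (h t) T) \<longlongrightarrow> 0) (prob_filter M)"
        unfolding lin by (intro tendsto_null_sum tendsto_mult_right_zero approx)
      from iexp_expectation_diff_tendsto[OF this]
      have "(\<lambda>n. expectation (\<lambda>\<omega>. iexp (t \<bullet> X n \<omega>)) - expectation (\<lambda>\<omega>. iexp (sqrt (real n) * avg (h t) (n, \<omega>)))) \<longlonglongrightarrow> 0"
        by simp
      from tendsto_add[OF this scaled_avg_char_tendsto[of "h t"]] hL2[of t]
      show ?thesis unfolding N(2) quad by (simp add: centered_L2_def)
    qed
    show "\<exists>R. \<forall>\<^sub>F n in sequentially. prob {\<omega> \<in> space M. R < norm (X n \<omega>)} \<le> e" if e: "e > 0" for e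
    proof -
      define Y where "Y T = (\<Sum>q\<in>UNIV. \<bar>sqrt (real (fst T)) * avg (\<psi> q) T\<bar>)" for T
      define r where "r T = (\<Sum>q\<in>UNIV. \<bar>X (fst T) (snd T) $ q - sqrt (real (fst T)) * avg (\<psi> q) T\<bar>)" for T
      have "bounded_mean Y" unfolding Y_def by (intro bounded_mean_sum bounded_mean_scaled_avg \<psi>)
      then obtain B where "\<forall>n. integrable M (\<lambda>\<omega>. Y (n, \<omega>)) \<and> expectation (\<lambda>\<omega>. \<bar>Y (n, \<omega>)\<bar>) \<le> B"
        unfolding bounded_mean_def by blast
      then have B: "integrable M (\<lambda>\<omega>. Y (n, \<omega>))" "expectation (\<lambda>\<omega>. \<bar>Y (n, \<omega>)\<bar>) \<le> B" for n by auto
      have Y0: "0 \<le> Y T" for T by (simp add: Y_def sum_nonneg)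
      have "0 \<le> expectation (\<lambda>\<omega>. \<bar>Y (0, \<omega>)\<bar>)" by simp
      then have B0: "0 \<le> B" using B(2)[of 0] by linarith
      \<comment> \<open>Makes the Markov bound B / c at most e / 2; the summand 1 keeps c positive
        when B = 0.\<close>
      define c where "c = 2 * B / e + 1"
      have c: "0 < c" using B0 e by (simp add: c_def add_nonneg_pos)
      have "(r \<longlongrightarrow> 0) (prob_filter M)"
        unfolding r_def by (intro tendsto_null_sum tendsto_rabs_zero approx)
      then have "\<forall>\<^sub>F T in prob_filter M. r T < 1" by (rule order_tendstoD) simp
      from order_tendstoD(2)[OF prob_not_eventually[OF this], of "e / 2"]
      have "\<forall>\<^sub>F n in sequentially. prob {\<omega> \<in> space M. \<not> r (n, \<omega>) < 1} < e / 2" using e by simp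
      then have "\<forall>\<^sub>F n in sequentially. prob {\<omega> \<in> space M. c + 1 < norm (X n \<omega>)} \<le> e"
      proof eventually_elim
        case (elim n)
        have [measurable]: "(\<lambda>\<omega>. X n \<omega> $ q) \<in> borel_measurable M" for q by (rule borel_measurable_vec_nth) simp
        have [measurable]: "(\<lambda>\<omega>. r (n, \<omega>)) \<in> borel_measurable M" "(\<lambda>\<omega>. Y (n, \<omega>)) \<in> borel_measurable M"
          unfolding r_def Y_def by simp_all
        have "norm (X n \<omega>) \<le> r (n, \<omega>) + Y (n, \<omega>)" for \<omega>
        proof -
          have "norm (X n \<omega>) \<le> (\<Sum>q\<in>UNIV. \<bar>X n \<omega> $ q\<bar>)" by (rule norm_le_l1_cart)
          also have "\<dots> \<le> (\<Sum>q\<in>UNIV. \<bar>X n \<omega> $ q - sqrt (real n) * avg (\<psi> q) (n, \<omega>)\<bar> + \<bar>sqrt (real n) * avg (\<psi> q) (n, \<omega>)\<bar>)"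
            by (intro sum_mono) simp
          finally show ?thesis by (simp add: r_def Y_def sum.distrib)
        qed
        then have "{\<omega> \<in> space M. c + 1 < norm (X n \<omega>)} \<subseteq> {\<omega> \<in> space M. \<not> r (n, \<omega>) < 1} \<union> {\<omega> \<in> space M. c \<le> Y (n, \<omega>)}"
          by (auto simp: not_less) (smt (verit))
        then have "prob {\<omega> \<in> space M. c + 1 < norm (X n \<omega>)} \<le> prob ({\<omega> \<in> space M. \<not> r (n, \<omega>) < 1} \<union> {\<omega> \<in> space M. c \<le> Y (n, \<omega>)})"
          by (intro finite_measure_mono) measurable
        also have "\<dots> \<le> prob {\<omega> \<in> space M. \<not> r (n, \<omega>) < 1} + prob {\<omega> \<in> space M. c \<le> Y (n, \<omega>)}"
          by (intro measure_Un_le) measurable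
        also have "prob {\<omega> \<in> space M. c \<le> Y (n, \<omega>)} \<le> expectation (\<lambda>\<omega>. Y (n, \<omega>)) / c"
          using B c Y0 by (intro Markov_inequality_ge) auto
        also have "\<dots> \<le> B / c" using B(2)[of n] c Y0 by (intro divide_right_mono) auto
        also have "\<dots> \<le> e / 2"
        proof -
          have "e / 2 * c = B + e / 2" using e by (simp add: c_def field_simps)
          then show ?thesis using c e by (simp add: pos_divide_le_eq)
        qed
        finally show ?case using elim by simp
      qed
      then show ?thesis by blast
    qed
  qed (rule X)
  then show ?thesis using N(1,3) by (intro exI[of _ N]) (auto simp: C_def power2_eq_square)
qed

end

context ica_sample
begin

text \<open>Independence lets v_l contribute only its variance 1, which leaves moments of v_k up to
  order six.\<close>

lemma integral_polynomial_square:
  assumes "k \<noteq> l"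
  shows "(\<integral>v. ((c0 + c1 * v $ k + c2 * (v $ k)\<^sup>2 + c3 * (v $ k) ^ 3) * v $ l)\<^sup>2 \<partial>D) =
    c0\<^sup>2 + (c1\<^sup>2 + 2 * c0 * c2) + 2 * (c0 * c3 + c1 * c2) * gam D k + (c2\<^sup>2 + 2 * c1 * c3) * bet D k
    + 2 * c2 * c3 * (\<integral>v. (v $ k) ^ 5 \<partial>D) + c3\<^sup>2 * (\<integral>v. (v $ k) ^ 6 \<partial>D)"
proof -
  have eq: "((c0 + c1 * x + c2 * x\<^sup>2 + c3 * x ^ 3) * y)\<^sup>2 =
      c0\<^sup>2 * (x ^ 0 * y\<^sup>2) + (2 * c0 * c1) * (x ^ 1 * y\<^sup>2) + (c1\<^sup>2 + 2 * c0 * c2) * (x\<^sup>2 * y\<^sup>2) + (2 * (c0 * c3 + c1 * c2)) * (x ^ 3 * y\<^sup>2)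
      + (c2\<^sup>2 + 2 * c1 * c3) * (x ^ 4 * y\<^sup>2) + (2 * c2 * c3) * (x ^ 5 * y\<^sup>2) + c3\<^sup>2 * (x ^ 6 * y\<^sup>2)" for x y :: real
    by (simp add: power2_eq_square eval_nat_numeral algebra_simps)
  have i: "integrable D (\<lambda>v. (v $ k) ^ j * (v $ l)\<^sup>2)" "(\<integral>v. (v $ k) ^ j * (v $ l)\<^sup>2 \<partial>D) = (\<integral>v. (v $ k) ^ j \<partial>D)" if "j \<le> 6" for j
    using product_moment2[OF assms that, of 2] by (simp_all add: variance_component)
  have "(\<integral>v. (v $ k) ^ 0 \<partial>D) = 1" "(\<integral>v. (v $ k) ^ 1 \<partial>D) = 0" using D.prob_space mean_component by simp_all
  then show ?thesis
    unfolding eq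
    by (subst Bochner_Integration.integral_add; (intro Bochner_Integration.integrable_add integrable_mult_right i; simp)?)+
       (simp only: integral_mult_right_zero i; simp add: variance_component gam_def bet_def)
qed

end


text \<open>The positivity condition concerns every row but the last. It provides identification
  and, for k < l, the positive denominator in the expansion of row k.\<close>

locale deflation_sample = ica_sample M D z
  for M :: "'a measure" and D :: "(real^'p::{finite,linorder}) measure" and z :: "nat \<Rightarrow> 'a \<Rightarrow> real^'p::{finite,linorder}" +
  fixes \<alpha> :: real
  assumes \<alpha>: "0 \<le> \<alpha>" "\<alpha> \<le> 1"
    and component_index_pos: "\<And>k l :: 'p. k < l \<Longrightarrow> component_index \<alpha> D k > 0"
begin

abbreviation "index_at n \<omega> \<equiv> empirical_index \<alpha> n (std (n, \<omega>))"

lemma greedy_tendsto: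
  assumes K: "compact K" "\<And>U. U \<in> K \<Longrightarrow> orthogonal_matrix U"
    and r: "r > 0" "\<And>U. orthogonal_matrix U \<Longrightarrow> norm (U - mat 1) < r \<Longrightarrow> U \<in> K"
    and ident: "\<And>U k. U \<in> K \<Longrightarrow> (\<And>j. j < k \<Longrightarrow> U $ j = axis j 1) \<Longrightarrow>
      population_index \<alpha> D (axis k 1) \<le> population_index \<alpha> D (U $ k) \<Longrightarrow> U $ k = axis k 1"
    and U: "\<And>n \<omega>. \<omega> \<in> space M \<Longrightarrow> greedy K (index_at n \<omega>) (U n \<omega>)"
  shows "((\<lambda>T. U (fst T) (snd T)) \<longlongrightarrow> mat 1) (prob_filter M)"
proof (rule tendstoI)
  fix e :: real assume "e > 0"
  from greedy_consistent[OF K r continuous_on_population_index ident this] obtain d where d: "d > 0"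
    "\<And>g U. (\<forall>u. norm u = 1 \<longrightarrow> \<bar>g u - population_index \<alpha> D u\<bar> < d) \<Longrightarrow> greedy K g U \<Longrightarrow> norm (U - mat 1) < e"
    by blast
  from empirical_index_uniform[OF \<alpha> d(1)] eventually_prob_filter_space
  show "\<forall>\<^sub>F T in prob_filter M. dist (U (fst T) (snd T)) (mat 1) < e"
  proof eventually_elim
    case (elim T)
    have "norm (U (fst T) (snd T) - mat 1) < e"
      using elim(1) U[OF elim(2), of "fst T"] by (intro d(2)) auto
    then show ?case by (simp add: dist_norm)
  qed
qed

text \<open>Where the greedy maximizer over a neighbourhood of the identity lies on its boundary it need not be
  a local maximizer; there the global maximizer is used instead, which does not affect the limit.\<close>

lemma estimator_exists:
  "\<exists>U. (\<forall>n. U n \<in> borel_measurable M) \<and> ((\<lambda>T. U (fst T) (snd T)) \<longlongrightarrow> mat 1) (prob_filter M) \<and>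
    (\<forall>n. \<forall>\<omega>\<in>space M. orthogonal_matrix (U n \<omega>) \<and>
      (\<forall>k. \<exists>\<epsilon>>0. \<forall>u\<in>deflation_sphere (U n \<omega>) k. dist u (row k (U n \<omega>)) < \<epsilon> \<longrightarrow>
        index_at n \<omega> u \<le> index_at n \<omega> (row k (U n \<omega>))) \<and>
      (index_decreasing \<alpha> D \<longrightarrow> (\<forall>k. \<forall>u\<in>deflation_sphere (U n \<omega>) k. index_at n \<omega> u \<le> index_at n \<omega> (row k (U n \<omega>)))))"
proof (cases "index_decreasing \<alpha> D")
  case True
  let ?K = "orthogonal_nonneg_diagonal :: ((real, 'p) vec, 'p) vec set"
  have K1: "mat 1 \<in> ?K" by (simp add: orthogonal_nonneg_diagonal_def orthogonal_matrix_id) (simp add: mat_def)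
  have "\<exists>U. U \<in> borel_measurable M \<and> (\<forall>\<omega>\<in>space M. greedy ?K (index_at n \<omega>) (U \<omega>))" for n
    using K1 by (intro measurable_greedy compact_orthogonal_nonneg_diagonal caratheodory_empirical_index) auto
  then obtain U where U: "\<And>n. U n \<in> borel_measurable M" "\<And>n \<omega>. \<omega> \<in> space M \<Longrightarrow> greedy ?K (index_at n \<omega>) (U n \<omega>)" by metis
  have orth: "orthogonal_matrix (U n \<omega>)" if "\<omega> \<in> space M" for n \<omega>
    using U(2)[OF that, of n] by (simp add: greedy_def orthogonal_nonneg_diagonal_def)
  have max: "index_at n \<omega> u \<le> index_at n \<omega> (row k (U n \<omega>))" if "\<omega> \<in> space M" "u \<in> deflation_sphere (U n \<omega>) k" for n \<omega> u k
    by (rule greedy_nonneg_diagonal_imp_max[OF U(2)[OF that(1)] that(2)]) (simp add: empirical_index_def sum_negf)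
  have "((\<lambda>T. U (fst T) (snd T)) \<longlongrightarrow> mat 1) (prob_filter M)"
  proof (rule greedy_tendsto[OF compact_orthogonal_nonneg_diagonal _ zero_less_one])
    fix V :: "((real, 'p) vec, 'p) vec" assume V: "orthogonal_matrix V" "norm (V - mat 1) < 1"
    \<comment> \<open>A diagonal entry differs from 1 by at most the distance to the identity, so
      radius 1 keeps it nonnegative.\<close>
    have "0 \<le> V $ k $ k" for k
    proof -
      have "\<bar>(V - mat 1) $ k $ k\<bar> \<le> norm ((V - mat 1) $ k)" by (rule component_le_norm_cart)
      also have "\<dots> \<le> norm (V - mat 1)" by (rule Finite_Cartesian_Product.norm_nth_le)
      finally show ?thesis using V(2) by (simp add: mat_def)
    qed
    then show "V \<in> ?K" using V(1) by (simp add: orthogonal_nonneg_diagonal_def)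
  qed (use U identification_decreasing[OF \<alpha> True] in \<open>auto simp: orthogonal_nonneg_diagonal_def\<close>)
  then show ?thesis using U(1) orth max by (intro exI[of _ U] conjI allI ballI impI) (auto intro: exI[of _ 1])
next
  case False
  obtain d where d: "d > 0" and ident: "\<And>U k. U \<in> orthogonal_near_identity d \<Longrightarrow> (\<And>j. j < k \<Longrightarrow> U $ j = axis j 1) \<Longrightarrow>
      population_index \<alpha> D (axis k 1) \<le> population_index \<alpha> D (U $ k) \<Longrightarrow> U $ k = axis k 1"
  proof -
    have "\<exists>d>0. \<forall>U k. U \<in> orthogonal_near_identity d \<longrightarrow> (\<forall>j<k. U $ j = axis j 1) \<longrightarrow>
      population_index \<alpha> D (axis k 1) \<le> population_index \<alpha> D (U $ k) \<longrightarrow> U $ k = axis k 1"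
      by (rule identification_local[OF \<alpha>]) (rule component_index_pos)
    then show ?thesis using that by blast
  qed
  let ?K = "orthogonal_near_identity d :: ((real, 'p) vec, 'p) vec set"
  let ?O = "{U :: ((real, 'p) vec, 'p) vec. orthogonal_matrix U}"
  have K1: "mat 1 \<in> ?K" "mat 1 \<in> ?O" using d by (simp_all add: orthogonal_near_identity_def orthogonal_matrix_id)
  have "\<exists>U. U \<in> borel_measurable M \<and> (\<forall>\<omega>\<in>space M. greedy ?K (index_at n \<omega>) (U \<omega>))" for n
    using K1 by (intro measurable_greedy compact_orthogonal_near_identity caratheodory_empirical_index) auto
  then obtain U where U: "\<And>n. U n \<in> borel_measurable M" "\<And>n \<omega>. \<omega> \<in> space M \<Longrightarrow> greedy ?K (index_at n \<omega>) (U n \<omega>)" by metis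
  have "\<exists>U. U \<in> borel_measurable M \<and> (\<forall>\<omega>\<in>space M. greedy ?O (index_at n \<omega>) (U \<omega>))" for n
    using K1 by (intro measurable_greedy compact_orthogonal_matrices caratheodory_empirical_index) auto
  then obtain U' where U': "\<And>n. U' n \<in> borel_measurable M" "\<And>n \<omega>. \<omega> \<in> space M \<Longrightarrow> greedy ?O (index_at n \<omega>) (U' n \<omega>)" by metis
  have lim: "((\<lambda>T. U (fst T) (snd T)) \<longlongrightarrow> mat 1) (prob_filter M)"
    by (rule greedy_tendsto[OF compact_orthogonal_near_identity _ d])
       (use U ident in \<open>auto simp: orthogonal_near_identity_def\<close>)
  define V where "V n \<omega> = (if norm (U n \<omega> - mat 1) < d then U n \<omega> else U' n \<omega>)" for n \<omega>
  have "V n \<in> borel_measurable M" for n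
    unfolding V_def using U(1)[of n] U'(1)[of n] by measurable
  moreover have "((\<lambda>T. V (fst T) (snd T)) \<longlongrightarrow> mat 1) (prob_filter M)"
    by (rule Lim_transform_eventually[OF lim])
       (use tendstoD[OF lim d] in eventually_elim, simp add: V_def dist_norm)
  moreover have "orthogonal_matrix (V n \<omega>)" if "\<omega> \<in> space M" for n \<omega>
    using U(2)[OF that, of n] U'(2)[OF that, of n] by (simp add: V_def greedy_def orthogonal_near_identity_def)
  moreover have "\<exists>\<epsilon>>0. \<forall>u\<in>deflation_sphere (V n \<omega>) k. dist u (row k (V n \<omega>)) < \<epsilon> \<longrightarrow>
        index_at n \<omega> u \<le> index_at n \<omega> (row k (V n \<omega>))" if \<omega>: "\<omega> \<in> space M" for n \<omega> k
  proof (cases "norm (U n \<omega> - mat 1) < d")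
    case True
    have "orthogonal_matrix (U n \<omega>)" using U(2)[OF \<omega>, of n] by (simp add: greedy_def orthogonal_near_identity_def)
    moreover have "V' \<in> ?K" if "orthogonal_matrix V'" "norm (V' - U n \<omega>) < d - norm (U n \<omega> - mat 1)" for V'
      using that norm_triangle_ineq[of "V' - U n \<omega>" "U n \<omega> - mat 1"] by (simp add: orthogonal_near_identity_def)
    ultimately show ?thesis
      using greedy_imp_local_max[OF U(2)[OF \<omega>], of n "d - norm (U n \<omega> - mat 1)" k] True by (simp add: V_def)
  next
    case False
    then show ?thesis using greedy_imp_max[OF U'(2)[OF \<omega>], of _ n k] by (auto simp: V_def intro: exI[of _ 1])
  qed
  ultimately show ?thesis using False by (intro exI[of _ V]) auto
qed

text \<open>The residual of a x^2 + b x^3 after linear regression on 1 and x, divided by d, with a =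
  3 \<alpha> \<gamma>_k and b = 4 (1 - \<alpha>) \<kappa>_k. Under the k-th component it has mean
  zero and is uncorrelated with x.\<close>

definition score :: "'p \<Rightarrow> real \<Rightarrow> real" where
  "score k x = (3 * \<alpha> * gam D k * (x\<^sup>2 - 1 - gam D k * x)
      + 4 * (1 - \<alpha>) * kap D k * (x ^ 3 - gam D k - bet D k * x))
    / (3 * \<alpha> * (gam D k)\<^sup>2 + 4 * (1 - \<alpha>) * (kap D k)\<^sup>2)"

text \<open>Above the diagonal the estimating equation of row k determines the entry and on the
  diagonal whitening does. Below the diagonal the entry is what whitening leaves after subtracting
  the transposed entry.\<close>

definition influence :: "'p \<Rightarrow> 'p \<Rightarrow> (real, 'p) vec \<Rightarrow> real" where
  "influence k l v = (if k < l then score k (v $ k) * v $ l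
     else if k = l then - (1 / 2) * ((v $ k)\<^sup>2 - 1)
     else (-1) * (score l (v $ l) * v $ k) + (-1) * (v $ k * v $ l))"

definition asv :: "'p \<Rightarrow> 'p \<Rightarrow> real" where
  "asv k l = (if l < k then
       (9 * \<alpha>\<^sup>2 * zeta11 D l + 16 * (1 - \<alpha>)\<^sup>2 * zeta22 D l + 24 * \<alpha> * (1 - \<alpha>) * zeta12 D l)
         / (3 * \<alpha> * (gam D l)\<^sup>2 + 4 * (1 - \<alpha>) * (kap D l)\<^sup>2)\<^sup>2 + 1
     else if l = k then (kap D k + 2) / 4
     else
       (9 * \<alpha>\<^sup>2 * zeta11 D k + 16 * (1 - \<alpha>)\<^sup>2 * zeta22 D k + 24 * \<alpha> * (1 - \<alpha>) * zeta12 D k)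
         / (3 * \<alpha> * (gam D k)\<^sup>2 + 4 * (1 - \<alpha>) * (kap D k)\<^sup>2)\<^sup>2)"

lemma denominator_pos:
  assumes "k < l"
  shows "3 * \<alpha> * (gam D k)\<^sup>2 + 4 * (1 - \<alpha>) * (kap D k)\<^sup>2 > 0"
proof -
  have "0 < 3 * component_index \<alpha> D k" using component_index_pos[OF assms] by simp
  also have "\<dots> \<le> 3 * \<alpha> * (gam D k)\<^sup>2 + 4 * (1 - \<alpha>) * (kap D k)\<^sup>2"
    using mult_nonneg_nonneg[of "1 - \<alpha>" "(kap D k)\<^sup>2"] \<alpha> by (simp add: component_index_def algebra_simps)
  finally show ?thesis .
qed

lemma score_polynomial:
  assumes d: "d = 3 * \<alpha> * (gam D k)\<^sup>2 + 4 * (1 - \<alpha>) * (kap D k)\<^sup>2" "d \<noteq> 0"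
    and ab: "a = 3 * \<alpha> * gam D k" "b = 4 * (1 - \<alpha>) * kap D k"
  shows "score k x = - (a + b * gam D k) / d + (- (a * gam D k + b * bet D k) / d) * x + (a / d) * x\<^sup>2 + (b / d) * x ^ 3"
  using d(2) unfolding score_def d(1)[symmetric] ab[symmetric] by (simp add: field_simps)

lemma centered_L2_score:
  assumes "k < l" "m \<noteq> k"
  shows "centered_L2 (\<lambda>v. score k (v $ k) * v $ m)"
proof -
  define d where "d = 3 * \<alpha> * (gam D k)\<^sup>2 + 4 * (1 - \<alpha>) * (kap D k)\<^sup>2"
  have "d \<noteq> 0" using denominator_pos[OF assms(1)] by (simp add: d_def)
  note p = score_polynomial[OF d_def this refl refl]
  have eq: "(c0 + c1 * x + c2 * x\<^sup>2 + c3 * x ^ 3) * y =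
     c0 * (x ^ 0 * y) + (c1 * (x ^ 1 * y) + (c2 * (x ^ 2 * y) + c3 * (x ^ 3 * y)))" for c0 c1 c2 c3 x y :: real
    by (simp add: algebra_simps)
  show ?thesis
    unfolding p eq using assms(2)
    by (intro centered_L2_add centered_L2_cmult centered_L2_monomial) auto
qed

lemma centered_L2_influence: "centered_L2 (influence k l)"
proof (cases k l rule: linorder_cases)
  case less
  then show ?thesis using centered_L2_score[OF less, of l] by (simp add: influence_def[abs_def])
next
  case equal
  then show ?thesis using centered_L2_cmult[OF centered_L2_square[of k], of "- (1 / 2)"] by (simp add: influence_def[abs_def])
next
  case greater
  have "centered_L2 (\<lambda>v. (-1) * (score l (v $ l) * v $ k) + (-1) * ((v $ k) ^ 1 * v $ l))"
    using greater by (intro centered_L2_add centered_L2_cmult centered_L2_monomial centered_L2_score[OF greater]) auto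
  moreover have "\<not> k < l" "k \<noteq> l" using greater by auto
  ultimately show ?thesis by (simp add: influence_def[abs_def])
qed

text \<open>The numerator is the variance of a x^2 + b x^3 after regression on 1 and x, whose three
  parts are the \<zeta> terms. Below the diagonal v_k v_l is added to a term uncorrelated with it,
  hence the extra 1.\<close>

lemma influence_variance: "(\<integral>v. (influence k l v)\<^sup>2 \<partial>D) = asv k l"
proof (cases k l rule: linorder_cases)
  case less
  define d where "d = 3 * \<alpha> * (gam D k)\<^sup>2 + 4 * (1 - \<alpha>) * (kap D k)\<^sup>2"
  define a where "a = 3 * \<alpha> * gam D k"
  define b where "b = 4 * (1 - \<alpha>) * kap D k"
  have d: "d \<noteq> 0" using denominator_pos[OF less] by (simp add: d_def)
  have kl: "k \<noteq> l" using less by simp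
  have inf: "influence k l v = (- (a + b * gam D k) / d + (- (a * gam D k + b * bet D k) / d) * v $ k + (a / d) * (v $ k)\<^sup>2 + (b / d) * (v $ k) ^ 3) * v $ l" for v
    using less by (simp add: influence_def score_polynomial[OF d_def d a_def b_def])
  have "(\<integral>v. (influence k l v)\<^sup>2 \<partial>D) = (- a\<^sup>2 - 2 * a * b * gam D k - b\<^sup>2 * (gam D k)\<^sup>2 - (a * gam D k + b * bet D k)\<^sup>2
      + a\<^sup>2 * bet D k + 2 * a * b * (\<integral>v. (v $ k) ^ 5 \<partial>D) + b\<^sup>2 * (\<integral>v. (v $ k) ^ 6 \<partial>D)) / d\<^sup>2"
    unfolding inf integral_polynomial_square[OF kl] using d
    by (simp add: field_simps power2_eq_square)
  also have "\<dots> = asv k l"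
    unfolding asv_def d_def[symmetric] zeta11_def zeta22_def zeta12_def nu_def omg_def eta_def a_def b_def
    using less by (simp add: gam_def[symmetric] bet_def[symmetric] less_imp_not_less less_imp_neq[symmetric])
       (simp add: algebra_simps power2_eq_square)
  finally show ?thesis .
next
  case equal
  have eq: "(- (1 / 2) * (x\<^sup>2 - 1))\<^sup>2 = (1 / 4) * x ^ 4 - (1 / 2) * x\<^sup>2 + 1 / 4" for x :: real
    by (simp add: power2_eq_square power4_eq_xxxx field_simps)
  have "influence k l = (\<lambda>v. - (1 / 2) * ((v $ k)\<^sup>2 - 1))" using equal by (simp add: influence_def fun_eq_iff)
  then have "(\<integral>v. (influence k l v)\<^sup>2 \<partial>D) = (\<integral>v. (1 / 4) * (v $ k) ^ 4 - (1 / 2) * (v $ k)\<^sup>2 + 1 / 4 \<partial>D)"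
    by (simp only: eq)
  also have "\<dots> = (1 / 4) * bet D k - 1 / 2 + 1 / 4"
    using moment_integrable[of 4 k] moment_integrable[of 2 k] D.prob_space
    by (simp add: bet_def variance_component)
  finally show ?thesis using equal by (simp add: asv_def kap_def)
next
  case greater
  define d where "d = 3 * \<alpha> * (gam D l)\<^sup>2 + 4 * (1 - \<alpha>) * (kap D l)\<^sup>2"
  define a where "a = 3 * \<alpha> * gam D l"
  define b where "b = 4 * (1 - \<alpha>) * kap D l"
  have d: "d \<noteq> 0" using denominator_pos[OF greater] by (simp add: d_def)
  have lk: "l \<noteq> k" using greater by simp
  \<comment> \<open>The whitening term only changes the linear coefficient of the score, by 1; the
    sign disappears in the square.\<close>
  have inf: "(influence k l v)\<^sup>2 = ((- (a + b * gam D l) / d + (1 - (a * gam D l + b * bet D l) / d) * v $ l + (a / d) * (v $ l)\<^sup>2 + (b / d) * (v $ l) ^ 3) * v $ k)\<^sup>2" for v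
  proof -
    have "\<not> k < l" "k \<noteq> l" using greater by auto
    then have "influence k l v = - ((- (a + b * gam D l) / d + (1 - (a * gam D l + b * bet D l) / d) * v $ l + (a / d) * (v $ l)\<^sup>2 + (b / d) * (v $ l) ^ 3) * v $ k)"
      using d by (simp add: influence_def score_polynomial[OF d_def d a_def b_def] field_simps)
    then show ?thesis by (simp only: power2_minus)
  qed
  have "(\<integral>v. (influence k l v)\<^sup>2 \<partial>D) = (- a\<^sup>2 - 2 * a * b * gam D l - b\<^sup>2 * (gam D l)\<^sup>2 - (a * gam D l + b * bet D l)\<^sup>2
      + a\<^sup>2 * bet D l + 2 * a * b * (\<integral>v. (v $ l) ^ 5 \<partial>D) + b\<^sup>2 * (\<integral>v. (v $ l) ^ 6 \<partial>D)) / d\<^sup>2 + 1"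
    unfolding inf integral_polynomial_square[OF lk] using d
    by (simp add: field_simps power2_eq_square)
  also have "\<dots> = asv k l"
    using greater unfolding asv_def d_def[symmetric] zeta11_def zeta22_def zeta12_def nu_def omg_def eta_def a_def b_def
    by (simp add: gam_def[symmetric] bet_def[symmetric])
       (simp add: algebra_simps power2_eq_square)
  finally show ?thesis .
qed

lemma row_mult_sample_isqrt: "(U ** sample_isqrt T) $ k = sample_isqrt T *v (U $ k)"
proof -
  have "sample_isqrt T $ j $ i = sample_isqrt T $ i $ j" for i j
    using transpose_sample_isqrt[of T] by (simp add: transpose_def vec_eq_iff)
  then show ?thesis
    by (simp add: vec_eq_iff matrix_matrix_mult_def matrix_vector_mult_def mult.commute)
qed

lemma std_eq_standardize:
  assumes "positive_definite (sample_cov T)"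
  shows "std T i = standardize (empirical (fst T) (\<lambda>i. z i (snd T))) (z i (snd T))"
  using assms by (simp add: std_def standardize_def sample_isqrt_def sample_cov_def sample_mean_def)

text \<open>The same W serves as local solution and, for decreasing indices, as global maximizer:
  \<open>estimator_exists\<close> delivers both properties for one U.\<close>

theorem deflation_estimator_asymptotics:
  "\<exists>W. sample_version (deflation_solution \<alpha>) M z W \<and>
    (index_decreasing \<alpha> D \<longrightarrow> sample_version (deflation_maximizer \<alpha>) M z W) \<and>
    conv_in_probability M W (mat 1) \<and> asymptotically_normal M W asv"
proof -
  obtain U where U_meas: "\<And>n. U n \<in> borel_measurable M"
    and U_lim: "((\<lambda>T. U (fst T) (snd T)) \<longlongrightarrow> mat 1) (prob_filter M)"
    and U_orth: "\<And>n \<omega>. \<omega> \<in> space M \<Longrightarrow> orthogonal_matrix (U n \<omega>)"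
    and U_local: "\<And>n \<omega> k. \<omega> \<in> space M \<Longrightarrow> \<exists>\<epsilon>>0. \<forall>u\<in>deflation_sphere (U n \<omega>) k. dist u (row k (U n \<omega>)) < \<epsilon> \<longrightarrow>
        index_at n \<omega> u \<le> index_at n \<omega> (row k (U n \<omega>))"
    and U_global: "\<And>n \<omega> k u. \<omega> \<in> space M \<Longrightarrow> index_decreasing \<alpha> D \<Longrightarrow> u \<in> deflation_sphere (U n \<omega>) k \<Longrightarrow>
        index_at n \<omega> u \<le> index_at n \<omega> (row k (U n \<omega>))"
    using estimator_exists by blast
  define W where "W n \<omega> = U n \<omega> ** sample_isqrt (n, \<omega>)" for n \<omega>
  have row: "row k V = V $ k" for k and V :: "((real, 'p) vec, 'p) vec" by (simp add: row_def vec_eq_iff)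
  have U_comp [measurable]: "(\<lambda>\<omega>. U n \<omega> $ k $ l) \<in> borel_measurable M" for n k l
    using U_meas by (intro borel_measurable_vec_nth)
  have sample_isqrt_comp [measurable]: "(\<lambda>\<omega>. sample_isqrt (n, \<omega>) $ k $ l) \<in> borel_measurable M" for n k l
    by (intro borel_measurable_vec_nth sample_isqrt_measurable)
  have W_comp [measurable]: "(\<lambda>\<omega>. W n \<omega> $ k $ l) \<in> borel_measurable M" for n k l
    by (simp add: W_def matrix_matrix_mult_def)
  have W_meas: "W n \<in> borel_measurable M" for n by (intro borel_measurable_vec W_comp)
  have index: "projection_index \<alpha> (empirical n (\<lambda>i. z i \<omega>)) u = index_at n \<omega> u"
    if "invertible (covariance_matrix (empirical n (\<lambda>i. z i \<omega>)))" "norm u = 1" for n \<omega> u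
  proof -
    have "positive_definite (sample_cov (n, \<omega>))" using that(1) by (simp add: positive_definite_sample_cov) (simp add: sample_cov_def)
    from std_eq_standardize[OF this] show ?thesis
      using projection_index_empirical[OF that] by (simp add: empirical_index_def)
  qed
  have W_eq: "W n \<omega> = U n \<omega> ** inv_sqrt (covariance_matrix (empirical n (\<lambda>i. z i \<omega>)))"
    if "invertible (covariance_matrix (empirical n (\<lambda>i. z i \<omega>)))" for n \<omega>
    using that positive_definite_sample_cov[of "(n, \<omega>)"] by (simp add: W_def sample_isqrt_def sample_cov_def)
  have norm_row: "norm (row k (U n \<omega>)) = 1" if "\<omega> \<in> space M" for k n \<omega>
    using orthogonal_row_norm[OF U_orth[OF that]] by (simp add: row)
  have solution: "sample_version (deflation_solution \<alpha>) M z W"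
    unfolding sample_version_def deflation_solution_def
  proof (intro conjI allI ballI impI W_meas)
    fix n \<omega> assume \<omega>: "\<omega> \<in> space M" and inv: "invertible (covariance_matrix (empirical n (\<lambda>i. z i \<omega>)))"
    show "\<exists>V. orthogonal_matrix V \<and> W n \<omega> = V ** inv_sqrt (covariance_matrix (empirical n (\<lambda>i. z i \<omega>))) \<and>
      (\<forall>k. \<exists>\<epsilon>>0. \<forall>u\<in>deflation_sphere V k. dist u (row k V) < \<epsilon> \<longrightarrow>
         projection_index \<alpha> (empirical n (\<lambda>i. z i \<omega>)) u \<le> projection_index \<alpha> (empirical n (\<lambda>i. z i \<omega>)) (row k V))"
    proof (intro exI[of _ "U n \<omega>"] conjI allI)
      fix k
      obtain \<epsilon> where "\<epsilon> > 0" "\<forall>u\<in>deflation_sphere (U n \<omega>) k. dist u (row k (U n \<omega>)) < \<epsilon> \<longrightarrow>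
        index_at n \<omega> u \<le> index_at n \<omega> (row k (U n \<omega>))" using U_local[OF \<omega>] by blast
      then show "\<exists>\<epsilon>>0. \<forall>u\<in>deflation_sphere (U n \<omega>) k. dist u (row k (U n \<omega>)) < \<epsilon> \<longrightarrow>
         projection_index \<alpha> (empirical n (\<lambda>i. z i \<omega>)) u \<le> projection_index \<alpha> (empirical n (\<lambda>i. z i \<omega>)) (row k (U n \<omega>))"
        using index[OF inv norm_row[OF \<omega>]] index[OF inv deflation_sphere_orthogonal(1)[OF U_orth[OF \<omega>]]]
        by (intro exI[of _ \<epsilon>]) simp
    qed (use U_orth[OF \<omega>] W_eq[OF inv] in auto)
  qed
  have maximizer: "sample_version (deflation_maximizer \<alpha>) M z W" if dec: "index_decreasing \<alpha> D"
    unfolding sample_version_def deflation_maximizer_def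
  proof (intro conjI allI ballI impI W_meas)
    fix n \<omega> assume \<omega>: "\<omega> \<in> space M" and inv: "invertible (covariance_matrix (empirical n (\<lambda>i. z i \<omega>)))"
    show "\<exists>V. orthogonal_matrix V \<and> W n \<omega> = V ** inv_sqrt (covariance_matrix (empirical n (\<lambda>i. z i \<omega>))) \<and>
      (\<forall>k. \<forall>u\<in>deflation_sphere V k.
         projection_index \<alpha> (empirical n (\<lambda>i. z i \<omega>)) u \<le> projection_index \<alpha> (empirical n (\<lambda>i. z i \<omega>)) (row k V))"
      using U_global[OF \<omega> dec] U_orth[OF \<omega>] W_eq[OF inv]
        index[OF inv norm_row[OF \<omega>]] index[OF inv deflation_sphere_orthogonal(1)[OF U_orth[OF \<omega>]]]
      by (intro exI[of _ "U n \<omega>"]) simp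
  qed
  have W_lim: "((\<lambda>T. W (fst T) (snd T)) \<longlongrightarrow> mat 1) (prob_filter M)"
  proof (intro vec_tendstoI)
    fix k l
    have "((\<lambda>T. \<Sum>j\<in>UNIV. U (fst T) (snd T) $ k $ j * sample_isqrt T $ j $ l) \<longlongrightarrow> (\<Sum>j\<in>UNIV. mat 1 $ k $ j * mat 1 $ j $ l)) (prob_filter M)"
      by (intro tendsto_sum tendsto_mult tendsto_vec_nth U_lim sample_isqrt_tendsto)
    moreover have "(\<Sum>j\<in>UNIV. mat 1 $ k $ j * mat 1 $ j $ l) = (mat 1 ** mat 1 :: ((real, 'p) vec, 'p) vec) $ k $ l"
      by (simp add: matrix_matrix_mult_def)
    ultimately show "((\<lambda>T. W (fst T) (snd T) $ k $ l) \<longlongrightarrow> mat 1 $ k $ l) (prob_filter M)"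
      by (simp add: W_def matrix_matrix_mult_def[of "U _ _"])
  qed
  \<comment> \<open>Pairing w k with the lifted observation gives row k of U applied to the
    standardized data, so the empirical moments of the projections become values of
    \<open>smom4\<close>.\<close>
  define w where "w k T = lift T (W (fst T) (snd T) $ k)" for k T
  have w_hom: "w k T \<bullet> hom (z i (snd T)) = (U (fst T) (snd T) $ k) \<bullet> std T i" for k T i
    unfolding inner_std w_def W_def by (simp add: row_mult_sample_isqrt)
  have smom4_w: "smom4 T (w i T) (w j T) (w k T) (w l T) = (\<Sum>m<fst T. (U (fst T) (snd T) $ i \<bullet> std T m) * (U (fst T) (snd T) $ j \<bullet> std T m)
      * (U (fst T) (snd T) $ k \<bullet> std T m) * (U (fst T) (snd T) $ l \<bullet> std T m)) / real (fst T)"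
    "smom4 T (w i T) (w j T) (w k T) one_ax = (\<Sum>m<fst T. (U (fst T) (snd T) $ i \<bullet> std T m) * (U (fst T) (snd T) $ j \<bullet> std T m)
      * (U (fst T) (snd T) $ k \<bullet> std T m)) / real (fst T)"
    "smom4 T (w i T) (w j T) one_ax one_ax = (\<Sum>m<fst T. (U (fst T) (snd T) $ i \<bullet> std T m) * (U (fst T) (snd T) $ j \<bullet> std T m)) / real (fst T)"
    "smom4 T (w i T) one_ax one_ax one_ax = (\<Sum>m<fst T. U (fst T) (snd T) $ i \<bullet> std T m) / real (fst T)" for T i j k l
    by (simp_all add: smom4_def avg_def w_hom)
  have W_row_lim: "((\<lambda>T. W (fst T) (snd T) $ k) \<longlongrightarrow> axis k 1) (prob_filter M)" for k
    using tendsto_vec_nth[OF W_lim, of k] by (simp add: mat_1_row)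
  interpret L: linearization M D z w
  proof unfold_locales
    show "(w k \<longlongrightarrow> ax k) (prob_filter M)" for k
      unfolding w_def using lift_tendsto[OF W_row_lim] .
    show "\<forall>\<^sub>F T in prob_filter M. smom4 T (w k T) one_ax one_ax one_ax = 0" for k
      using eventually_positive_definite
    proof eventually_elim
      case (elim T)
      then have "invertible (covariance_matrix (empirical (fst T) (\<lambda>i. z i (snd T))))"
        by (simp add: positive_definite_sample_cov) (simp add: sample_cov_def)
      from sum_standardize[OF this] show ?case by (simp add: smom4_w std_eq_standardize[OF elim])
    qed
    show "\<forall>\<^sub>F T in prob_filter M. smom4 T (w k T) (w l T) one_ax one_ax = (if k = l then 1 else 0)" for k l
      using eventually_positive_definite eventually_prob_filter_space
    proof eventually_elim
      case (elim T)
      then have "invertible (covariance_matrix (empirical (fst T) (\<lambda>i. z i (snd T))))"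
        by (simp add: positive_definite_sample_cov) (simp add: sample_cov_def)
      from sum_standardize_product[OF this] show ?case
        using U_orth[OF elim(2), of "fst T"] by (simp add: smom4_w std_eq_standardize[OF elim(1)] orthogonal_matrix_iff_rows)
    qed
  qed
  \<comment> \<open>Only pairs k < l are possible: turning row k towards the later row l keeps it
    orthogonal to the rows before k, so the competitor stays in the deflation sphere.\<close>
  have est: "\<forall>\<^sub>F T in prob_filter M. 3 * \<alpha> * smom4 T (w k T) (w k T) (w k T) one_ax * smom4 T (w k T) (w k T) (w l T) one_ax
      + 4 * (1 - \<alpha>) * (smom4 T (w k T) (w k T) (w k T) (w k T) - 3) * smom4 T (w k T) (w k T) (w k T) (w l T) = 0"
    if kl: "k < l" for k l
    using eventually_prob_filter_space
  proof eventually_elim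
    case (elim T)
    define n where "n = fst T"
    define \<omega> where "\<omega> = snd T"
    have T: "T = (n, \<omega>)" by (simp add: n_def \<omega>_def)
    have \<omega>: "\<omega> \<in> space M" using elim by (simp add: \<omega>_def)
    let ?V = "U n \<omega>"
    have V: "(?V $ i) \<bullet> (?V $ j) = (if i = j then 1 else 0)" for i j
      using U_orth[OF \<omega>] by (simp add: orthogonal_matrix_iff_rows)
    obtain e where e: "e > 0" "\<And>u. u \<in> deflation_sphere ?V k \<Longrightarrow> dist u (?V $ k) < e \<Longrightarrow> index_at n \<omega> u \<le> index_at n \<omega> (?V $ k)"
      using U_local[OF \<omega>, of n k] by (auto simp: row)
    have "3 * \<alpha> * ((\<Sum>i<n. (?V $ k \<bullet> std T i) ^ 3) / real n) * ((\<Sum>i<n. (?V $ k \<bullet> std T i)\<^sup>2 * (?V $ l \<bullet> std T i)) / real n)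
      + 4 * (1 - \<alpha>) * ((\<Sum>i<n. (?V $ k \<bullet> std T i) ^ 4) / real n - 3) * ((\<Sum>i<n. (?V $ k \<bullet> std T i) ^ 3 * (?V $ l \<bullet> std T i)) / real n) = 0"
      unfolding T
    proof (rule empirical_index_estimating_equation[OF _ _ _ e(1)])
      show "norm (?V $ k) = 1" "norm (?V $ l) = 1" using U_orth[OF \<omega>] by (auto intro: orthogonal_row_norm)
      show "?V $ k \<bullet> ?V $ l = 0" using V kl by simp
      fix \<theta> assume a: "norm (cos \<theta> *\<^sub>R ?V $ k + sin \<theta> *\<^sub>R ?V $ l) = 1" "dist (cos \<theta> *\<^sub>R ?V $ k + sin \<theta> *\<^sub>R ?V $ l) (?V $ k) < e"
      have "cos \<theta> *\<^sub>R ?V $ k + sin \<theta> *\<^sub>R ?V $ l \<in> deflation_sphere ?V k"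
        using a(1) kl V by (auto simp: deflation_sphere_def row inner_add_left)
      then show "index_at n \<omega> (cos \<theta> *\<^sub>R ?V $ k + sin \<theta> *\<^sub>R ?V $ l) \<le> index_at n \<omega> (?V $ k)"
        using a(2) by (rule e(2))
    qed
    then show ?case
      unfolding smom4_w by (simp add: T power2_eq_square power3_eq_cube power4_eq_xxxx)
  qed
  define \<psi> where "\<psi> k a = (case a of None \<Rightarrow> (\<lambda>v. (-1) * v $ k) | Some l \<Rightarrow> influence k l)" for k a
  have \<psi>: "centered_L2 (\<psi> k a)" for k a
    using centered_L2_cmult[OF centered_L2_component[of k], of "-1"]
    by (cases a) (simp_all add: \<psi>_def centered_L2_influence)
  have upper: "(\<lambda>T. L.\<Delta> k (Some l) T - L.root_n T * avg (influence k l) T) \<in> o[prob_filter M](L.error_scale)" if kl: "k < l" for k l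
  proof -
    have "k \<noteq> l" using kl by simp
    from L.estimating_expansion[OF this est[OF kl] refl less_imp_neq[OF denominator_pos[OF kl], symmetric] refl refl]
    show ?thesis using kl by (simp add: influence_def[abs_def] score_def)
  qed
  have approx: "(\<lambda>T. L.\<Delta> k a T - L.root_n T * avg (\<psi> k a) T) \<in> o[prob_filter M](L.error_scale)" for k a
  proof (cases a)
    case None
    have "avg (\<psi> k None) T = - avg (\<lambda>v. v $ k) T" for T
      by (simp add: \<psi>_def avg_def sum_negf)
    then show ?thesis using None L.centering_expansion[of k] by simp
  next
    case (Some l)
    show ?thesis
    proof (cases k l rule: linorder_cases)
      case less then show ?thesis using upper Some by (simp add: \<psi>_def)
    next
      \<comment> \<open>For k = l the whitening expansion contains the diagonal error twice, so half
        of it is the required expansion.\<close>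
      case equal
      have "\<forall>\<^sub>F T in prob_filter M. (1 / 2) * (L.\<Delta> k (Some k) T + L.\<Delta> k (Some k) T + L.root_n T * (avg (\<lambda>v. v $ k * v $ k) T - (if k = k then 1 else 0)))
          = L.\<Delta> k (Some k) T - L.root_n T * avg (influence k k) T"
        using eventually_pos
      proof eventually_elim
        case (elim T)
        have "influence k k = (\<lambda>v. (- (1 / 2)) * (v $ k * v $ k + (-1)))" by (simp add: influence_def fun_eq_iff power2_eq_square)
        then have "avg (influence k k) T = - (1 / 2) * (avg (\<lambda>v. v $ k * v $ k) T + avg (\<lambda>v. -1) T)"
          by (simp only: avg_cmult avg_add)
        moreover have "avg (\<lambda>v. -1) T = -1" using elim by (simp add: avg_def)
        ultimately have e: "avg (influence k k) T = - (1 / 2) * (avg (\<lambda>v. v $ k * v $ k) T + -1)" by (simp only:)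
        show ?case unfolding e by (simp add: algebra_simps)
      qed
      from L.smallo_eventually_cong[OF smallo_cmult[OF L.whitening_expansion[of k k]] this]
      show ?thesis using equal Some by (simp add: \<psi>_def)
    next
      \<comment> \<open>Subtracting the expansion of the transposed entry, which lies above the
        diagonal, from the whitening expansion leaves the entry below it.\<close>
      case greater
      have ne: "\<not> k < l" "k \<noteq> l" using greater by auto
      have e: "avg (influence k l) T = - avg (influence l k) T - avg (\<lambda>v. v $ k * v $ l) T" for T
      proof -
        have "influence k l = (\<lambda>v. (-1) * influence l k v + (-1) * (v $ k * v $ l))"
          using ne greater by (simp add: influence_def fun_eq_iff)
        then show ?thesis by (simp only: avg_add avg_cmult)
      qed
      have eq: "L.\<Delta> k (Some l) T - L.root_n T * avg (influence k l) T =
        (L.\<Delta> l (Some k) T + L.\<Delta> k (Some l) T + L.root_n T * (avg (\<lambda>v. v $ k * v $ l) T - (if k = l then 1 else 0)))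
        - (L.\<Delta> l (Some k) T - L.root_n T * avg (influence l k) T)" for T
        unfolding e using ne by (simp add: algebra_simps)
      have "(\<lambda>T. L.\<Delta> k (Some l) T - L.root_n T * avg (influence k l) T) \<in> o[prob_filter M](L.error_scale)"
        unfolding eq by (rule sum_in_smallo(2)[OF L.whitening_expansion[of l k] upper[OF greater]])
      then show ?thesis using Some by (simp add: \<psi>_def)
    qed
  qed
  have w_meas: "(\<lambda>\<omega>. w k (n, \<omega>) $ a) \<in> borel_measurable M" for n k a
  proof (cases a)
    case None
    have [measurable]: "(\<lambda>\<omega>. sample_mean (n, \<omega>) $ l) \<in> borel_measurable M" for l
      by (intro borel_measurable_vec_nth sample_mean_measurable)
    show ?thesis using None by (simp add: w_def inner_vec_def)
  next
    case (Some l) then show ?thesis by (simp add: w_def)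
  qed
  have remainder: "((\<lambda>T. L.\<Delta> k (Some l) T - L.root_n T * avg (influence k l) T) \<longlongrightarrow> 0) (prob_filter M)" for k l
    using L.linearization_remainder[OF \<psi> approx w_meas, of k "Some l"] by (simp add: \<psi>_def)
  define X where "X n \<omega> = sqrt (real n) *\<^sub>R vectorize (W n \<omega> - mat 1)" for n \<omega>
  have X_nth: "X n \<omega> $ q = sqrt (real n) * (W n \<omega> $ fst q $ snd q - mat 1 $ fst q $ snd q)" for n \<omega> q
    by (simp add: X_def vectorize_def)
  have "X n \<in> borel_measurable M" for n
    by (rule borel_measurable_vec) (simp add: X_nth)
  moreover have "((\<lambda>T. X (fst T) (snd T) $ q - sqrt (real (fst T)) * avg (influence (fst q) (snd q)) T) \<longlongrightarrow> 0) (prob_filter M)" for q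
    using remainder[of "fst q" "snd q"]
    by (simp add: X_nth L.\<Delta>_def L.root_n_def w_def) (simp add: mat_1_row axis_def eq_commute)
  ultimately obtain N where N: "multivariate_normal N" "conv_in_distribution M X N"
    "\<And>q. (\<integral>x. x $ q \<partial>N) = 0 \<and> (\<integral>x. (x $ q)\<^sup>2 \<partial>N) = (\<integral>v. (influence (fst q) (snd q) v)\<^sup>2 \<partial>D)"
    using asymptotic_normality_of_linear_approximation[of "\<lambda>q. influence (fst q) (snd q)" X] centered_L2_influence by blast
  have "asymptotically_normal M W asv"
    unfolding asymptotically_normal_def using N(1,2)
    by (intro exI[of _ N]) (simp add: N(3) influence_variance X_def[abs_def])
  then show ?thesis using solution maximizer conv_in_probabilityI[OF W_lim] by blast
qed

end

text \<open>If a row before the last had index zero, \<open>zero_index_last\<close> would give a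
  later row index zero as well, contradicting the bound on their number.\<close>

lemma card_le_1_component_index_pos:
  fixes D :: "(real^'p::{finite,linorder}) measure"
  assumes "card {k. component_index \<alpha> D k = 0} \<le> 1" "zero_index_last \<alpha> D" "0 \<le> \<alpha>" "\<alpha> \<le> 1" "k < l"
  shows "component_index \<alpha> D k > 0"
proof (rule ccontr)
  assume "\<not> ?thesis"
  then have k: "component_index \<alpha> D k = 0" using component_index_nonneg[OF assms(3,4), of D k] by simp
  then have "component_index \<alpha> D l = 0" using assms(2,5) by (auto simp: zero_index_last_def)
  then have "card {k, l} \<le> card {k. component_index \<alpha> D k = 0}" using k by (intro card_mono) auto
  then show False using assms(1,5) by simp
qed

lemma integrable_sixth_of_eighth_moment:
  assumes "prob_space D" "sets D = sets borel" "integrable D (\<lambda>v :: real^'p. (v $ k) ^ 8)"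
  shows "integrable D (\<lambda>v. (v $ k) ^ 6)"
proof (rule Bochner_Integration.integrable_bound)
  interpret prob_space D by fact
  show "integrable D (\<lambda>v. 1 + (v $ k) ^ 8)" using assms(3) by simp
  have "x ^ 6 \<le> 1 + x ^ 8" for x :: real
  proof (cases "\<bar>x\<bar> \<le> 1")
    case True
    then have "\<bar>x\<bar> ^ 6 \<le> 1" by (intro power_le_one) auto
    then show ?thesis by (simp add: add_increasing2)
  next
    case False
    then have "\<bar>x\<bar> ^ 6 \<le> \<bar>x\<bar> ^ 8" by (intro power_increasing) auto
    then show ?thesis by simp
  qed
  then show "AE v in D. norm ((v $ k) ^ 6) \<le> norm (1 + (v $ k) ^ 8)" by simp
  show "(\<lambda>v. (v $ k) ^ 6) \<in> borel_measurable D" using assms(2) by (simp cong: measurable_cong_sets)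
qed

theorem corollary4p1p1:
  fixes M :: "'a measure"
    and D :: "(real^'p::{finite,linorder}) measure"
    and z :: "nat \<Rightarrow> 'a \<Rightarrow> real^'p::{finite,linorder}"
  assumes "prob_space M"
    and sample: "random_sample M D z"
    and indep: "prob_space.indep_vars D (\<lambda>_. borel) (\<lambda>k v. v $ k) UNIV"
    and mean: "\<And>k. prob_space.expectation D (\<lambda>v. v $ k) = 0"
    and variance: "\<And>k. prob_space.variance D (\<lambda>v. v $ k) = 1"
  shows
    "((\<forall>k. integrable D (\<lambda>v. (v $ k) ^ 6)) \<and>
       card {k. gam D k = 0} \<le> 1 \<and> zero_index_last 1 D \<longrightarrow>
       (\<exists>W. sample_version (deflation_solution 1) M z W \<and>
            (index_decreasing 1 D \<longrightarrow> sample_version (deflation_maximizer 1) M z W) \<and>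
            conv_in_probability M W (mat 1) \<and>
            asymptotically_normal M W (\<lambda>k l.
              if l < k then zeta11 D l / gam D l ^ 4 + 1
              else if l = k then (kap D k + 2) / 4
              else zeta11 D k / gam D k ^ 4)))
     \<and>
     ((\<forall>k. integrable D (\<lambda>v. (v $ k) ^ 8)) \<and>
       card {k. kap D k = 0} \<le> 1 \<and> zero_index_last 0 D \<longrightarrow>
       (\<exists>W. sample_version (deflation_solution 0) M z W \<and>
            (index_decreasing 0 D \<longrightarrow> sample_version (deflation_maximizer 0) M z W) \<and>
            conv_in_probability M W (mat 1) \<and>
            asymptotically_normal M W (\<lambda>k l.
              if l < k then zeta22 D l / kap D l ^ 4 + 1
              else if l = k then (kap D k + 2) / 4
              else zeta22 D k / kap D k ^ 4)))
     \<and>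
     (\<forall>\<alpha>. 0 \<le> \<alpha> \<and> \<alpha> \<le> 1 \<and>
       (\<forall>k. integrable D (\<lambda>v. (v $ k) ^ 8)) \<and>
       card {k. gam D k = 0 \<and> kap D k = 0} \<le> 1 \<and>
       (\<alpha> = 1 \<longrightarrow> card {k. gam D k = 0} \<le> 1) \<and>
       (\<alpha> = 0 \<longrightarrow> card {k. kap D k = 0} \<le> 1) \<and>
       zero_index_last \<alpha> D \<longrightarrow>
       (\<exists>W. sample_version (deflation_solution \<alpha>) M z W \<and>
            (index_decreasing \<alpha> D \<longrightarrow> sample_version (deflation_maximizer \<alpha>) M z W) \<and>
            conv_in_probability M W (mat 1) \<and>
            asymptotically_normal M W (\<lambda>k l.
              if l < k then
                (9 * \<alpha>\<^sup>2 * zeta11 D l + 16 * (1 - \<alpha>)\<^sup>2 * zeta22 D l + 24 * \<alpha> * (1 - \<alpha>) * zeta12 D l)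
                  / (3 * \<alpha> * (gam D l)\<^sup>2 + 4 * (1 - \<alpha>) * (kap D l)\<^sup>2)\<^sup>2 + 1
              else if l = k then (kap D k + 2) / 4
              else
                (9 * \<alpha>\<^sup>2 * zeta11 D k + 16 * (1 - \<alpha>)\<^sup>2 * zeta22 D k + 24 * \<alpha> * (1 - \<alpha>) * zeta12 D k)
                  / (3 * \<alpha> * (gam D k)\<^sup>2 + 4 * (1 - \<alpha>) * (kap D k)\<^sup>2)\<^sup>2)))"
proof -
  interpret iid_sample M D z
    using assms(1) sample by (simp add: iid_sample_def iid_sample_axioms_def)
  \<comment> \<open>The general variance formula; the first two claims are its values at \<alpha> =
    1 and \<alpha> = 0.\<close>
  define A where "A \<alpha> k l = (if l < k then
                (9 * \<alpha>\<^sup>2 * zeta11 D l + 16 * (1 - \<alpha>)\<^sup>2 * zeta22 D l + 24 * \<alpha> * (1 - \<alpha>) * zeta12 D l)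
                  / (3 * \<alpha> * (gam D l)\<^sup>2 + 4 * (1 - \<alpha>) * (kap D l)\<^sup>2)\<^sup>2 + 1
              else if l = k then (kap D k + 2) / 4
              else
                (9 * \<alpha>\<^sup>2 * zeta11 D k + 16 * (1 - \<alpha>)\<^sup>2 * zeta22 D k + 24 * \<alpha> * (1 - \<alpha>) * zeta12 D k)
                  / (3 * \<alpha> * (gam D k)\<^sup>2 + 4 * (1 - \<alpha>) * (kap D k)\<^sup>2)\<^sup>2)" for \<alpha> :: real and k l
  have main: "\<exists>W. sample_version (deflation_solution \<alpha>) M z W \<and>
      (index_decreasing \<alpha> D \<longrightarrow> sample_version (deflation_maximizer \<alpha>) M z W) \<and>
      conv_in_probability M W (mat 1) \<and> asymptotically_normal M W (A \<alpha>)"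
    if \<alpha>: "0 \<le> \<alpha>" "\<alpha> \<le> 1" and m6: "\<And>k. integrable D (\<lambda>v. (v $ k) ^ 6)"
      and card: "card {k. component_index \<alpha> D k = 0} \<le> 1" and last: "zero_index_last \<alpha> D" for \<alpha>
  proof -
    interpret deflation_sample M D z \<alpha>
    proof unfold_locales
      show "(\<integral>v. (v $ k)\<^sup>2 \<partial>D) = 1" for k using variance[of k] by (simp add: mean)
      show "component_index \<alpha> D k > 0" if "k < l" for k l
        by (rule card_le_1_component_index_pos[OF card last \<alpha> that])
    qed (use indep mean m6 \<alpha> in auto)
    show ?thesis using deflation_estimator_asymptotics unfolding asv_def[abs_def] A_def[abs_def] .
  qed
  have m8: "(\<forall>k. integrable D (\<lambda>v. (v $ k) ^ 8)) \<Longrightarrow> integrable D (\<lambda>v. (v $ k) ^ 6)" for k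
    by (rule integrable_sixth_of_eighth_moment[OF prob_space_D sets_D]) blast
  \<comment> \<open>At the endpoints only one weight survives: 9 and 16 are the squares of the
    factors 3 and 4 in the denominator and cancel.\<close>
  have "(9 * x) / (3 * y\<^sup>2)\<^sup>2 = x / y ^ 4" "(16 * x) / (4 * y\<^sup>2)\<^sup>2 = x / y ^ 4" for x y :: real
    by (simp_all add: power_mult_distrib flip: power_mult)
  note frac = this
  have A1: "A 1 = (\<lambda>k l. if l < k then zeta11 D l / gam D l ^ 4 + 1 else if l = k then (kap D k + 2) / 4 else zeta11 D k / gam D k ^ 4)"
    by (intro ext) (simp add: A_def frac)
  have A0: "A 0 = (\<lambda>k l. if l < k then zeta22 D l / kap D l ^ 4 + 1 else if l = k then (kap D k + 2) / 4 else zeta22 D k / kap D k ^ 4)"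
    by (intro ext) (simp add: A_def frac)
  have i: "(\<forall>k. integrable D (\<lambda>v. (v $ k) ^ 6)) \<and> card {k. gam D k = 0} \<le> 1 \<and> zero_index_last 1 D \<longrightarrow>
       (\<exists>W. sample_version (deflation_solution 1) M z W \<and>
            (index_decreasing 1 D \<longrightarrow> sample_version (deflation_maximizer 1) M z W) \<and>
            conv_in_probability M W (mat 1) \<and>
            asymptotically_normal M W (\<lambda>k l.
              if l < k then zeta11 D l / gam D l ^ 4 + 1
              else if l = k then (kap D k + 2) / 4
              else zeta11 D k / gam D k ^ 4))"
    using main[of 1] unfolding A1 by (simp add: component_index_def)
  have ii: "(\<forall>k. integrable D (\<lambda>v. (v $ k) ^ 8)) \<and> card {k. kap D k = 0} \<le> 1 \<and> zero_index_last 0 D \<longrightarrow>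
       (\<exists>W. sample_version (deflation_solution 0) M z W \<and>
            (index_decreasing 0 D \<longrightarrow> sample_version (deflation_maximizer 0) M z W) \<and>
            conv_in_probability M W (mat 1) \<and>
            asymptotically_normal M W (\<lambda>k l.
              if l < k then zeta22 D l / kap D l ^ 4 + 1
              else if l = k then (kap D k + 2) / 4
              else zeta22 D k / kap D k ^ 4))"
    using main[of 0] m8 unfolding A0 by (simp add: component_index_def)
  \<comment> \<open>Strictly between the endpoints both cumulants must vanish for the index to be
    zero. At an endpoint a single cumulant decides, which matches the conditions stated for \<alpha>
    = 0 and \<alpha> = 1.\<close>
  have ci: "component_index \<alpha> D k = 0 \<longleftrightarrow> (if \<alpha> = 1 then gam D k = 0 else if \<alpha> = 0 then kap D k = 0 else gam D k = 0 \<and> kap D k = 0)"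
    if "0 \<le> \<alpha>" "\<alpha> \<le> 1" for \<alpha> k
    using that by (auto simp: component_index_def add_nonneg_eq_0_iff)
  have card: "card {k. component_index \<alpha> D k = 0} \<le> 1"
    if "0 \<le> \<alpha>" "\<alpha> \<le> 1" "card {k. gam D k = 0 \<and> kap D k = 0} \<le> 1"
      "\<alpha> = 1 \<longrightarrow> card {k. gam D k = 0} \<le> 1" "\<alpha> = 0 \<longrightarrow> card {k. kap D k = 0} \<le> 1" for \<alpha>
    using that unfolding ci[OF that(1,2)] by (cases "\<alpha> = 0"; cases "\<alpha> = 1") auto
  show ?thesis
  proof (intro conjI allI impI)
    fix \<alpha> :: real
    assume a: "0 \<le> \<alpha> \<and> \<alpha> \<le> 1 \<and> (\<forall>k. integrable D (\<lambda>v. (v $ k) ^ 8)) \<and>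
       card {k. gam D k = 0 \<and> kap D k = 0} \<le> 1 \<and>
       (\<alpha> = 1 \<longrightarrow> card {k. gam D k = 0} \<le> 1) \<and> (\<alpha> = 0 \<longrightarrow> card {k. kap D k = 0} \<le> 1) \<and> zero_index_last \<alpha> D"
    show "\<exists>W. sample_version (deflation_solution \<alpha>) M z W \<and>
            (index_decreasing \<alpha> D \<longrightarrow> sample_version (deflation_maximizer \<alpha>) M z W) \<and>
            conv_in_probability M W (mat 1) \<and>
            asymptotically_normal M W (\<lambda>k l.
              if l < k then
                (9 * \<alpha>\<^sup>2 * zeta11 D l + 16 * (1 - \<alpha>)\<^sup>2 * zeta22 D l + 24 * \<alpha> * (1 - \<alpha>) * zeta12 D l)
                  / (3 * \<alpha> * (gam D l)\<^sup>2 + 4 * (1 - \<alpha>) * (kap D l)\<^sup>2)\<^sup>2 + 1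
              else if l = k then (kap D k + 2) / 4
              else
                (9 * \<alpha>\<^sup>2 * zeta11 D k + 16 * (1 - \<alpha>)\<^sup>2 * zeta22 D k + 24 * \<alpha> * (1 - \<alpha>) * zeta12 D k)
                  / (3 * \<alpha> * (gam D k)\<^sup>2 + 4 * (1 - \<alpha>) * (kap D k)\<^sup>2)\<^sup>2)"
      by (rule main[unfolded A_def[abs_def]]) (use a card m8 in auto)
  qed (use i ii in \<open>blast+\<close>)
qed

end
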